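(* Four distinct spheres in $\mathbb{R}^3$ have infinitely many common real tangent lines if and only if they have collinear centers and at least one common real tangent line. This means that either all four spheres intersect in a circle, possibly degenerating to a common tangency point, or each sphere has a curve of tangency with one and the same real quadric of revolution with symmetry axis determined by the line passing through all centers; this quadric can be a cone, a cylinder, or a one-sheeted hyperboloid.
   Context: A sphere in $\mathbb{R}^3$ is $\{x:\sum_{i=1}^3(x_i-c_i)^2=r^2\}$ with center $c\in\mathbb{R}^3$ and radius $r>0$. Tangents are real lines in $\mathbb{R}^3$ tangent to the sphere; a common tangent is a line tangent to all four spheres. *)

theory Defs
  imports "HOL-Analysis.Analysis"
begin

definition is_line :: "(real^3) set \<Rightarrow> bool" where
  "is_line l \<longleftrightarrow> (\<exists>a b. a \<noteq> b \<and> l = affine hull {a, b})"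

text \<open>A real line is tangent to a sphere (of positive radius) iff it meets it in exactly one
  point.\<close>

definition tangent_line :: "(real^3) set \<Rightarrow> (real^3) set \<Rightarrow> bool" where
  "tangent_line S l \<longleftrightarrow> is_line l \<and> (\<exists>p. l \<inter> S = {p})"

definition common_tangent_lines :: "('i \<Rightarrow> (real^3) set) \<Rightarrow> (real^3) set set" where
  "common_tangent_lines S = {l. \<forall>i. tangent_line (S i) l}"

definition is_circle :: "(real^3) set \<Rightarrow> bool" where
  "is_circle C \<longleftrightarrow> (\<exists>m n \<rho>. n \<noteq> 0 \<and> \<rho> > 0 \<and> C = {x. (x - m) \<bullet> n = 0} \<inter> sphere m \<rho>)"

text \<open>Velocities at \<open>p\<close> of curves in \<open>S\<close> through \<open>p\<close>. At a regular point of a surface this is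
  the linear tangent plane; at the apex of a cone it is a translate of the cone itself, hence not
  a plane, so that nothing smooth is tangent to a cone at its apex.\<close>

definition tangent_vectors :: "(real^3) set \<Rightarrow> real^3 \<Rightarrow> (real^3) set" where
  "tangent_vectors S p =
     {v. \<exists>g. g 0 = p \<and> (\<forall>t. g t \<in> S) \<and> (g has_vector_derivative v) (at (0::real))}"

definition tangent_at :: "(real^3) set \<Rightarrow> (real^3) set \<Rightarrow> real^3 \<Rightarrow> bool" where
  "tangent_at S T p \<longleftrightarrow> p \<in> S \<and> p \<in> T \<and> tangent_vectors S p = tangent_vectors T p"

definition has_curve_of_tangency :: "(real^3) set \<Rightarrow> (real^3) set \<Rightarrow> bool" where
  "has_curve_of_tangency S T \<longleftrightarrow> (\<exists>g. simple_path g \<and> path_image g = {p. tangent_at S T p})"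

definition quadric :: "(real^3) set \<Rightarrow> bool" where
  "quadric Q \<longleftrightarrow> (\<exists>(A::real^3^3) b d. transpose A = A \<and> A \<noteq> 0 \<and>
     Q = {x. x \<bullet> (A *v x) + b \<bullet> x + d = 0})"

text \<open>The maps \<open>x \<mapsto> M x + t\<close> with \<open>M\<close> a rotation matrix that fix the line \<open>L\<close> pointwise are
  exactly the rotations about \<open>L\<close>.\<close>

definition surface_of_revolution :: "(real^3) set \<Rightarrow> (real^3) set \<Rightarrow> bool" where
  "surface_of_revolution L Q \<longleftrightarrow>
     (\<forall>(M::real^3^3) t. rotation_matrix M \<and> (\<forall>x\<in>L. M *v x + t = x)
        \<longrightarrow> (\<lambda>x. M *v x + t) ` Q = Q)"

definition quadric_of_revolution :: "(real^3) set \<Rightarrow> (real^3) set \<Rightarrow> bool" where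
  "quadric_of_revolution L Q \<longleftrightarrow> quadric Q \<and> surface_of_revolution L Q"

text \<open>Cartesian coordinate systems with origin \<open>m\<close> and third coordinate axis \<open>L\<close>; the normal
  forms below are the usual ones with equal first and second semi-axis.\<close>

definition frame_along ::
    "(real^3) set \<Rightarrow> real^3 \<Rightarrow> real^3 \<Rightarrow> real^3 \<Rightarrow> real^3 \<Rightarrow> bool" where
  "frame_along L m e1 e2 e3 \<longleftrightarrow>
     norm e1 = 1 \<and> norm e2 = 1 \<and> norm e3 = 1 \<and> e1 \<bullet> e2 = 0 \<and> e1 \<bullet> e3 = 0 \<and> e2 \<bullet> e3 = 0 \<and>
     L = {m + s *\<^sub>R e3 | s. True}"

definition cone_of_revolution :: "(real^3) set \<Rightarrow> (real^3) set \<Rightarrow> bool" where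
  "cone_of_revolution L Q \<longleftrightarrow> (\<exists>m e1 e2 e3 a c. frame_along L m e1 e2 e3 \<and> a > 0 \<and> c > 0 \<and>
     Q = {x. ((x - m) \<bullet> e1)\<^sup>2 / a\<^sup>2 + ((x - m) \<bullet> e2)\<^sup>2 / a\<^sup>2 - ((x - m) \<bullet> e3)\<^sup>2 / c\<^sup>2 = 0})"

definition cylinder_of_revolution :: "(real^3) set \<Rightarrow> (real^3) set \<Rightarrow> bool" where
  "cylinder_of_revolution L Q \<longleftrightarrow> (\<exists>m e1 e2 e3 a. frame_along L m e1 e2 e3 \<and> a > 0 \<and>
     Q = {x. ((x - m) \<bullet> e1)\<^sup>2 / a\<^sup>2 + ((x - m) \<bullet> e2)\<^sup>2 / a\<^sup>2 = 1})"

definition one_sheeted_hyperboloid_of_revolution ::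
    "(real^3) set \<Rightarrow> (real^3) set \<Rightarrow> bool" where
  "one_sheeted_hyperboloid_of_revolution L Q \<longleftrightarrow>
     (\<exists>m e1 e2 e3 a c. frame_along L m e1 e2 e3 \<and> a > 0 \<and> c > 0 \<and>
     Q = {x. ((x - m) \<bullet> e1)\<^sup>2 / a\<^sup>2 + ((x - m) \<bullet> e2)\<^sup>2 / a\<^sup>2 - ((x - m) \<bullet> e3)\<^sup>2 / c\<^sup>2 = 1})"

definition meet_in_circle_or_tangency_point :: "('i \<Rightarrow> (real^3) set) \<Rightarrow> bool" where
  "meet_in_circle_or_tangency_point S \<longleftrightarrow>
     is_circle (\<Inter>i. S i) \<or>
     (\<exists>p. (\<Inter>i. S i) = {p} \<and> (\<forall>i j. tangent_at (S i) (S j) p))"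

definition tangent_to_common_quadric_of_revolution ::
    "(real^3) set \<Rightarrow> ('i \<Rightarrow> (real^3) set) \<Rightarrow> bool" where
  "tangent_to_common_quadric_of_revolution L S \<longleftrightarrow>
     (\<exists>Q. quadric_of_revolution L Q \<and>
        (cone_of_revolution L Q \<or> cylinder_of_revolution L Q \<or>
         one_sheeted_hyperboloid_of_revolution L Q) \<and>
        (\<forall>i. has_curve_of_tangency (S i) Q))"

end

theory Submission
  imports Defs
    "HOL-Computational_Algebra.Polynomial_Factorial"
    "HOL-Computational_Algebra.Fundamental_Theorem_Algebra"
    "HOL-Computational_Algebra.Field_as_Ring"
    "HOL-Complex_Analysis.Contour_Integration"
begin

text \<open>
  Fix one center as origin and encode a line by a unit direction \<open>v\<close> and its point \<open>P\<close> with
  \<open>P \<bullet> v = 0\<close>. Subtracting the tangency condition of the first sphere, \<open>P \<bullet> P = r\<^sub>0\<^sup>2\<close>, from the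
  others gives \<open>2 a\<^sub>i \<bullet> P = k\<^sub>i - (a\<^sub>i \<bullet> v)\<^sup>2\<close>. If the centers are affinely independent, \<open>P\<close> is a
  quadratic function of \<open>v\<close>, and \<open>v\<close> lies on a cubic and a quartic. A common component of the two
  curves would meet the isotropic conic \<open>v \<bullet> v = 0\<close>; but there every \<open>a\<^sub>i \<bullet> v\<close> lies in \<open>{0, \<lambda>}\<close>, so
  \<open>v\<close> is a complex multiple of a real vector, which is impossible. For coplanar centers, no three of
  them collinear, the two coordinates \<open>a\<^sub>1 \<bullet> v\<close>, \<open>a\<^sub>2 \<bullet> v\<close> lie on a nondegenerate conic and a sextic,
  and a branch of the conic at infinity is not contained in the sextic. With exactly three collinear
  centers the elimination ends in a quartic for one coordinate of \<open>v\<close>. Hence infinitely many tangents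
  force collinear centers; conversely, a common tangent can be rotated about the line of centers,
  and it sweeps out a plane or a quadric of revolution.
\<close>

section \<open>Common zeros of two bivariate polynomials\<close>

text \<open>The radii enter only through the constants \<open>k\<^sub>i\<close> and
  \<open>r\<^sub>0\<^sup>2\<close>. Since \<open>v \<bullet> v = 1\<close>, these can be multiplied
  by powers of \<open>v \<bullet> v\<close> to make the equations homogeneous in \<open>v\<close>;
  on the isotropic conic they all drop out, so the zeros there depend on the centers alone. Real
  vectors do not see this conic. The sphere is therefore complexified: stereographic projection
  gives two independent complex coordinates \<open>x\<close>, \<open>y\<close>, conjugate to each
  other at real points, and the conic becomes \<open>1 + x * y = 0\<close>. A curve of bidegree
  \<open>(a, b)\<close> meets it in \<open>a + b\<close> points, so a nonconstant common factor
  cannot avoid it. The case split is forced by \<open>P\<close>: for coplanar centers the linear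
  equations leave the component of \<open>P\<close> normal to their plane open. Only its square is
  known, so \<open>P \<bullet> v = 0\<close> has to be squared; the products of highest degree then
  cancel, which keeps the degree low. With exactly three collinear centers the conic of the coplanar
  case loses its discriminant, hence the separate elimination.\<close>

definition poly2 :: "'a::comm_ring_1 poly poly \<Rightarrow> 'a \<Rightarrow> 'a \<Rightarrow> 'a" where
  "poly2 p x y = poly (poly p [:y:]) x"

lemma poly2_simps [simp]:
  "poly2 0 x y = 0" "poly2 1 x y = 1"
  "poly2 (p + q) x y = poly2 p x y + poly2 q x y"
  "poly2 (p - q) x y = poly2 p x y - poly2 q x y"
  "poly2 (- p) x y = - poly2 p x y"
  "poly2 (p * q) x y = poly2 p x y * poly2 q x y"
  "poly2 (p ^ n) x y = poly2 p x y ^ n"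
  "poly2 (pCons c p) x y = poly c x + y * poly2 p x y"
  by (simp_all add: poly2_def poly_power algebra_simps)

lemma poly2_altdef: "poly2 p x y = (\<Sum>i\<le>degree p. poly (coeff p i) x * y ^ i)"
proof -
  have e: "[:y:] ^ i = [:y ^ i:]" for i
    by (induction i) (auto simp: one_pCons)
  show ?thesis
    by (simp add: poly2_def poly_altdef[of p] poly_sum e mult.commute)
qed

text \<open>Elimination by least degree: by pseudo-division, a nonzero element \<open>d\<close> of
  least degree in \<open>y\<close> in the ideal of \<open>f\<close> and \<open>g\<close> divides
  every element of the ideal up to a factor free of \<open>y\<close>. Coprimality forces
  \<open>d\<close> itself to be free of \<open>y\<close>, and its roots contain the first
  coordinates of all common zeros.\<close>

lemma coprime_finite_common_zeros:
  fixes f g :: "'a::field_gcd poly poly"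
  assumes cop: "coprime f g"
  shows "finite {x. \<exists>y. poly2 f x y = 0 \<and> poly2 g x y = 0}"
proof -
  define I where "I = {a * f + b * g | a b. True}"
  have fI: "f \<in> I" and gI: "g \<in> I"
    unfolding I_def using mult_1[of f] mult_1[of g] mult_zero_left[of f] mult_zero_left[of g] add_0_left[of g] add_0_right[of f]
    by (auto, metis, metis)
  have Isub: "smult c u - w * v \<in> I" if "u \<in> I" "v \<in> I" for u v w c
  proof -
    from that obtain a b a' b' where "u = a * f + b * g" "v = a' * f + b' * g"
      unfolding I_def by auto
    then have "smult c u - w * v = (smult c a - w * a') * f + (smult c b - w * b') * g"
      by (simp add: algebra_simps smult_add_right)
    then show ?thesis unfolding I_def by blast
  qed
  have "f \<noteq> 0 \<or> g \<noteq> 0" using cop by auto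
  then obtain d0 where "d0 \<in> I \<and> d0 \<noteq> 0" using fI gI by auto
  then obtain d where d: "d \<in> I" "d \<noteq> 0" and
    dmin: "\<And>e. e \<in> I \<Longrightarrow> e \<noteq> 0 \<Longrightarrow> degree d \<le> degree e"
    using ex_has_least_nat[of "\<lambda>d. d \<in> I \<and> d \<noteq> 0" d0 degree] by auto
  have div: "\<exists>c. c \<noteq> 0 \<and> d dvd smult c u" if "u \<in> I" for u
  proof -
    obtain q r where qr: "pseudo_divmod u d = (q, r)" by force
    define c where "c = coeff d (degree d) ^ (Suc (degree u) - degree d)"
    have eq: "smult c u = d * q + r" and r: "r = 0 \<or> degree r < degree d"
      using pseudo_divmod[OF d(2) qr] by (auto simp: c_def)
    have "r = smult c u - q * d" using eq by (simp add: algebra_simps)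
    then have "r \<in> I" using Isub[OF that d(1)] by simp
    with r dmin have "r = 0" by fastforce
    with eq have "d dvd smult c u" by simp
    moreover have "c \<noteq> 0" using d(2) by (simp add: c_def)
    ultimately show ?thesis by blast
  qed
  have "degree d = 0"
  proof (rule ccontr)
    assume dd: "degree d \<noteq> 0"
    \<comment> \<open>The prime factors of the primitive part have positive degree in
      \<open>y\<close>. Such a prime cannot divide the factor \<open>c\<close> left by
      pseudo-division, so it divides every element of the ideal.\<close>
    define e where "e = primitive_part d"
    have e: "content e = 1" "degree e \<noteq> 0" "e \<noteq> 0" "e dvd d"
      using d(2) dd by (auto simp: e_def)
        (metis content_times_primitive_part dvd_smult dvd_refl)
    then have "\<not> is_unit e" by (auto simp: is_unit_poly_iff)
    then obtain p where p: "prime p" "p dvd e"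
      using e prime_divisor_exists by blast
    have "degree p \<noteq> 0"
    proof
      assume "degree p = 0"
      then obtain k where k: "p = [:k:]" by (rule degree_eq_zeroE)
      with p e(1) have "is_unit k" by (simp add: const_poly_dvd_iff_dvd_content)
      then have "is_unit p" using k by (simp add: is_unit_poly_iff)
      with p(1) show False by auto
    qed
    have pdvd: "p dvd u" if u: "u \<in> I" for u
    proof -
      obtain c where c: "c \<noteq> 0" "d dvd smult c u" using div[OF u] by blast
      then have "p dvd [:c:] * u" using p e(4) by (auto dest: dvd_trans)
      then have "p dvd [:c:] \<or> p dvd u" using p(1) by (simp add: prime_dvd_mult_iff del: mult_pCons_left)
      moreover have "\<not> p dvd [:c:]"
        using \<open>degree p \<noteq> 0\<close> c(1) by (auto dest!: dvd_imp_degree_le)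
      ultimately show ?thesis by blast
    qed
    have "is_unit p" using pdvd[OF fI] pdvd[OF gI] cop by (rule coprime_common_divisor[rotated])
    with p(1) show False by auto
  qed
  then obtain R where R: "d = [:R:]" by (rule degree_eq_zeroE)
  with d have "R \<noteq> 0" by auto
  obtain a b where ab: "[:R:] = a * f + b * g" using d(1) R unfolding I_def by auto
  have "poly R x = 0" if "poly2 f x y = 0" "poly2 g x y = 0" for x y
    using arg_cong[OF ab, of "\<lambda>p. poly2 p x y"] that by simp
  then have "{x. \<exists>y. poly2 f x y = 0 \<and> poly2 g x y = 0} \<subseteq> {x. poly R x = 0}" by auto
  then show ?thesis using poly_roots_finite[OF \<open>R \<noteq> 0\<close>] finite_subset by blast
qed

text \<open>The restriction of a polynomial of degree at most \<open>b\<close> in \<open>y\<close> to the curve \<open>1 + x y = 0\<close>,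
  cleared of denominators by the factor \<open>x ^ b\<close>. Under stereographic projection this curve is the
  isotropic conic.\<close>

definition antidiag :: "nat \<Rightarrow> complex poly poly \<Rightarrow> complex poly" where
  "antidiag b p = (\<Sum>i\<le>b. monom ((-1) ^ i) (b - i) * coeff p i)"

lemma poly_antidiag:
  assumes "degree p \<le> b" "x \<noteq> 0"
  shows "poly (antidiag b p) x = x ^ b * poly2 p x (- 1 / x)"
proof -
  have "poly2 p x (- 1 / x) = (\<Sum>i\<le>b. poly (coeff p i) x * (- 1 / x) ^ i)"
    unfolding poly2_altdef using assms(1)
    by (intro sum.mono_neutral_left) (auto simp: coeff_eq_0)
  then have "x ^ b * poly2 p x (- 1 / x) = (\<Sum>i\<le>b. x ^ b * (poly (coeff p i) x * (- 1 / x) ^ i))"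
    by (simp add: sum_distrib_left)
  also have "\<dots> = (\<Sum>i\<le>b. (-1) ^ i * x ^ (b - i) * poly (coeff p i) x)"
    using assms(2) by (intro sum.cong) (auto simp: power_diff power_minus[of "1 / x"] power_one_over field_simps)
  finally show ?thesis by (simp add: antidiag_def poly_sum poly_monom)
qed

lemma poly_eqI_nonzero:
  fixes p q :: "complex poly"
  assumes "\<And>x. x \<noteq> 0 \<Longrightarrow> poly p x = poly q x"
  shows "p = q"
proof (rule ccontr)
  assume "p \<noteq> q"
  then have "finite {x. poly (p - q) x = 0}" by (intro poly_roots_finite) simp
  moreover have "UNIV - {0} \<subseteq> {x. poly (p - q) x = 0}" using assms by auto
  ultimately have "finite (UNIV - {0::complex})" by (rule rev_finite_subset)
  then show False by (simp add: infinite_UNIV_char_0)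
qed

lemma antidiag_mult:
  assumes "degree p \<le> b" "degree q \<le> c"
  shows "antidiag (b + c) (p * q) = antidiag b p * antidiag c q"
proof (rule poly_eqI_nonzero)
  fix x :: complex assume "x \<noteq> 0"
  moreover have "degree (p * q) \<le> b + c"
    using degree_mult_le[of p q] assms by linarith
  ultimately show "poly (antidiag (b + c) (p * q)) x = poly (antidiag b p * antidiag c q) x"
    using assms by (simp add: poly_antidiag power_add)
qed

lemma degree_antidiag_le:
  assumes "\<And>i. degree (coeff p i) \<le> a"
  shows "degree (antidiag b p) \<le> a + b"
  unfolding antidiag_def
proof (rule degree_sum_le)
  fix i assume "i \<in> {..b}"
  have "degree (monom ((-1) ^ i) (b - i) * coeff p i) \<le> degree (monom ((-1) ^ i :: complex) (b - i)) + degree (coeff p i)"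
    by (rule degree_mult_le)
  also have "\<dots> \<le> b + a" using assms[of i] by (intro add_mono) (auto intro: order.trans[OF degree_monom_le])
  finally show "degree (monom ((-1) ^ i) (b - i) * coeff p i) \<le> a + b" by simp
qed simp

text \<open>\<open>a\<close> is the degree in \<open>x\<close>, which the type of \<open>h\<close>
  hides in the coefficients. Fixing a value of \<open>y\<close> turns it into an ordinary degree,
  which drops only at the roots of the coefficient \<open>l\<close> of \<open>x ^ a\<close>.\<close>

lemma generic_inner_degree:
  fixes h :: "'a::field poly poly"
  assumes "h \<noteq> 0"
  obtains a where "\<And>i. degree (coeff h i) \<le> a" "finite {y. degree (poly h [:y:]) \<noteq> a}"
proof -
  define a where "a = Max ((\<lambda>i. degree (coeff h i)) ` {..degree h})"
  have le: "degree (coeff h i) \<le> a" for i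
    by (cases "i \<le> degree h") (auto simp: a_def coeff_eq_0)
  have "a \<in> (\<lambda>i. degree (coeff h i)) ` {..degree h}"
    unfolding a_def by (rule Max_in) auto
  then obtain i where i: "i \<le> degree h" "degree (coeff h i) = a" by auto
  have e: "[:y:] ^ i = [:y ^ i:]" for i and y :: 'a
    by (induction i) (auto simp: one_pCons)
  have dle: "degree (poly h [:y:]) \<le> a" for y
    unfolding poly_altdef e
    by (rule degree_sum_le) (auto intro!: order.trans[OF degree_smult_le] le)
  define l where "l = map_poly (\<lambda>c. coeff c a) h"
  have cl: "coeff l j = coeff (coeff h j) a" for j by (simp add: l_def coeff_map_poly)
  have pl: "poly l y = coeff (poly h [:y:]) a" for y
  proof -
    have "poly l y = (\<Sum>j\<le>degree h. coeff l j * y ^ j)"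
      unfolding poly_altdef[of l]
    proof (rule sum.mono_neutral_left)
      show "{..degree l} \<subseteq> {..degree h}"
        using degree_le[of "degree h" l] by (auto simp: cl coeff_eq_0)
    qed (auto simp: coeff_eq_0)
    also have "\<dots> = coeff (poly h [:y:]) a"
      by (simp add: poly_altdef[of h] e coeff_sum cl mult.commute)
    finally show ?thesis .
  qed
  have "l \<noteq> 0"
  \<comment> \<open>For \<open>a = 0\<close> the index \<open>i\<close> may belong to a zero
    coefficient, because \<open>0\<close> also has degree \<open>0\<close>; the leading coefficient
    of \<open>h\<close> is used instead.\<close>
  proof (cases "a = 0")
    case False
    then have "coeff l i \<noteq> 0" unfolding cl using i(2) by (metis degree_0 leading_coeff_0_iff)
    then show ?thesis by auto
  next
    case True
    have "degree (coeff h (degree h)) = 0" using le[of "degree h"] True by simp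
    then have "coeff l (degree h) \<noteq> 0" unfolding cl True using assms
      by (metis leading_coeff_0_iff)
    then show ?thesis by auto
  qed
  then have "finite {y. poly l y = 0}" by (rule poly_roots_finite)
  moreover have "{y. degree (poly h [:y:]) \<noteq> a} \<subseteq> {y. poly l y = 0}"
    using dle unfolding pl by (auto simp: coeff_eq_0 le_neq_implies_less)
  ultimately show ?thesis using that le finite_subset by blast
qed

text \<open>The degree in \<open>x\<close> is additive: at a value of \<open>y\<close> outside a
  finite set both factors specialise to their full degree, and there the degrees of ordinary
  polynomials add.\<close>

lemma inner_degree_mult:
  fixes h h' :: "complex poly poly"
  assumes "h \<noteq> 0" "h' \<noteq> 0" and n: "\<And>i. degree (coeff (h * h') i) \<le> n"
  obtains a a' where "\<And>i. degree (coeff h i) \<le> a" "\<And>i. degree (coeff h' i) \<le> a'" "a + a' \<le> n"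
proof -
  obtain a where a: "\<And>i. degree (coeff h i) \<le> a" "finite {y. degree (poly h [:y:]) \<noteq> a}"
    using generic_inner_degree[OF assms(1)] by blast
  obtain a' where a': "\<And>i. degree (coeff h' i) \<le> a'" "finite {y. degree (poly h' [:y:]) \<noteq> a'}"
    using generic_inner_degree[OF assms(2)] by blast
  have "h * h' \<noteq> 0" using assms by simp
  then obtain b where b: "\<And>i. degree (coeff (h * h') i) \<le> b" "finite {y. degree (poly (h * h') [:y:]) \<noteq> b}"
    using generic_inner_degree by blast
  have fz: "finite {y. poly p [:y:] = 0}" if "p \<noteq> 0" for p :: "complex poly poly"
  proof -
    have "finite {c. poly p c = 0}" using that by (rule poly_roots_finite)
    then have "finite ((\<lambda>y. [:y:]) -` {c. poly p c = 0})"
      by (rule finite_vimageI) (simp add: inj_def)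
    then show ?thesis by (simp add: vimage_def)
  qed
  have "finite ({y. degree (poly h [:y:]) \<noteq> a} \<union> {y. degree (poly h' [:y:]) \<noteq> a'}
     \<union> {y. poly h [:y:] = 0} \<union> {y. poly h' [:y:] = 0})" (is "finite ?B")
    using a a' fz assms by auto
  from ex_new_if_finite[OF infinite_UNIV_char_0 this] obtain y where "y \<notin> ?B" ..
  then have y: "degree (poly h [:y:] * poly h' [:y:]) = a + a'"
    by (simp add: degree_mult_eq)
  have e: "[:y:] ^ i = [:y ^ i:]" for i
    by (induction i) (auto simp: one_pCons)
  have "degree (poly (h * h') [:y:]) \<le> n"
    unfolding poly_altdef e
    by (rule degree_sum_le) (auto intro!: order.trans[OF degree_smult_le] n)
  with y have "a + a' \<le> n" by simp
  with a(1) a'(1) show ?thesis using that by blast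
qed

text \<open>A common factor of bidegree \<open>(a, b)\<close> restricts to the curve \<open>1 + x y = 0\<close> as a form of degree
  \<open>a + b\<close>, so it would have a zero there; \<open>inf\<close> excludes a zero at \<open>x = \<infinity>\<close>.\<close>

theorem finite_common_zeros_antidiag:
  fixes F G :: "complex poly poly"
  assumes F: "degree F \<le> m" "\<And>i. degree (coeff F i) \<le> m"
    and G: "degree G \<le> n" "\<And>i. degree (coeff G i) \<le> n"
    and nz: "\<And>x. poly (antidiag m F) x \<noteq> 0 \<or> poly (antidiag n G) x \<noteq> 0"
    and inf: "coeff (antidiag m F) (2 * m) \<noteq> 0 \<or> coeff (antidiag n G) (2 * n) \<noteq> 0"
  shows "finite {x. \<exists>y. poly2 F x y = 0 \<and> poly2 G x y = 0}"
proof -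
  have a0: "antidiag k 0 = 0" for k by (simp add: antidiag_def)
  have FG: "F \<noteq> 0 \<or> G \<noteq> 0" using nz[of 0] a0 by auto
  define h where "h = gcd F G"
  have h0: "h \<noteq> 0" using FG by (simp add: h_def)
  then obtain F' G' where FG': "F = F' * h" "G = G' * h" "coprime F' G'"
    using gcd_coprime_exists[of F G] unfolding h_def by blast
  define b where "b = degree h"
  define k where "k = antidiag b h"
  have split: "b \<le> m \<and> degree P' \<le> m - b \<and> antidiag m P = antidiag (m - b) P' * k"
    if "P = P' * h" "degree P \<le> m" "P \<noteq> 0" for P P' m
  proof -
    have "P' \<noteq> 0" using that by auto
    then have d: "degree P' + b \<le> m"
      using that h0 by (simp add: degree_mult_eq b_def)
    then show ?thesis using antidiag_mult[of P' "m - b" h b] that(1) by (auto simp: k_def b_def)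
  qed
  have dvd: "k dvd antidiag m P" if "P = P' * h" "degree P \<le> m" for P P' m
    using split[OF that] a0 by (cases "P = 0") auto
  \<comment> \<open>\<open>k\<close> divides both restrictions, so a zero of \<open>k\<close> would
    be common to them. A complex polynomial without zeros is constant.\<close>
  have "poly k x \<noteq> 0" for x
    using nz[of x] dvd[OF FG'(1) F(1)] dvd[OF FG'(2) G(1)] by (auto elim!: dvdE)
  then have k0: "degree k = 0"
    using fundamental_theorem_of_algebra[of k] constant_degree by blast
  have main: "h \<in> {[:[:c:]:] | c. c \<noteq> 0}"
    if P: "P = P' * h" "degree P \<le> m" "\<And>i. degree (coeff P i) \<le> m"
      and c: "coeff (antidiag m P) (2 * m) \<noteq> 0" for P P' m
  proof -
    have "P \<noteq> 0" using c a0 by auto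
    note s = split[OF P(1,2) this]
    have "P' \<noteq> 0" using P(1) \<open>P \<noteq> 0\<close> by auto
    then obtain a a' where a: "\<And>i. degree (coeff P' i) \<le> a" "\<And>i. degree (coeff h i) \<le> a'" "a + a' \<le> m"
      using inner_degree_mult[OF _ h0, of P' m] P by blast
    \<comment> \<open>The restriction of \<open>P\<close> has full degree \<open>2 * m\<close>, but
      the cofactor of \<open>h\<close> contributes at most \<open>a + (m - b)\<close> and the
      constant \<open>k\<close> nothing. With \<open>a + a' \<le> m\<close> this leaves
      \<open>a' = b = 0\<close>, so \<open>h\<close> is constant.\<close>
    have "2 * m \<le> degree (antidiag m P)" using c by (rule le_degree)
    also have "\<dots> \<le> degree (antidiag (m - b) P') + degree k" using s by (simp add: degree_mult_le)
    also have "\<dots> \<le> a + (m - b)" using degree_antidiag_le[of P' a "m - b"] a k0 by simp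
    finally have "b = 0" "a' = 0" using a(3) s by auto
    then obtain c where c: "h = [:c:]" unfolding b_def by (metis degree_eq_zeroE)
    have "degree c = 0" using a(2)[of 0] \<open>a' = 0\<close> c by simp
    then obtain e where "c = [:e:]" by (rule degree_eq_zeroE)
    with c h0 show ?thesis by auto
  qed
  obtain c where c: "h = [:[:c:]:]" "c \<noteq> 0"
    using inf main[OF FG'(1) F] main[OF FG'(2) G] by auto
  have "{x. \<exists>y. poly2 F x y = 0 \<and> poly2 G x y = 0} = {x. \<exists>y. poly2 F' x y = 0 \<and> poly2 G' x y = 0}"
    unfolding FG'(1,2) c(1) poly2_simps using c(2) by simp
  then show ?thesis using coprime_finite_common_zeros[OF FG'(3)] by simp
qed

text \<open>A form of degree \<open>n\<close> in a unit vector, cleared of denominators, has degree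
  at most \<open>n\<close> in each stereographic coordinate; hence one bound for both
  variables.\<close>

definition bideg_le :: "nat \<Rightarrow> 'a::comm_ring_1 poly poly \<Rightarrow> bool" where
  "bideg_le n p \<longleftrightarrow> degree p \<le> n \<and> (\<forall>i. degree (coeff p i) \<le> n)"

lemma bideg_le_add: "bideg_le n p \<Longrightarrow> bideg_le n q \<Longrightarrow> bideg_le n (p + q)"
  and bideg_le_diff: "bideg_le n p \<Longrightarrow> bideg_le n q \<Longrightarrow> bideg_le n (p - q)"
  by (auto simp: bideg_le_def intro: degree_add_le degree_diff_le)

lemma bideg_le_const: "bideg_le n [:[:c:]:]"
  by (auto simp: bideg_le_def coeff_pCons split: nat.splits)

lemma bideg_le_mult:
  assumes "bideg_le m p" "bideg_le n q"
  shows "bideg_le (m + n) (p * q)"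
  unfolding bideg_le_def
proof
  show "degree (p * q) \<le> m + n"
    using degree_mult_le[of p q] assms by (auto simp: bideg_le_def)
  show "\<forall>i. degree (coeff (p * q) i) \<le> m + n"
    unfolding coeff_mult using assms
    by (auto simp: bideg_le_def intro!: degree_sum_le order.trans[OF degree_mult_le] add_mono)
qed

lemma bideg_le_power: "bideg_le n p \<Longrightarrow> bideg_le (k * n) (p ^ k)"
proof (induction k)
  case 0
  then show ?case using bideg_le_const[of 0 1] by (simp add: one_pCons)
next
  case (Suc k)
  then show ?case using bideg_le_mult[of n p "k * n" "p ^ k"] by simp
qed

lemma coeff_mult_top:
  fixes p q :: "'a::comm_semiring_0 poly"
  assumes "degree p \<le> m" "degree q \<le> n"
  shows "coeff (p * q) (m + n) = coeff p m * coeff q n"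
proof -
  have "coeff (p * q) (m + n) = (\<Sum>i\<le>m + n. coeff p i * coeff q (m + n - i))"
    by (rule coeff_mult)
  also have "\<dots> = (\<Sum>i\<in>{m}. coeff p i * coeff q (m + n - i))"
  proof (rule sum.mono_neutral_right)
    show "\<forall>i\<in>{..m + n} - {m}. coeff p i * coeff q (m + n - i) = 0"
    proof
      fix i assume "i \<in> {..m + n} - {m}"
      then have "i > m \<or> m + n - i > n" by auto
      then show "coeff p i * coeff q (m + n - i) = 0"
        using assms by (auto simp: coeff_eq_0)
    qed
  qed auto
  finally show ?thesis by simp
qed

text \<open>Cramer's rule: the dual vectors are cross products of two of the given vectors, divided
  by the triple product.\<close>

lemma dual_basis:
  fixes a1 a2 a3 :: "real^3"
  assumes "a1 \<bullet> (cross3 a2 a3) \<noteq> 0"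
  obtains d1 d2 d3 where
    "\<And>v. v = (a1 \<bullet> v) *\<^sub>R d1 + (a2 \<bullet> v) *\<^sub>R d2 + (a3 \<bullet> v) *\<^sub>R d3"
    "a1 \<bullet> d1 = 1" "a1 \<bullet> d2 = 0" "a1 \<bullet> d3 = 0"
    "a2 \<bullet> d1 = 0" "a2 \<bullet> d2 = 1" "a2 \<bullet> d3 = 0"
    "a3 \<bullet> d1 = 0" "a3 \<bullet> d2 = 0" "a3 \<bullet> d3 = 1"
proof -
  define D where "D = a1 \<bullet> (cross3 a2 a3)"
  have D: "D \<noteq> 0" using assms D_def by simp
  have D1: "a1 \<bullet> (cross3 a2 a3) = D" "a2 \<bullet> (cross3 a3 a1) = D" "a3 \<bullet> (cross3 a1 a2) = D"
    by (simp_all add: D_def cross3_simps)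
  have exp: "v = (a1 \<bullet> v) *\<^sub>R ((1 / D) *\<^sub>R (cross3 a2 a3)) + (a2 \<bullet> v) *\<^sub>R ((1 / D) *\<^sub>R (cross3 a3 a1)) + (a3 \<bullet> v) *\<^sub>R ((1 / D) *\<^sub>R (cross3 a1 a2))" for v
  proof -
    have "D *\<^sub>R v = (a1 \<bullet> v) *\<^sub>R (cross3 a2 a3) + (a2 \<bullet> v) *\<^sub>R (cross3 a3 a1) + (a3 \<bullet> v) *\<^sub>R (cross3 a1 a2)"
      unfolding D_def by (simp add: cross3_simps forall_3)
    then have "(1 / D) *\<^sub>R D *\<^sub>R v = (1 / D) *\<^sub>R ((a1 \<bullet> v) *\<^sub>R (cross3 a2 a3) + (a2 \<bullet> v) *\<^sub>R (cross3 a3 a1) + (a3 \<bullet> v) *\<^sub>R (cross3 a1 a2))"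
      by simp
    then show ?thesis using D by (simp add: scaleR_add_right mult.commute)
  qed
  show ?thesis
    by (rule that[OF exp]) (simp_all add: D1 D dot_cross_self)
qed

section \<open>Affinely independent centers\<close>

text \<open>A totally isotropic subspace of complex three-space has dimension at most one. For the
  cross product \<open>u\<close> of \<open>M\<close> and \<open>w\<close>, the double cross product
  formula shows that the cross products of \<open>u\<close> with \<open>w\<close> and with
  \<open>M\<close> vanish, and this forces \<open>u = 0\<close>.\<close>

lemma isotropic_parallel:
  fixes w1 w2 w3 M1 M2 M3 :: complex
  assumes w: "w1\<^sup>2 + w2\<^sup>2 + w3\<^sup>2 = 0" "w1 \<noteq> 0 \<or> w2 \<noteq> 0 \<or> w3 \<noteq> 0"
    and Mw: "M1 * w1 + M2 * w2 + M3 * w3 = 0" and MM: "M1\<^sup>2 + M2\<^sup>2 + M3\<^sup>2 = 0"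
  obtains l where "M1 = l * w1" "M2 = l * w2" "M3 = l * w3"
proof -
  define u1 u2 u3 where "u1 = M2 * w3 - M3 * w2" and "u2 = M3 * w1 - M1 * w3" and "u3 = M1 * w2 - M2 * w1"
  have e: "w1 * u2 = w2 * u1" "w2 * u3 = w3 * u2" "w1 * u3 = w3 * u1"
     "M1 * u2 = M2 * u1" "M2 * u3 = M3 * u2" "M1 * u3 = M3 * u1"
    using w(1) Mw MM unfolding u1_def u2_def u3_def by algebra+
  have z: "u1 * u1 = 0" "u2 * u2 = 0" "u3 * u3 = 0"
    using e unfolding u1_def u2_def u3_def by algebra+
  then have z: "M2 * w3 = M3 * w2" "M3 * w1 = M1 * w3" "M1 * w2 = M2 * w1"
    by (simp_all add: u1_def u2_def u3_def)
  consider "w1 \<noteq> 0" | "w2 \<noteq> 0" | "w3 \<noteq> 0" using w(2) by blast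
  then show ?thesis
  proof cases
    case 1 then show ?thesis using z by (intro that[of "M1 / w1"]) (auto simp: field_simps)
  next
    case 2 then show ?thesis using z by (intro that[of "M2 / w2"]) (auto simp: field_simps)
  next
    case 3 then show ?thesis using z by (intro that[of "M3 / w3"]) (auto simp: field_simps)
  qed
qed

text \<open>The bilinear, not Hermitian, extension of the scalar product; only the bilinear one has
  isotropic vectors.\<close>

definition cdot :: "real^3 \<Rightarrow> complex \<Rightarrow> complex \<Rightarrow> complex \<Rightarrow> complex" where
  "cdot a w1 w2 w3 = of_real (a $ 1) * w1 + of_real (a $ 2) * w2 + of_real (a $ 3) * w3"

text \<open>For complex isotropic \<open>w\<close>, the conditions put \<open>M = \<Sum> (a\<^sub>i\<cdot>w)\<^sup>2 d\<^sub>i\<close> into the isotropic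
  line spanned by \<open>w\<close>, so all \<open>a\<^sub>i\<cdot>w\<close> lie in \<open>{0, \<lambda>}\<close> and \<open>w\<close> is a multiple of a real vector.\<close>

lemma no_isotropic_zero:
  fixes a1 a2 a3 d1 d2 d3 :: "real^3" and w1 w2 w3 :: complex
  assumes exp: "\<And>v. v = (a1 \<bullet> v) *\<^sub>R d1 + (a2 \<bullet> v) *\<^sub>R d2 + (a3 \<bullet> v) *\<^sub>R d3"
    and dual: "a1 \<bullet> d1 = 1" "a1 \<bullet> d2 = 0" "a1 \<bullet> d3 = 0"
    "a2 \<bullet> d1 = 0" "a2 \<bullet> d2 = 1" "a2 \<bullet> d3 = 0"
    "a3 \<bullet> d1 = 0" "a3 \<bullet> d2 = 0" "a3 \<bullet> d3 = 1"
    and w: "w1\<^sup>2 + w2\<^sup>2 + w3\<^sup>2 = 0" "w1 \<noteq> 0 \<or> w2 \<noteq> 0 \<or> w3 \<noteq> 0"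
  defines "M \<equiv> \<lambda>k. (cdot a1 w1 w2 w3)\<^sup>2 * of_real (d1 $ k) + (cdot a2 w1 w2 w3)\<^sup>2 * of_real (d2 $ k)
      + (cdot a3 w1 w2 w3)\<^sup>2 * of_real (d3 $ k)"
  shows "M 1 * w1 + M 2 * w2 + M 3 * w3 \<noteq> 0 \<or> (M 1)\<^sup>2 + (M 2)\<^sup>2 + (M 3)\<^sup>2 \<noteq> 0"
proof (rule ccontr)
  assume "\<not> ?thesis"
  then obtain l where l: "M 1 = l * w1" "M 2 = l * w2" "M 3 = l * w3"
    using isotropic_parallel[OF w, of "M 1" "M 2" "M 3"] by auto
  define y1 y2 y3 where "y1 = cdot a1 w1 w2 w3" and "y2 = cdot a2 w1 w2 w3" and "y3 = cdot a3 w1 w2 w3"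
  have dd: "of_real (a $ 1) * of_real (d $ 1) + of_real (a $ 2) * of_real (d $ 2) + of_real (a $ 3) * of_real (d $ 3) = complex_of_real (a \<bullet> d)" for a d :: "real^3"
    by (simp add: inner_vec_def sum_3)
  have aM: "of_real (a $ 1) * M 1 + of_real (a $ 2) * M 2 + of_real (a $ 3) * M 3
     = y1\<^sup>2 * of_real (a \<bullet> d1) + y2\<^sup>2 * of_real (a \<bullet> d2) + y3\<^sup>2 * of_real (a \<bullet> d3)" for a
    unfolding M_def y1_def[symmetric] y2_def[symmetric] y3_def[symmetric] dd[symmetric] by algebra
  have aM': "of_real (a $ 1) * M 1 + of_real (a $ 2) * M 2 + of_real (a $ 3) * M 3 = l * cdot a w1 w2 w3" for a
    unfolding l cdot_def by algebra
  have y: "y1\<^sup>2 = l * y1" "y2\<^sup>2 = l * y2" "y3\<^sup>2 = l * y3"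
    using aM[of a1] aM[of a2] aM[of a3] unfolding aM' y1_def[symmetric] y2_def[symmetric] y3_def[symmetric] dual by simp_all
  \<comment> \<open>The real number \<open>t\<close> is \<open>0\<close> or \<open>1\<close>, so up
    to the common factor \<open>l\<close> the coordinates of \<open>w\<close> in the dual basis are
    real.\<close>
  have "\<exists>t. y = l * complex_of_real t" if "y\<^sup>2 = l * y" for y
    using that by (intro exI[of _ "if y = 0 then 0 else 1"]) (auto simp: power2_eq_square)
  then obtain t1 t2 t3 where t: "y1 = l * of_real t1" "y2 = l * of_real t2" "y3 = l * of_real t3"
    using y by metis
  \<comment> \<open>The expansion at the standard basis vectors, entry by entry: in this form the
    real identity extends to complex \<open>w\<close>.\<close>
  have comp: "of_real (axis j 1 $ k) = of_real (a1 $ j) * complex_of_real (d1 $ k)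
      + of_real (a2 $ j) * of_real (d2 $ k) + of_real (a3 $ j) * of_real (d3 $ k)" for j k
    using arg_cong[OF exp[of "axis j 1"], of "\<lambda>v. complex_of_real (v $ k)"] by (simp add: inner_axis)
  define e where "e k = t1 * d1 $ k + t2 * d2 $ k + t3 * d3 $ k" for k
  have wk: "w1 * of_real (axis 1 1 $ k) + w2 * of_real (axis 2 1 $ k) + w3 * of_real (axis 3 1 $ k) = l * of_real (e k)" for k
  proof -
    have "w1 * of_real (axis 1 1 $ k) + w2 * of_real (axis 2 1 $ k) + w3 * of_real (axis 3 1 $ k)
      = y1 * of_real (d1 $ k) + y2 * of_real (d2 $ k) + y3 * of_real (d3 $ k)"
      unfolding comp y1_def y2_def y3_def cdot_def by algebra
    also have "\<dots> = l * of_real (e k)" unfolding t e_def by (simp add: algebra_simps)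
    finally show ?thesis .
  qed
  have we: "w1 = l * of_real (e 1)" "w2 = l * of_real (e 2)" "w3 = l * of_real (e 3)"
    using wk[of 1] wk[of 2] wk[of 3] by (simp_all add: axis_def)
  have "l\<^sup>2 * of_real ((e 1)\<^sup>2 + (e 2)\<^sup>2 + (e 3)\<^sup>2) = 0"
    using w(1) unfolding we by (simp add: algebra_simps)
  then have "l = 0 \<or> (e 1)\<^sup>2 + (e 2)\<^sup>2 + (e 3)\<^sup>2 = 0"
    by (metis mult_eq_0_iff of_real_eq_0_iff power_eq_0_iff)
  then have "l = 0 \<or> (e 1 = 0 \<and> e 2 = 0 \<and> e 3 = 0)"
    by (smt (verit) zero_le_power2 zero_eq_power2)
  then show False using w(2) we by auto
qed

section \<open>Stereographic coordinates and the isotropic conic\<close>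

text \<open>The forms \<open>a \<bullet> v\<close> and \<open>v \<bullet> v\<close> for \<open>v = (x + y, - \<i> (x - y), x y - 1) / (1 + x y)\<close>, up to
  powers of the denominator \<open>qform\<close>; real unit vectors correspond to \<open>y = cnj x\<close>.\<close>

definition lform :: "real^3 \<Rightarrow> complex poly poly" where
  "lform a = [:[:- of_real (a $ 3), Complex (a $ 1) (- a $ 2):], [:Complex (a $ 1) (a $ 2), of_real (a $ 3):]:]"

definition qform :: "complex poly poly" where
  "qform = [:1, [:0, 1:]:]"

text \<open>The restriction of \<open>lform a\<close> to \<open>y = - 1 / x\<close>, multiplied by
  \<open>x\<close>: the value of \<open>a\<close> on the parametrisation
  \<open>(x\<^sup>2 - 1, - \<i> * (x\<^sup>2 + 1), - 2 * x)\<close> of the isotropic conic.\<close>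

definition wform :: "real^3 \<Rightarrow> complex poly" where
  "wform a = [:- Complex (a $ 1) (a $ 2), - 2 * of_real (a $ 3), Complex (a $ 1) (- a $ 2):]"

lemma bideg_le_lform: "bideg_le 1 (lform a)" and bideg_le_qform: "bideg_le 1 qform"
  by (auto simp: bideg_le_def lform_def qform_def coeff_pCons split: nat.splits)

text \<open>Projection from the north pole: for \<open>y = cnj z\<close> the denominator
  \<open>1 + x * y\<close> is one plus the squared modulus of \<open>z\<close>, that is
  \<open>2 / (1 - v $ 3)\<close>.\<close>

lemma stereographic:
  fixes v :: "real^3"
  assumes v: "v \<bullet> v = 1" "v $ 3 \<noteq> 1"
  defines "z \<equiv> Complex (v $ 1 / (1 - v $ 3)) (v $ 2 / (1 - v $ 3))"
  shows "poly2 qform z (cnj z) = of_real (2 / (1 - v $ 3))"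
    and "poly2 (lform a) z (cnj z) = poly2 qform z (cnj z) * of_real (a \<bullet> v)"
proof -
  define s where "s = 1 / (1 - v $ 3)"
  have s: "s * (1 - v $ 3) = 1" using v(2) by (simp add: s_def)
  have v1: "(v$1)\<^sup>2 + (v$2)\<^sup>2 + (v$3)\<^sup>2 = 1"
    using v(1) by (simp add: inner_vec_def sum_3 power2_eq_square)
  have z: "z = Complex (v $ 1 * s) (v $ 2 * s)" by (simp add: z_def s_def)
  have n: "(v$1 * s)\<^sup>2 + (v$2 * s)\<^sup>2 = 2 * s - 1"
    using s v1 by algebra
  have q: "poly2 qform z (cnj z) = of_real (2 * s)"
    using n by (simp add: qform_def z complex_eq_iff power2_eq_square algebra_simps)
  then show "poly2 qform z (cnj z) = of_real (2 / (1 - v $ 3))" by (simp add: s_def)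
  have re: "2 * s * (a$1 * v$1 + a$2 * v$2) + a$3 * ((v$1 * s)\<^sup>2 + (v$2 * s)\<^sup>2 - 1)
      = 2 * s * (a$1 * v$1 + a$2 * v$2 + a$3 * v$3)"
    unfolding n using arg_cong[OF s, of "\<lambda>x. 2 * a $ 3 * x"] by (simp add: algebra_simps)
  show "poly2 (lform a) z (cnj z) = poly2 qform z (cnj z) * of_real (a \<bullet> v)"
    unfolding q using re
    by (simp add: lform_def z complex_eq_iff inner_vec_def sum_3 power2_eq_square algebra_simps)
qed

lemma antidiag_lform:
  assumes "x \<noteq> 0"
  shows "x * poly2 (lform a) x (- 1 / x) = poly (wform a) x"
proof -
  define y where "y = - 1 / x"
  define c c' where "c = Complex (a $ 1) (a $ 2)" and "c' = Complex (a $ 1) (- a $ 2)"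
  have "x * y = - 1" using assms by (simp add: y_def)
  then have "x * ((- of_real (a $ 3) + x * c') + y * (c + x * of_real (a $ 3))) = - c + x * (- 2 * of_real (a $ 3) + x * c')"
    by algebra
  then show ?thesis
    unfolding lform_def wform_def c_def[symmetric] c'_def[symmetric] y_def[symmetric] by simp
qed

lemma antidiag_qform: "x \<noteq> 0 \<Longrightarrow> poly2 qform x (- 1 / x) = 0"
  by (simp add: qform_def)

lemma wform_cdot: "poly (wform a) x = cdot a (x\<^sup>2 - 1) (- \<i> * (x\<^sup>2 + 1)) (- 2 * x)"
  by (simp add: wform_def cdot_def power2_eq_square algebra_simps complex_eq_iff)

text \<open>The leading coefficient is the value at the point of the isotropic conic that belongs to
  infinite \<open>x\<close>.\<close>

lemma coeff_wform: "coeff (wform a) 2 = cdot a 1 (- \<i>) 0"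
  by (simp add: wform_def cdot_def complex_eq_iff numeral_2_eq_2)

lemma degree_wform: "degree (wform a) \<le> 2"
  by (auto simp: wform_def)

text \<open>\<open>N v\<close> plays the role of \<open>2 * P\<close>, so \<open>R\<close> stands
  for four times a squared radius. Both equations are made homogeneous with \<open>qform\<close>.
  Where \<open>qform\<close> vanishes, \<open>k1\<close>, \<open>k2\<close>, \<open>k3\<close> and
  \<open>R\<close> disappear and \<open>N\<close> becomes the vector of
  \<open>no_isotropic_zero\<close> up to sign.\<close>

theorem finite_unit_cubic_quartic:
  fixes a1 a2 a3 d1 d2 d3 :: "real^3" and k1 k2 k3 R :: real
  assumes exp: "\<And>v. v = (a1 \<bullet> v) *\<^sub>R d1 + (a2 \<bullet> v) *\<^sub>R d2 + (a3 \<bullet> v) *\<^sub>R d3"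
    and dual: "a1 \<bullet> d1 = 1" "a1 \<bullet> d2 = 0" "a1 \<bullet> d3 = 0"
    "a2 \<bullet> d1 = 0" "a2 \<bullet> d2 = 1" "a2 \<bullet> d3 = 0"
    "a3 \<bullet> d1 = 0" "a3 \<bullet> d2 = 0" "a3 \<bullet> d3 = 1"
  defines "N \<equiv> \<lambda>v. (k1 - (a1 \<bullet> v)\<^sup>2) *\<^sub>R d1 + (k2 - (a2 \<bullet> v)\<^sup>2) *\<^sub>R d2 + (k3 - (a3 \<bullet> v)\<^sup>2) *\<^sub>R d3"
  shows "finite {v. v \<bullet> v = 1 \<and> N v \<bullet> v = 0 \<and> N v \<bullet> N v = R}"
proof -
  define C where "C c = [:[:complex_of_real c:]:]" for c
  define Nf where "Nf j = (C k1 * qform ^ 2 - lform a1 ^ 2) * C (d1 $ j) + (C k2 * qform ^ 2 - lform a2 ^ 2) * C (d2 $ j)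
     + (C k3 * qform ^ 2 - lform a3 ^ 2) * C (d3 $ j)" for j
  define F where "F = Nf 1 * lform (axis 1 1) + Nf 2 * lform (axis 2 1) + Nf 3 * lform (axis 3 1)"
  define G where "G = Nf 1 ^ 2 + Nf 2 ^ 2 + Nf 3 ^ 2 - C R * qform ^ 4"
  have C2: "poly2 (C c) x y = of_real c" for c x y by (simp add: C_def)
  have Cb: "bideg_le 0 (C c)" for c by (simp add: C_def bideg_le_const)
  have Cm: "bideg_le n (C c * p)" "bideg_le n (p * C c)" if "bideg_le n p" for n c p
    using bideg_le_mult[OF Cb that] bideg_le_mult[OF that Cb] by simp_all
  have pw: "bideg_le 2 (qform ^ 2)" "bideg_le 4 (qform ^ 4)" "bideg_le 2 (lform a ^ 2)" for a
    using bideg_le_power[OF bideg_le_qform, of 2] bideg_le_power[OF bideg_le_qform, of 4] bideg_le_power[OF bideg_le_lform, of 2 a] by simp_all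
  have t: "bideg_le 2 ((C k * qform ^ 2 - lform a ^ 2) * C d)" for k d a
    by (intro Cm bideg_le_diff pw)
  have Nb: "bideg_le 2 (Nf j)" for j
    unfolding Nf_def by (intro bideg_le_add t)
  have "bideg_le 3 (Nf j * lform a)" for j a
    using bideg_le_mult[OF Nb[of j] bideg_le_lform[of a]] by simp
  then have Fb: "bideg_le 3 F" unfolding F_def by (intro bideg_le_add)
  have "bideg_le 4 (Nf j ^ 2)" for j
    using bideg_le_power[OF Nb[of j], of 2] by simp
  then have Gb: "bideg_le 4 G" unfolding G_def
    by (intro bideg_le_add bideg_le_diff Cm pw)
  define W where "W j = - ((wform a1)\<^sup>2 * [:of_real (d1 $ j):] + (wform a2)\<^sup>2 * [:of_real (d2 $ j):]
     + (wform a3)\<^sup>2 * [:of_real (d3 $ j):])" for j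
  have Wev: "x\<^sup>2 * poly2 (Nf j) x (- 1 / x) = poly (W j) x" if "x \<noteq> 0" for x j
    unfolding W_def Nf_def using that antidiag_qform[OF that]
    by (simp add: antidiag_lform[symmetric] C2 power_mult_distrib algebra_simps)
  have Fa: "antidiag 3 F = W 1 * wform (axis 1 1) + W 2 * wform (axis 2 1) + W 3 * wform (axis 3 1)"
  proof (rule poly_eqI_nonzero)
    fix x :: complex assume x: "x \<noteq> 0"
    have "poly (antidiag 3 F) x = x ^ 3 * poly2 F x (- 1 / x)"
      using Fb x by (intro poly_antidiag) (auto simp: bideg_le_def)
    also have "\<dots> = poly (W 1 * wform (axis 1 1) + W 2 * wform (axis 2 1) + W 3 * wform (axis 3 1)) x"
      by (simp add: F_def Wev[OF x, symmetric] antidiag_lform[OF x, symmetric] power3_eq_cube power2_eq_square algebra_simps)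
    finally show "poly (antidiag 3 F) x = poly (W 1 * wform (axis 1 1) + W 2 * wform (axis 2 1) + W 3 * wform (axis 3 1)) x" .
  qed
  have Ga: "antidiag 4 G = (W 1)\<^sup>2 + (W 2)\<^sup>2 + (W 3)\<^sup>2"
  proof (rule poly_eqI_nonzero)
    fix x :: complex assume x: "x \<noteq> 0"
    have "poly (antidiag 4 G) x = x ^ 4 * poly2 G x (- 1 / x)"
      using Gb x by (intro poly_antidiag) (auto simp: bideg_le_def)
    also have "\<dots> = (x\<^sup>2 * poly2 (Nf 1) x (- 1 / x))\<^sup>2 + (x\<^sup>2 * poly2 (Nf 2) x (- 1 / x))\<^sup>2 + (x\<^sup>2 * poly2 (Nf 3) x (- 1 / x))\<^sup>2"
      using antidiag_qform[OF x] by (simp add: G_def power_mult_distrib algebra_simps)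
    also have "\<dots> = poly ((W 1)\<^sup>2 + (W 2)\<^sup>2 + (W 3)\<^sup>2) x"
      unfolding Wev[OF x] by simp
    finally show "poly (antidiag 4 G) x = poly ((W 1)\<^sup>2 + (W 2)\<^sup>2 + (W 3)\<^sup>2) x" .
  qed
  have ax: "cdot (axis 1 1) w1 w2 w3 = w1" "cdot (axis 2 1) w1 w2 w3 = w2" "cdot (axis 3 1) w1 w2 w3 = w3" for w1 w2 w3
    by (simp_all add: cdot_def axis_def)
  define M where "M w1 w2 w3 j = (cdot a1 w1 w2 w3)\<^sup>2 * of_real (d1 $ j) + (cdot a2 w1 w2 w3)\<^sup>2 * of_real (d2 $ j)
     + (cdot a3 w1 w2 w3)\<^sup>2 * of_real (d3 $ j)" for w1 w2 w3 j
  note iso = no_isotropic_zero[OF exp dual, folded M_def]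
  have "poly (antidiag 3 F) x \<noteq> 0 \<or> poly (antidiag 4 G) x \<noteq> 0" for x
  proof -
    have w: "(x\<^sup>2 - 1)\<^sup>2 + (- \<i> * (x\<^sup>2 + 1))\<^sup>2 + (- 2 * x)\<^sup>2 = 0"
      by (simp add: power_mult_distrib power2_eq_square algebra_simps)
    have w0: "x\<^sup>2 - 1 \<noteq> 0 \<or> - \<i> * (x\<^sup>2 + 1) \<noteq> 0 \<or> - 2 * x \<noteq> 0"
      by auto
    have "poly (W j) x = - M (x\<^sup>2 - 1) (- \<i> * (x\<^sup>2 + 1)) (- 2 * x) j" for j
      unfolding W_def M_def wform_cdot[symmetric] by (simp add: mult.commute)
    then have "poly (antidiag 3 F) x = - (M (x\<^sup>2 - 1) (- \<i> * (x\<^sup>2 + 1)) (- 2 * x) 1 * (x\<^sup>2 - 1)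
        + M (x\<^sup>2 - 1) (- \<i> * (x\<^sup>2 + 1)) (- 2 * x) 2 * (- \<i> * (x\<^sup>2 + 1))
        + M (x\<^sup>2 - 1) (- \<i> * (x\<^sup>2 + 1)) (- 2 * x) 3 * (- 2 * x))"
      "poly (antidiag 4 G) x = (M (x\<^sup>2 - 1) (- \<i> * (x\<^sup>2 + 1)) (- 2 * x) 1)\<^sup>2
        + (M (x\<^sup>2 - 1) (- \<i> * (x\<^sup>2 + 1)) (- 2 * x) 2)\<^sup>2
        + (M (x\<^sup>2 - 1) (- \<i> * (x\<^sup>2 + 1)) (- 2 * x) 3)\<^sup>2"
      unfolding Fa Ga poly_add poly_mult poly_power wform_cdot ax by (simp_all only: power2_minus mult_minus_left minus_add_distrib)
    then show ?thesis
      using iso[OF w w0] by (metis neg_equal_0_iff_equal)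
  qed
  \<comment> \<open>The same argument at infinite \<open>x\<close>, where the isotropic vector is
    \<open>(1, - \<i>, 0)\<close>.\<close>
  moreover have "coeff (antidiag 3 F) (2 * 3) \<noteq> 0 \<or> coeff (antidiag 4 G) (2 * 4) \<noteq> 0"
  proof -
    have w: "1\<^sup>2 + (- \<i>)\<^sup>2 + 0\<^sup>2 = 0" and w0: "1 \<noteq> (0::complex) \<or> - \<i> \<noteq> 0 \<or> (0::complex) \<noteq> 0"
      by simp_all
    have dw2: "degree ((wform a)\<^sup>2) \<le> 4" for a
      using degree_mult_le[of "wform a" "wform a"] degree_wform[of a] by (simp add: power2_eq_square)
    have cw2: "coeff ((wform a)\<^sup>2) 4 = (cdot a 1 (- \<i>) 0)\<^sup>2" for a
      using coeff_mult_top[OF degree_wform[of a] degree_wform[of a]] by (simp add: power2_eq_square coeff_wform)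
    have dW: "degree (W j) \<le> 4" for j
      unfolding W_def degree_minus
      by (intro degree_add_le order.trans[OF degree_mult_le]) (use dw2 in auto)
    have cW: "coeff (W j) 4 = - M 1 (- \<i>) 0 j" for j
      by (simp add: W_def M_def cw2 mult.commute)
    have "coeff (antidiag 3 F) (2 * 3) = - (M 1 (- \<i>) 0 1 * 1 + M 1 (- \<i>) 0 2 * (- \<i>) + M 1 (- \<i>) 0 3 * 0)"
      using coeff_mult_top[OF dW[of 1] degree_wform[of "axis 1 1"]]
        coeff_mult_top[OF dW[of 2] degree_wform[of "axis 2 1"]]
        coeff_mult_top[OF dW[of 3] degree_wform[of "axis 3 1"]]
      by (simp add: Fa coeff_wform ax cW)
    moreover have "coeff (antidiag 4 G) (2 * 4) = (M 1 (- \<i>) 0 1)\<^sup>2 + (M 1 (- \<i>) 0 2)\<^sup>2 + (M 1 (- \<i>) 0 3)\<^sup>2"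
      using coeff_mult_top[OF dW[of 1] dW[of 1]] coeff_mult_top[OF dW[of 2] dW[of 2]] coeff_mult_top[OF dW[of 3] dW[of 3]]
      by (simp add: Ga power2_eq_square cW)
    ultimately show ?thesis
      using iso[OF w w0] by (metis neg_equal_0_iff_equal)
  qed
  ultimately have fin: "finite {x. \<exists>y. poly2 F x y = 0 \<and> poly2 G x y = 0}"
    using Fb Gb by (intro finite_common_zeros_antidiag[of F 3 G 4]) (auto simp: bideg_le_def)
  define S where "S = {v. v \<bullet> v = 1 \<and> N v \<bullet> v = 0 \<and> N v \<bullet> N v = R}"
  define st where "st v = Complex (v $ 1 / (1 - v $ 3)) (v $ 2 / (1 - v $ 3))" for v :: "real^3"
  have "st ` {v \<in> S. v $ 3 \<noteq> 1} \<subseteq> {x. \<exists>y. poly2 F x y = 0 \<and> poly2 G x y = 0}"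
  proof safe
    fix v assume v: "v \<in> S" "v $ 3 \<noteq> 1"
    define Q where "Q = poly2 qform (st v) (cnj (st v))"
    have vv: "v \<bullet> v = 1" "N v \<bullet> v = 0" "N v \<bullet> N v = R" using v by (simp_all add: S_def)
    have l: "poly2 (lform a) (st v) (cnj (st v)) = Q * of_real (a \<bullet> v)" for a
      unfolding Q_def st_def by (rule stereographic(2)[OF vv(1) v(2)])
    have Nj: "poly2 (Nf j) (st v) (cnj (st v)) = Q\<^sup>2 * of_real (N v $ j)" for j
      unfolding Nf_def N_def by (simp add: l C2 Q_def[symmetric] power_mult_distrib algebra_simps)
    have axl: "poly2 (lform (axis j 1)) (st v) (cnj (st v)) = Q * of_real (v $ j)" for j
      by (simp add: l inner_axis')
    have "poly2 F (st v) (cnj (st v)) = Q ^ 3 * of_real (N v \<bullet> v)"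
      unfolding F_def by (simp add: Nj axl inner_vec_def sum_3 power3_eq_cube power2_eq_square algebra_simps)
    moreover have "poly2 G (st v) (cnj (st v)) = Q ^ 4 * of_real (N v \<bullet> N v - R)"
      unfolding G_def by (simp add: Nj C2 Q_def[symmetric] inner_vec_def sum_3 power4_eq_xxxx power2_eq_square algebra_simps)
    ultimately show "\<exists>y. poly2 F (st v) y = 0 \<and> poly2 G (st v) y = 0"
      using vv by auto
  qed
  then have "finite (st ` {v \<in> S. v $ 3 \<noteq> 1})" using fin finite_subset by blast
  moreover have "inj_on st {v \<in> S. v $ 3 \<noteq> 1}"
  proof (rule inj_onI)
    fix u v assume uv: "u \<in> {v \<in> S. v $ 3 \<noteq> 1}" "v \<in> {v \<in> S. v $ 3 \<noteq> 1}" "st u = st v"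
    have "complex_of_real (2 / (1 - u $ 3)) = of_real (2 / (1 - v $ 3))"
      using stereographic(1)[of u] stereographic(1)[of v] uv unfolding st_def[symmetric] by (simp add: S_def)
    then have "2 / (1 - u $ 3) = 2 / (1 - v $ 3)" using of_real_eq_iff by blast
    then have u3: "u $ 3 = v $ 3" using uv by (simp add: field_simps)
    have "a \<bullet> u = a \<bullet> v" for a
    proof -
      have "poly2 qform (st u) (cnj (st u)) \<noteq> 0"
        using stereographic(1)[of u] uv unfolding st_def[symmetric] by (simp add: S_def)
      then show ?thesis
        using stereographic(2)[of u a] stereographic(2)[of v a] uv unfolding st_def[symmetric] by (simp add: S_def)
    qed
    then have "\<forall>a. a \<bullet> u = a \<bullet> v" by blast
    then show "u = v" by (simp only: vector_eq_ldot)
  qed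
  ultimately have f1: "finite {v \<in> S. v $ 3 \<noteq> 1}" by (rule finite_imageD)
  \<comment> \<open>The north pole has no stereographic image and is added by hand.\<close>
  have "{v \<in> S. v $ 3 = 1} \<subseteq> {axis 3 1}"
  proof
    fix v assume "v \<in> {v \<in> S. v $ 3 = 1}"
    then have "v $ 3 = 1" "v \<bullet> v = 1" by (simp_all add: S_def)
    then have "v $ 3 = 1" "v $ 1 = 0" "v $ 2 = 0" by (auto simp: inner_vec_def sum_3)
    then show "v \<in> {axis 3 1}" by (simp add: vec_eq_iff forall_3 axis_def)
  qed
  then have "finite {v \<in> S. v $ 3 = 1}" using finite_subset by blast
  with f1 have "finite ({v \<in> S. v $ 3 \<noteq> 1} \<union> {v \<in> S. v $ 3 = 1})" by simp
  then show ?thesis by (rule rev_finite_subset) (auto simp: S_def)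
qed

section \<open>Coplanar centers\<close>

text \<open>\<open>(x\<^sub>0, y\<^sub>0)\<close> is a point at infinity of the conic that is parametrised by \<open>t\<close>. Where the leading
  form of the sextic does not vanish, the coefficient of \<open>t ^ 6\<close> survives; at the remaining points
  \<open>x\<^sub>0 = 0\<close>, \<open>y\<^sub>0 = 0\<close>, \<open>x\<^sub>0 = y\<^sub>0\<close> the cubic inside the square is \<open>O(t)\<close>, and the coefficient of
  \<open>t ^ 4\<close> survives. All terms are even in \<open>t\<close>, so the proof works with the variable \<open>t\<^sup>2\<close>.\<close>

lemma finite_roots_sextic:
  fixes x0 x1 y0 y1 k1 k2 g11 g12 g22 D R :: complex
  assumes xy: "x0 \<noteq> 0 \<or> y0 \<noteq> 0" and D: "D \<noteq> 0"
    and g: "g11 \<noteq> 0" "g22 \<noteq> 0" "g11 + 2 * g12 + g22 \<noteq> 0"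
  defines "G \<equiv> \<lambda>X Y. g11 * (k1 - X\<^sup>2)\<^sup>2 + 2 * g12 * (k1 - X\<^sup>2) * (k2 - Y\<^sup>2) + g22 * (k2 - Y\<^sup>2)\<^sup>2
      - 4 * R * (1 - (g11 * X\<^sup>2 + 2 * g12 * X * Y + g22 * Y\<^sup>2))
      - D * ((k1 - X\<^sup>2) * Y - (k2 - Y\<^sup>2) * X)\<^sup>2"
  shows "finite {t. t \<noteq> 0 \<and> G (x0 * t + x1 / t) (y0 * t + y1 / t) = 0}"
proof -
  \<comment> \<open>\<open>T\<close> is the variable \<open>t\<^sup>2\<close>, and \<open>x\<close>,
    \<open>y\<close> stand for \<open>t * X\<close>, \<open>t * Y\<close>, which are even in
    \<open>t\<close>.\<close>
  define T x y :: "complex poly" where "T = [:0, 1:]" and "x = [:x1, x0:]" and "y = [:y1, y0:]"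
  define A1 A2 where "A1 = [:k1:] * T - x\<^sup>2" and "A2 = [:k2:] * T - y\<^sup>2"
  define C where "C = A1 * y - A2 * x"
  define H where "H = T * ([:g11:] * A1\<^sup>2 + [:2 * g12:] * (A1 * A2) + [:g22:] * A2\<^sup>2)
    - [:4 * R:] * (T\<^sup>2 * (T - ([:g11:] * x\<^sup>2 + [:2 * g12:] * (x * y) + [:g22:] * y\<^sup>2))) - [:D:] * C\<^sup>2"
  have ev: "poly H (t\<^sup>2) = t ^ 6 * G (x0 * t + x1 / t) (y0 * t + y1 / t)" if t: "t \<noteq> 0" for t
  proof -
    define X Y where "X = x0 * t + x1 / t" and "Y = y0 * t + y1 / t"
    have px: "poly x (t\<^sup>2) = t * X" "poly y (t\<^sup>2) = t * Y" "poly T (t\<^sup>2) = t * t"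
      using t by (simp_all add: x_def y_def T_def X_def Y_def distrib_left power2_eq_square mult_ac add.commute)
    have pA: "poly A1 (t\<^sup>2) = t\<^sup>2 * (k1 - X\<^sup>2)" "poly A2 (t\<^sup>2) = t\<^sup>2 * (k2 - Y\<^sup>2)"
      unfolding A1_def A2_def poly_diff poly_mult poly_power px by (simp_all add: power2_eq_square algebra_simps)
    have pC: "poly C (t\<^sup>2) = t ^ 3 * ((k1 - X\<^sup>2) * Y - (k2 - Y\<^sup>2) * X)"
      unfolding C_def poly_diff poly_mult px pA by (simp add: power2_eq_square power3_eq_cube algebra_simps)
    have hom: "(t * t) * (g11 * (t\<^sup>2 * B1)\<^sup>2 + 2 * g12 * ((t\<^sup>2 * B1) * (t\<^sup>2 * B2)) + g22 * (t\<^sup>2 * B2)\<^sup>2)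
      - 4 * R * ((t * t)\<^sup>2 * (t * t - (g11 * (t * X)\<^sup>2 + 2 * g12 * ((t * X) * (t * Y)) + g22 * (t * Y)\<^sup>2)))
      - D * (t ^ 3 * B3)\<^sup>2 = t ^ 6 * (g11 * B1\<^sup>2 + 2 * g12 * B1 * B2 + g22 * B2\<^sup>2
      - 4 * R * (1 - (g11 * X\<^sup>2 + 2 * g12 * X * Y + g22 * Y\<^sup>2)) - D * B3\<^sup>2)" for B1 B2 B3 X Y
      by (simp add: eval_nat_numeral algebra_simps)
    have "poly H (t\<^sup>2) = (t * t) * (g11 * (t\<^sup>2 * (k1 - X\<^sup>2))\<^sup>2 + 2 * g12 * ((t\<^sup>2 * (k1 - X\<^sup>2)) * (t\<^sup>2 * (k2 - Y\<^sup>2))) + g22 * (t\<^sup>2 * (k2 - Y\<^sup>2))\<^sup>2)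
      - 4 * R * ((t * t)\<^sup>2 * (t * t - (g11 * (t * X)\<^sup>2 + 2 * g12 * ((t * X) * (t * Y)) + g22 * (t * Y)\<^sup>2)))
      - D * (t ^ 3 * ((k1 - X\<^sup>2) * Y - (k2 - Y\<^sup>2) * X))\<^sup>2"
      unfolding H_def poly_diff poly_add poly_mult poly_power pA pC px by simp
    also have "\<dots> = t ^ 6 * G X Y" unfolding G_def by (rule hom)
    finally show ?thesis unfolding X_def Y_def .
  qed
  have sq: "degree (p * p) \<le> 2 * n" if "degree p \<le> n" for p :: "complex poly" and n
    using degree_mult_le[of p p] that by simp
  have dT: "degree T \<le> 1" "coeff T 1 = 1" and dx: "degree x \<le> 1" "coeff x 1 = x0" and dy: "degree y \<le> 1" "coeff y 1 = y0"
    by (auto simp: T_def x_def y_def)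
  have dx2: "degree (x\<^sup>2) \<le> 2" "coeff (x\<^sup>2) 2 = x0\<^sup>2" and dy2: "degree (y\<^sup>2) \<le> 2" "coeff (y\<^sup>2) 2 = y0\<^sup>2"
    using sq[OF dx(1)] sq[OF dy(1)] coeff_mult_top[OF dx(1) dx(1)] coeff_mult_top[OF dy(1) dy(1)] dx dy
    by (simp_all add: power2_eq_square numeral_2_eq_2)
  have dA1: "degree A1 \<le> 2" "coeff A1 2 = - x0\<^sup>2" and dA2: "degree A2 \<le> 2" "coeff A2 2 = - y0\<^sup>2"
    using dx2 dy2 unfolding A1_def A2_def
    by (auto simp: T_def intro!: degree_diff_le) (auto simp: numeral_2_eq_2)
  have dC: "degree C \<le> 3" "coeff C 3 = x0 * y0 * (y0 - x0)"
  proof -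
    show "degree C \<le> 3" unfolding C_def
      using degree_mult_le[of A1 y] degree_mult_le[of A2 x] dA1 dA2 dx dy by (intro degree_diff_le) auto
    show "coeff C 3 = x0 * y0 * (y0 - x0)"
      using coeff_mult_top[OF dA1(1) dy(1)] coeff_mult_top[OF dA2(1) dx(1)] dA1 dA2 dx dy
      by (simp add: C_def power2_eq_square numeral_3_eq_3 algebra_simps)
  qed
  define E where "E = [:g11:] * A1\<^sup>2 + [:2 * g12:] * (A1 * A2) + [:g22:] * A2\<^sup>2"
  have dA11: "degree (A1\<^sup>2) \<le> 4" "coeff (A1\<^sup>2) 4 = x0 ^ 4" and dA22: "degree (A2\<^sup>2) \<le> 4" "coeff (A2\<^sup>2) 4 = y0 ^ 4"
    and dA12: "degree (A1 * A2) \<le> 4" "coeff (A1 * A2) 4 = x0\<^sup>2 * y0\<^sup>2"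
    using sq[OF dA1(1)] sq[OF dA2(1)] degree_mult_le[of A1 A2] dA1 dA2
      coeff_mult_top[OF dA1(1) dA1(1)] coeff_mult_top[OF dA2(1) dA2(1)] coeff_mult_top[OF dA1(1) dA2(1)]
    by (auto simp: power2_eq_square power4_eq_xxxx)
  have dE: "degree E \<le> 4" "coeff E 4 = g11 * x0 ^ 4 + 2 * g12 * (x0\<^sup>2 * y0\<^sup>2) + g22 * y0 ^ 4"
  proof -
    show "degree E \<le> 4" unfolding E_def
      using dA11 dA12 dA22 by (intro degree_add_le) (auto intro: order.trans[OF degree_smult_le])
    show "coeff E 4 = g11 * x0 ^ 4 + 2 * g12 * (x0\<^sup>2 * y0\<^sup>2) + g22 * y0 ^ 4"
      by (simp add: E_def dA11 dA12 dA22)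
  qed
  have dTE: "degree (T * E) \<le> 5" "coeff (T * E) 5 = coeff E 4"
    using degree_mult_le[of T E] dT dE coeff_mult_top[OF dT(1) dE(1)] by auto
  define F where "F = [:4 * R:] * (T\<^sup>2 * (T - ([:g11:] * x\<^sup>2 + [:2 * g12:] * (x * y) + [:g22:] * y\<^sup>2)))"
  have dF: "degree F \<le> 4"
  proof -
    have "degree (x * y) \<le> 2" using degree_mult_le[of x y] dx dy by simp
    then have "degree (T - ([:g11:] * x\<^sup>2 + [:2 * g12:] * (x * y) + [:g22:] * y\<^sup>2)) \<le> 2"
      using dx2 dy2 dT by (intro degree_diff_le degree_add_le) (auto intro: order.trans[OF degree_smult_le])
    moreover have "degree (T\<^sup>2) \<le> 2" using sq[OF dT(1)] by (simp add: power2_eq_square)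
    ultimately have "degree (T\<^sup>2 * (T - ([:g11:] * x\<^sup>2 + [:2 * g12:] * (x * y) + [:g22:] * y\<^sup>2))) \<le> 4"
      using degree_mult_le[of "T\<^sup>2" "T - ([:g11:] * x\<^sup>2 + [:2 * g12:] * (x * y) + [:g22:] * y\<^sup>2)"] by linarith
    then show ?thesis unfolding F_def by (auto intro: order.trans[OF degree_smult_le])
  qed
  have H: "H = T * E - F - [:D:] * C\<^sup>2" by (simp add: H_def E_def F_def)
  have "H \<noteq> 0"
  proof (cases "coeff C 3 = 0")
    case False
    have "coeff (C\<^sup>2) 6 = (coeff C 3)\<^sup>2"
      using coeff_mult_top[OF dC(1) dC(1)] by (simp add: power2_eq_square)
    moreover have "coeff (T * E) 6 = 0" "coeff F 6 = 0" using dTE dF by (auto intro!: coeff_eq_0)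
    ultimately have "coeff H 6 = - D * (coeff C 3)\<^sup>2" by (simp add: H)
    then show ?thesis using False D by auto
  next
    case True
    have c: "degree C \<le> 2"
    proof (rule degree_le, intro allI impI)
      fix i :: nat assume "2 < i"
      then show "coeff C i = 0" using True dC(1) by (cases "i = 3") (auto intro: coeff_eq_0)
    qed
    have "degree (C\<^sup>2) \<le> 4" using sq[OF c] by (simp add: power2_eq_square)
    then have "coeff (C\<^sup>2) 5 = 0" "coeff F 5 = 0" using dF by (auto intro!: coeff_eq_0)
    then have "coeff H 5 = coeff E 4" using dTE by (simp add: H)
    \<comment> \<open>On the three exceptional lines this coefficient is
      \<open>g22 * y0 ^ 4\<close>, \<open>g11 * x0 ^ 4\<close> or
      \<open>(g11 + 2 * g12 + g22) * y0 ^ 4\<close>: the origin of the three conditions on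
      \<open>g11\<close>, \<open>g12\<close>, \<open>g22\<close>.\<close>
    moreover have "coeff E 4 \<noteq> 0"
    proof -
      consider "x0 = 0" "y0 \<noteq> 0" | "y0 = 0" "x0 \<noteq> 0" | "x0 = y0" "x0 \<noteq> 0"
        using True xy unfolding dC(2) by auto
      then show ?thesis
      proof cases
        case 3
        then have "coeff E 4 = (g11 + 2 * g12 + g22) * y0 ^ 4"
          by (simp add: dE power2_eq_square power4_eq_xxxx algebra_simps)
        then show ?thesis using 3 g by simp
      qed (use g in \<open>simp_all add: dE\<close>)
    qed
    ultimately show ?thesis by auto
  qed
  then have "finite {u. poly H u = 0}" by (rule poly_roots_finite)
  moreover have "finite {t::complex. t\<^sup>2 = u}" for u
  proof -
    have "{t. t\<^sup>2 = u} \<subseteq> {csqrt u, - csqrt u}"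
      using power2_eq_iff[of _ "csqrt u"] by auto
    then show ?thesis using finite_subset by blast
  qed
  ultimately have "finite (\<Union>u\<in>{u. poly H u = 0}. {t. t\<^sup>2 = u})" by blast
  then show ?thesis
    by (rule rev_finite_subset) (use ev in auto)
qed

text \<open>For \<open>c \<noteq> 0\<close>, multiplication by \<open>c\<close> completes the
  square: the form becomes \<open>(c * Y + b * X)\<^sup>2 - s\<^sup>2 * X\<^sup>2\<close>. The
  factors are independent because the discriminant is not zero.\<close>

lemma binary_form_factors:
  fixes a b c :: complex
  assumes "b\<^sup>2 - a * c \<noteq> 0"
  obtains p1 q1 p2 q2 m where "p1 * q2 - q1 * p2 \<noteq> 0"
    "\<And>X Y. (p1 * X + q1 * Y) * (p2 * X + q2 * Y) = m * (a * X\<^sup>2 + 2 * b * X * Y + c * Y\<^sup>2)"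
proof (cases "c = 0")
  case True
  then show ?thesis using assms
    by (intro that[of 1 "2 * b" 0 a 1]) (auto simp: algebra_simps power2_eq_square)
next
  case False
  define s where "s = csqrt (b\<^sup>2 - a * c)"
  have s: "s\<^sup>2 = b\<^sup>2 - a * c" "s \<noteq> 0" using assms by (auto simp: s_def)
  show ?thesis
  proof (rule that[of "b - s" c c "b + s" c])
    show "(b - s) * c - c * (b + s) \<noteq> 0" using s(2) False by (simp add: algebra_simps)
    show "((b - s) * X + c * Y) * ((b + s) * X + c * Y) = c * (a * X\<^sup>2 + 2 * b * X * Y + c * Y\<^sup>2)" for X Y
      using s(1) by algebra
  qed
qed

text \<open>In the coordinates \<open>U\<close>, \<open>V\<close> given by the complex linear
  factors the conic is \<open>U * V = k\<close>, parametrised by \<open>t = U\<close>. For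
  \<open>K = 0\<close> it degenerates into two lines; then the line \<open>U = 0\<close> is
  parametrised by \<open>V\<close>, and the origin is added.\<close>

lemma finite_conic_sextic:
  fixes a b c K k1 k2 g11 g12 g22 D R :: real
  assumes disc: "b\<^sup>2 - a * c \<noteq> 0" and D: "D \<noteq> 0"
    and g: "g11 \<noteq> 0" "g22 \<noteq> 0" "g11 + 2 * g12 + g22 \<noteq> 0"
  shows "finite {(X, Y). a * X\<^sup>2 + 2 * b * X * Y + c * Y\<^sup>2 = K \<and>
      g11 * (k1 - X\<^sup>2)\<^sup>2 + 2 * g12 * (k1 - X\<^sup>2) * (k2 - Y\<^sup>2) + g22 * (k2 - Y\<^sup>2)\<^sup>2
      - 4 * R * (1 - (g11 * X\<^sup>2 + 2 * g12 * X * Y + g22 * Y\<^sup>2))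
      - D * ((k1 - X\<^sup>2) * Y - (k2 - Y\<^sup>2) * X)\<^sup>2 = 0}" (is "finite ?Z")
proof -
  define G where "G X Y = complex_of_real g11 * (of_real k1 - X\<^sup>2)\<^sup>2 + 2 * of_real g12 * (of_real k1 - X\<^sup>2) * (of_real k2 - Y\<^sup>2) + of_real g22 * (of_real k2 - Y\<^sup>2)\<^sup>2
      - 4 * of_real R * (1 - (of_real g11 * X\<^sup>2 + 2 * of_real g12 * X * Y + of_real g22 * Y\<^sup>2))
      - of_real D * ((of_real k1 - X\<^sup>2) * Y - (of_real k2 - Y\<^sup>2) * X)\<^sup>2" for X Y
  have "complex_of_real (b\<^sup>2 - a * c) \<noteq> 0" using disc by (simp only: of_real_eq_0_iff not_False_eq_True)
  then have "(complex_of_real b)\<^sup>2 - of_real a * of_real c \<noteq> 0" by simp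
  then obtain p1 q1 p2 q2 m :: complex where d: "p1 * q2 - q1 * p2 \<noteq> 0"
    and fac: "\<And>X Y. (p1 * X + q1 * Y) * (p2 * X + q2 * Y) = m * (of_real a * X\<^sup>2 + 2 * of_real b * X * Y + of_real c * Y\<^sup>2)"
    by (rule binary_form_factors) (rule that)
  define d where "d = p1 * q2 - q1 * p2"
  have d0: "d \<noteq> 0" using d d_def by simp
  define k where "k = m * of_real K"
  have gc: "complex_of_real D \<noteq> 0" "complex_of_real g11 \<noteq> 0" "complex_of_real g22 \<noteq> 0" "of_real g11 + 2 * of_real g12 + complex_of_real g22 \<noteq> 0"
  proof -
    have "complex_of_real (g11 + 2 * g12 + g22) \<noteq> 0" using g by (simp only: of_real_eq_0_iff not_False_eq_True)
    then show "of_real g11 + 2 * of_real g12 + complex_of_real g22 \<noteq> 0" by simp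
  qed (use D g in auto)
  define f where "f x0 x1 y0 y1 t = (Re (x0 * t + x1 / t), Re (y0 * t + y1 / t))" for x0 x1 y0 y1 t :: complex
  define S where "S x0 x1 y0 y1 = {t. t \<noteq> 0 \<and> G (x0 * t + x1 / t) (y0 * t + y1 / t) = 0}" for x0 x1 y0 y1
  have fin: "finite (S x0 x1 y0 y1)" if "x0 \<noteq> 0 \<or> y0 \<noteq> 0" for x0 x1 y0 y1
    unfolding S_def G_def by (rule finite_roots_sextic[OF that gc])
  have f1: "finite (S (q2 / d) (- q1 * k / d) (- p2 / d) (p1 * k / d))"
    using d0 by (intro fin) (auto simp: d_def)
  have f2: "finite (S (- q1 / d) 0 (p1 / d) 0)"
    using d0 by (intro fin) (auto simp: d_def)
  have "?Z \<subseteq> f (q2 / d) (- q1 * k / d) (- p2 / d) (p1 * k / d) ` S (q2 / d) (- q1 * k / d) (- p2 / d) (p1 * k / d)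
      \<union> f (- q1 / d) 0 (p1 / d) 0 ` S (- q1 / d) 0 (p1 / d) 0 \<union> {(0, 0)}" (is "_ \<subseteq> ?A \<union> ?B \<union> _")
  proof
    fix z assume "z \<in> ?Z"
    then obtain X Y where z: "z = (X, Y)" and con: "a * X\<^sup>2 + 2 * b * X * Y + c * Y\<^sup>2 = K"
      and sext: "g11 * (k1 - X\<^sup>2)\<^sup>2 + 2 * g12 * (k1 - X\<^sup>2) * (k2 - Y\<^sup>2) + g22 * (k2 - Y\<^sup>2)\<^sup>2
      - 4 * R * (1 - (g11 * X\<^sup>2 + 2 * g12 * X * Y + g22 * Y\<^sup>2))
      - D * ((k1 - X\<^sup>2) * Y - (k2 - Y\<^sup>2) * X)\<^sup>2 = 0"
      by blast
    have G0: "G (of_real X) (of_real Y) = 0"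
      using arg_cong[OF sext, of complex_of_real] unfolding G_def by simp
    define U V where "U = p1 * of_real X + q1 * of_real Y" and "V = p2 * of_real X + q2 * of_real Y"
    have UV: "U * V = k"
      unfolding U_def V_def fac k_def con[symmetric] by simp
    have XY: "complex_of_real X = (q2 * U - q1 * V) / d" "complex_of_real Y = (p1 * V - p2 * U) / d"
      using d0 by (simp_all add: field_simps) (simp_all add: U_def V_def d_def algebra_simps)
    show "z \<in> ?A \<union> ?B \<union> {(0, 0)}"
    proof (cases "U = 0")
      case False
      then have "V = k / U" using UV by (simp add: field_simps)
      then have e: "q2 / d * U + - q1 * k / d / U = of_real X" "- p2 / d * U + p1 * k / d / U = of_real Y"
        unfolding XY by (simp_all add: diff_divide_distrib add_divide_distrib mult.commute)
      then have "U \<in> S (q2 / d) (- q1 * k / d) (- p2 / d) (p1 * k / d)"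
        using False G0 by (simp only: S_def mem_Collect_eq) simp
      moreover have "f (q2 / d) (- q1 * k / d) (- p2 / d) (p1 * k / d) U = (X, Y)"
        unfolding f_def e by simp
      ultimately have "(X, Y) \<in> ?A" by (metis image_eqI)
      then show ?thesis using z by blast
    next
      case True
      have e: "- q1 / d * V + 0 / V = of_real X" "p1 / d * V + 0 / V = of_real Y"
        unfolding XY True by simp_all
      show ?thesis
      proof (cases "V = 0")
        case True
        then show ?thesis using e z by simp
      next
        case False
        then have "V \<in> S (- q1 / d) 0 (p1 / d) 0"
          using G0 e by (simp only: S_def mem_Collect_eq) simp
        moreover have "f (- q1 / d) 0 (p1 / d) 0 V = (X, Y)"
          unfolding f_def e by simp
        ultimately have "(X, Y) \<in> ?B" by (metis image_eqI)
        then show ?thesis using z by blast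
      qed
    qed
  qed
  then show ?thesis using f1 f2 by (meson finite_Un finite_imageI finite.emptyI finite.insertI finite_subset)
qed

section \<open>Lines as solutions of polynomial systems\<close>

lemma is_line_iff_unit:
  "is_line l \<longleftrightarrow> (\<exists>p v. v \<bullet> v = 1 \<and> l = range (\<lambda>t. p + t *\<^sub>R v))"
proof
  assume "is_line l"
  then obtain a b where ab: "a \<noteq> b" "l = affine hull {a, b}" by (auto simp: is_line_def)
  define v where "v = (b - a) /\<^sub>R norm (b - a)"
  have n: "norm (b - a) \<noteq> 0" using ab by simp
  have "l = range (\<lambda>t. a + t *\<^sub>R v)"
  proof -
    have "range (\<lambda>u. a + u *\<^sub>R (b - a)) = range (\<lambda>t. a + t *\<^sub>R v)"
    proof safe
      fix u show "a + u *\<^sub>R (b - a) \<in> range (\<lambda>t. a + t *\<^sub>R v)"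
        using n by (intro image_eqI[of _ _ "u * norm (b - a)"]) (auto simp: v_def)
    next
      fix t show "a + t *\<^sub>R v \<in> range (\<lambda>u. a + u *\<^sub>R (b - a))"
        by (intro image_eqI[of _ _ "t / norm (b - a)"]) (auto simp: v_def divide_inverse)
    qed
    then show ?thesis unfolding ab(2) affine_hull_2_alt by blast
  qed
  moreover have "v \<bullet> v = 1" using n by (simp add: v_def dot_square_norm power2_eq_square)
  ultimately show "\<exists>p v. v \<bullet> v = 1 \<and> l = range (\<lambda>t. p + t *\<^sub>R v)" by blast
next
  assume "\<exists>p v. v \<bullet> v = 1 \<and> l = range (\<lambda>t. p + t *\<^sub>R v)"
  then obtain p v where v: "v \<bullet> v = 1" "l = range (\<lambda>t. p + t *\<^sub>R v)" by blast
  then have "p \<noteq> p + v" by auto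
  moreover have "l = affine hull {p, p + v}" unfolding affine_hull_2_alt v(2) by simp
  ultimately show "is_line l" unfolding is_line_def by blast
qed

lemma range_line_shift: "range (\<lambda>t. (p + s *\<^sub>R v) + t *\<^sub>R v) = range (\<lambda>t::real. p + t *\<^sub>R v)" for p v :: "'a::real_vector"
proof (intro equalityI image_subsetI)
  show "p + s *\<^sub>R v + t *\<^sub>R v \<in> range (\<lambda>t. p + t *\<^sub>R v)" for t
    using rangeI[of "\<lambda>t. p + t *\<^sub>R v" "s + t"] by (simp add: scaleR_add_left add.assoc)
  show "p + t *\<^sub>R v \<in> range (\<lambda>t. p + s *\<^sub>R v + t *\<^sub>R v)" for t
    using rangeI[of "\<lambda>t. p + s *\<^sub>R v + t *\<^sub>R v" "t - s"] by (simp add: algebra_simps)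
qed

text \<open>\<open>?E\<close> says that the squared distance from \<open>c\<close> to the line is
  \<open>r\<^sup>2\<close>. The points of the line on the sphere have parameters with
  \<open>(t + b)\<^sup>2 = D\<close>, a set symmetric about \<open>- b\<close>, so a single point
  means \<open>D = 0\<close>.\<close>

lemma tangent_line_unit_iff:
  assumes v: "v \<bullet> v = 1" and r: "r > 0"
  shows "tangent_line (sphere c r) (range (\<lambda>t. p + t *\<^sub>R v)) \<longleftrightarrow> (p - c) \<bullet> (p - c) - ((p - c) \<bullet> v)\<^sup>2 = r\<^sup>2"
    (is "_ \<longleftrightarrow> ?E")
proof -
  define b where "b = (p - c) \<bullet> v"
  define D where "D = r\<^sup>2 - ((p - c) \<bullet> (p - c) - b\<^sup>2)"
  have on: "p + t *\<^sub>R v \<in> sphere c r \<longleftrightarrow> (t + b)\<^sup>2 = D" for t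
  proof -
    have "p + t *\<^sub>R v \<in> sphere c r \<longleftrightarrow> (norm ((p - c) + t *\<^sub>R v))\<^sup>2 = r\<^sup>2"
      using r by (simp add: dist_norm norm_minus_commute[of c] algebra_simps)
    also have "(norm ((p - c) + t *\<^sub>R v))\<^sup>2 = (p - c) \<bullet> (p - c) + 2 * t * b + t\<^sup>2"
      unfolding power2_norm_eq_inner inner_add_left inner_add_right inner_scaleR_left inner_scaleR_right v b_def
      by (simp add: inner_commute power2_eq_square distrib_left)
    finally show ?thesis unfolding D_def by (simp add: power2_eq_square algebra_simps)
  qed
  have inj: "p + s *\<^sub>R v = p + t *\<^sub>R v \<longleftrightarrow> s = t" for s t
    using v by auto
  have "is_line (range (\<lambda>t. p + t *\<^sub>R v))" using v is_line_iff_unit by blast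
  moreover have "(\<exists>q. range (\<lambda>t. p + t *\<^sub>R v) \<inter> sphere c r = {q}) \<longleftrightarrow> D = 0"
  proof
    assume "\<exists>q. range (\<lambda>t. p + t *\<^sub>R v) \<inter> sphere c r = {q}"
    then obtain q where q: "range (\<lambda>t. p + t *\<^sub>R v) \<inter> sphere c r = {q}" by blast
    then have "q \<in> range (\<lambda>t. p + t *\<^sub>R v)" and qS: "q \<in> sphere c r" by blast+
    then obtain t where t1: "q = p + t *\<^sub>R v" by (elim rangeE)
    have t: "q = p + t *\<^sub>R v" "(t + b)\<^sup>2 = D" using t1 qS unfolding t1 on by simp_all
    have "((- 2 * b - t) + b)\<^sup>2 = D" using t(2) by (simp add: power2_eq_square algebra_simps)
    then have "p + (- 2 * b - t) *\<^sub>R v \<in> range (\<lambda>t. p + t *\<^sub>R v) \<inter> sphere c r"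
      unfolding on[symmetric] by blast
    then have "- 2 * b - t = t" unfolding q t(1) singleton_iff inj .
    then have "t + b = 0" by simp
    then show "D = 0" using t(2) by simp
  next
    assume "D = 0"
    then have A: "p + t *\<^sub>R v \<in> sphere c r \<longleftrightarrow> t = - b" for t
      unfolding on by (simp add: eq_neg_iff_add_eq_0)
    have "range (\<lambda>t. p + t *\<^sub>R v) \<inter> sphere c r = {p + (- b) *\<^sub>R v}"
    proof (intro equalityI subsetI)
      fix q assume "q \<in> range (\<lambda>t. p + t *\<^sub>R v) \<inter> sphere c r"
      then obtain t where t: "q = p + t *\<^sub>R v" and "q \<in> sphere c r" by (elim IntE rangeE)
      then have "p + t *\<^sub>R v \<in> sphere c r" by (simp only:)
      with t show "q \<in> {p + (- b) *\<^sub>R v}" unfolding A by simp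
    next
      fix q assume "q \<in> {p + (- b) *\<^sub>R v}"
      then have "q = p + (- b) *\<^sub>R v" by (rule singletonD)
      then show "q \<in> range (\<lambda>t. p + t *\<^sub>R v) \<inter> sphere c r"
        using A[of "- b"] by (metis IntI rangeI)
    qed
    then show "\<exists>q. range (\<lambda>t. p + t *\<^sub>R v) \<inter> sphere c r = {q}" by blast
  qed
  ultimately show ?thesis unfolding tangent_line_def D_def b_def by auto
qed

text \<open>A pair \<open>(P, v)\<close> encodes the line through \<open>x\<^sub>0 + P\<close> with unit direction \<open>v\<close>, where \<open>P\<close> is
  orthogonal to \<open>v\<close> and \<open>x\<^sub>0\<close> is one of the centers. Subtracting the tangency condition at \<open>x\<^sub>0\<close> from
  the one at \<open>x\<^sub>0 + a\<close> leaves an equation that is linear in \<open>P\<close>.\<close>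

definition tangent_pairs :: "real \<Rightarrow> ((real^3) \<times> real) set \<Rightarrow> ((real^3) \<times> (real^3)) set" where
  "tangent_pairs R A = {(P, v). v \<bullet> v = 1 \<and> P \<bullet> v = 0 \<and> P \<bullet> P = R \<and>
     (\<forall>(a, k)\<in>A. 2 * (a \<bullet> P) = k - (a \<bullet> v)\<^sup>2)}"

lemma finite_common_tangents:
  fixes x0 x1 x2 x3 :: "real^3"
  assumes r: "r0 > 0" "r1 > 0" "r2 > 0" "r3 > 0"
    and fin: "\<And>R k1 k2 k3. finite (tangent_pairs R {(x1 - x0, k1), (x2 - x0, k2), (x3 - x0, k3)})"
  shows "finite {l. tangent_line (sphere x0 r0) l \<and> tangent_line (sphere x1 r1) l \<and>
    tangent_line (sphere x2 r2) l \<and> tangent_line (sphere x3 r3) l}"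
proof -
  \<comment> \<open>The constant left when \<open>P \<bullet> P = r0\<^sup>2\<close> is subtracted
    from \<open>(P - a) \<bullet> (P - a) - (a \<bullet> v)\<^sup>2 = r\<^sup>2\<close>.\<close>
  define k where "k a r = a \<bullet> a - r\<^sup>2 + r0\<^sup>2" for a :: "real^3" and r
  define T where "T = tangent_pairs (r0\<^sup>2) {(x1 - x0, k (x1 - x0) r1), (x2 - x0, k (x2 - x0) r2), (x3 - x0, k (x3 - x0) r3)}"
  have "{l. tangent_line (sphere x0 r0) l \<and> tangent_line (sphere x1 r1) l \<and>
    tangent_line (sphere x2 r2) l \<and> tangent_line (sphere x3 r3) l}
    \<subseteq> (\<lambda>(P, v). range (\<lambda>t. (x0 + P) + t *\<^sub>R v)) ` T"
  proof
    fix l assume "l \<in> {l. tangent_line (sphere x0 r0) l \<and> tangent_line (sphere x1 r1) l \<and>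
      tangent_line (sphere x2 r2) l \<and> tangent_line (sphere x3 r3) l}"
    then have tl: "tangent_line (sphere x0 r0) l" "tangent_line (sphere x1 r1) l"
      "tangent_line (sphere x2 r2) l" "tangent_line (sphere x3 r3) l" by auto
    have "is_line l" using tl(1) by (simp add: tangent_line_def)
    then obtain p v where v: "v \<bullet> v = 1" and l: "l = range (\<lambda>t. p + t *\<^sub>R v)"
      unfolding is_line_iff_unit by (elim exE conjE)
    define s P where "s = (p - x0) \<bullet> v" and "P = (p - x0) - s *\<^sub>R v"
    have Pv: "P \<bullet> v = 0" by (simp add: P_def s_def inner_diff_left v)
    have tg: "(p - x) \<bullet> (p - x) - ((p - x) \<bullet> v)\<^sup>2 = P \<bullet> P - 2 * ((x - x0) \<bullet> P) + (x - x0) \<bullet> (x - x0) - ((x - x0) \<bullet> v)\<^sup>2" for x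
    proof -
      define a where "a = x - x0"
      have px: "p - x = P + s *\<^sub>R v - a" by (simp add: P_def a_def)
      have 1: "(p - x) \<bullet> v = s - a \<bullet> v"
        unfolding px by (simp add: inner_add_left inner_diff_left Pv v)
      have 2: "(p - x) \<bullet> (p - x) = P \<bullet> P + s\<^sup>2 + a \<bullet> a - 2 * (a \<bullet> P) - 2 * s * (a \<bullet> v)"
        unfolding px using Pv
        by (simp add: inner_add_left inner_diff_left inner_add_right inner_diff_right v inner_commute power2_eq_square algebra_simps)
      show ?thesis unfolding 1 2 a_def[symmetric] by (simp add: power2_eq_square algebra_simps)
    qed
    have R: "P \<bullet> P = r0\<^sup>2"
      using tl(1) tangent_line_unit_iff[OF v r(1)] tg[of x0] unfolding l by simp
    have "2 * ((x - x0) \<bullet> P) = k (x - x0) r - ((x - x0) \<bullet> v)\<^sup>2"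
      if "tangent_line (sphere x r) l" "r > 0" for x r
      using that(1) tangent_line_unit_iff[OF v that(2)] tg[of x] R unfolding l k_def by simp
    then have "(P, v) \<in> T" using tl r R Pv v by (simp add: T_def tangent_pairs_def)
    moreover have "l = range (\<lambda>t. (x0 + P) + t *\<^sub>R v)"
    proof -
      have "x0 + P = p + (- s) *\<^sub>R v" by (simp add: P_def)
      then show ?thesis unfolding l by (simp only: range_line_shift)
    qed
    ultimately show "l \<in> (\<lambda>(P, v). range (\<lambda>t. (x0 + P) + t *\<^sub>R v)) ` T" by force
  qed
  moreover have "finite T" unfolding T_def by (rule fin)
  ultimately show ?thesis by (meson finite_imageI finite_subset)
qed

section \<open>Finiteness of the tangent pairs, by the position of the centers\<close>

lemma finite_tangent_pairs_independent:
  assumes "a1 \<bullet> (cross3 a2 a3) \<noteq> 0"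
  shows "finite (tangent_pairs R {(a1, k1), (a2, k2), (a3, k3)})"
proof -
  obtain d1 d2 d3 where exp: "\<And>v. v = (a1 \<bullet> v) *\<^sub>R d1 + (a2 \<bullet> v) *\<^sub>R d2 + (a3 \<bullet> v) *\<^sub>R d3"
    and dual: "a1 \<bullet> d1 = 1" "a1 \<bullet> d2 = 0" "a1 \<bullet> d3 = 0"
    "a2 \<bullet> d1 = 0" "a2 \<bullet> d2 = 1" "a2 \<bullet> d3 = 0"
    "a3 \<bullet> d1 = 0" "a3 \<bullet> d2 = 0" "a3 \<bullet> d3 = 1"
    using dual_basis[OF assms] by metis
  define N where "N v = (k1 - (a1 \<bullet> v)\<^sup>2) *\<^sub>R d1 + (k2 - (a2 \<bullet> v)\<^sup>2) *\<^sub>R d2 + (k3 - (a3 \<bullet> v)\<^sup>2) *\<^sub>R d3" for v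
  have fin: "finite {v. v \<bullet> v = 1 \<and> N v \<bullet> v = 0 \<and> N v \<bullet> N v = 4 * R}"
    unfolding N_def by (rule finite_unit_cubic_quartic[OF exp dual])
  have "tangent_pairs R {(a1, k1), (a2, k2), (a3, k3)}
    \<subseteq> (\<lambda>v. ((1/2) *\<^sub>R N v, v)) ` {v. v \<bullet> v = 1 \<and> N v \<bullet> v = 0 \<and> N v \<bullet> N v = 4 * R}"
  proof
    fix z assume "z \<in> tangent_pairs R {(a1, k1), (a2, k2), (a3, k3)}"
    then obtain P v where z: "z = (P, v)" and h: "v \<bullet> v = 1" "P \<bullet> v = 0" "P \<bullet> P = R"
      "2 * (a1 \<bullet> P) = k1 - (a1 \<bullet> v)\<^sup>2" "2 * (a2 \<bullet> P) = k2 - (a2 \<bullet> v)\<^sup>2" "2 * (a3 \<bullet> P) = k3 - (a3 \<bullet> v)\<^sup>2"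
      by (auto simp: tangent_pairs_def)
    have "2 *\<^sub>R P = 2 *\<^sub>R ((a1 \<bullet> P) *\<^sub>R d1 + (a2 \<bullet> P) *\<^sub>R d2 + (a3 \<bullet> P) *\<^sub>R d3)"
      by (rule arg_cong[OF exp])
    also have "\<dots> = N v" unfolding N_def h(4-6)[symmetric] by (simp add: scaleR_add_right)
    finally have "N v = 2 *\<^sub>R P" by (rule sym)
    then show "z \<in> (\<lambda>v. ((1/2) *\<^sub>R N v, v)) ` {v. v \<bullet> v = 1 \<and> N v \<bullet> v = 0 \<and> N v \<bullet> N v = 4 * R}"
      using h z by (intro image_eqI[of _ _ v]) simp_all
  qed
  then show ?thesis using fin by (meson finite_imageI finite_subset)
qed

lemma finite_vec_of_coords:
  fixes a1 a2 a3 :: "real^3"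
  assumes "\<And>v. v = (a1 \<bullet> v) *\<^sub>R d1 + (a2 \<bullet> v) *\<^sub>R d2 + (a3 \<bullet> v) *\<^sub>R d3"
    and "finite A" "finite B" "finite C"
  shows "finite {v. a1 \<bullet> v \<in> A \<and> a2 \<bullet> v \<in> B \<and> a3 \<bullet> v \<in> C}"
proof -
  have "{v. a1 \<bullet> v \<in> A \<and> a2 \<bullet> v \<in> B \<and> a3 \<bullet> v \<in> C} \<subseteq>
    (\<lambda>(x, y, z). x *\<^sub>R d1 + y *\<^sub>R d2 + z *\<^sub>R d3) ` (A \<times> B \<times> C)"
  proof
    fix v assume "v \<in> {v. a1 \<bullet> v \<in> A \<and> a2 \<bullet> v \<in> B \<and> a3 \<bullet> v \<in> C}"
    then show "v \<in> (\<lambda>(x, y, z). x *\<^sub>R d1 + y *\<^sub>R d2 + z *\<^sub>R d3) ` (A \<times> B \<times> C)"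
      using assms(1)[of v] by (intro image_eqI[of _ _ "(a1 \<bullet> v, a2 \<bullet> v, a3 \<bullet> v)"]) (simp, blast)
  qed
  then show ?thesis using assms(2-) by (meson finite_SigmaI finite_imageI finite_subset)
qed

lemma orthonormal_cross:
  fixes e f :: "real^3"
  assumes "e \<bullet> e = 1" "f \<bullet> f = 1" "e \<bullet> f = 0"
  defines "n \<equiv> cross3 e f"
  shows "n \<bullet> n = 1" "e \<bullet> n = 0" "f \<bullet> n = 0"
    and "\<And>v. v = (e \<bullet> v) *\<^sub>R e + (f \<bullet> v) *\<^sub>R f + (n \<bullet> v) *\<^sub>R n"
    and "\<And>u w. u \<bullet> w = (e \<bullet> u) * (e \<bullet> w) + (f \<bullet> u) * (f \<bullet> w) + (n \<bullet> u) * (n \<bullet> w)"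
proof -
  show n: "n \<bullet> n = 1"
    using norm_cross_dot[of e f] assms by (simp add: power_mult_distrib power2_norm_eq_inner)
  show en: "e \<bullet> n = 0" "f \<bullet> n = 0" by (simp_all add: n_def dot_cross_self)
  have "e \<bullet> (cross3 f n) = n \<bullet> n"
    unfolding n_def by (simp add: cross3_simps)
  then have "e \<bullet> (cross3 f n) \<noteq> 0" using n by simp
  then obtain d1 d2 d3 where exp: "\<And>v. v = (e \<bullet> v) *\<^sub>R d1 + (f \<bullet> v) *\<^sub>R d2 + (n \<bullet> v) *\<^sub>R d3"
    using dual_basis by metis
  have "d1 = e" "d2 = f" "d3 = n"
    using exp[of e] exp[of f] exp[of n] assms n en by (simp_all add: inner_commute)
  with exp show *: "\<And>v. v = (e \<bullet> v) *\<^sub>R e + (f \<bullet> v) *\<^sub>R f + (n \<bullet> v) *\<^sub>R n" by simp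
  fix u w
  have "u \<bullet> w = ((e \<bullet> u) *\<^sub>R e + (f \<bullet> u) *\<^sub>R f + (n \<bullet> u) *\<^sub>R n) \<bullet> w"
    using *[of u] by simp
  then show "u \<bullet> w = (e \<bullet> u) * (e \<bullet> w) + (f \<bullet> u) * (f \<bullet> w) + (n \<bullet> u) * (n \<bullet> w)"
    by (simp add: inner_add_left)
qed

lemma finite_quartic_roots:
  fixes c4 :: real
  assumes "c4 \<noteq> 0"
  shows "finite {y. c0 + c1 * y + c2 * y ^ 2 + c3 * y ^ 3 + c4 * y ^ 4 = 0}"
proof -
  have "finite {y. poly [:c0, c1, c2, c3, c4:] y = 0}"
    using assms by (intro poly_roots_finite) simp
  then show ?thesis by (simp add: eval_nat_numeral algebra_simps)
qed

lemma square_root_cases: "z\<^sup>2 = (x::real) \<Longrightarrow> z \<in> {sqrt x, - sqrt x}"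
  by (auto simp: abs_if)

text \<open>The two equations along \<open>e\<close> fix
  \<open>(e \<bullet> v)\<^sup>2 = \<kappa>\<close> and \<open>e \<bullet> P = s\<close>; the third
  makes \<open>q = f \<bullet> P\<close> a quadratic in \<open>y = f \<bullet> v\<close>. Squaring
  the orthogonality of \<open>P\<close> and \<open>v\<close> eliminates the components along
  \<open>n\<close>; the terms \<open>q\<^sup>2 * y\<^sup>2\<close> cancel, which leaves a quartic in
  \<open>y\<close> with leading coefficient \<open>- S * \<gamma> ^ 4\<close>.\<close>

lemma finite_tangent_pairs_three_collinear:
  fixes e f :: "real^3"
  assumes ef: "e \<bullet> e = 1" "f \<bullet> f = 1" "e \<bullet> f = 0"
    and nz: "\<alpha> \<noteq> 0" "\<tau> \<noteq> 0" "\<alpha> \<noteq> \<tau>" "\<gamma> \<noteq> 0"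
  shows "finite (tangent_pairs R {(\<alpha> *\<^sub>R e, k1), (\<tau> *\<^sub>R e, k2), (\<beta> *\<^sub>R e + \<gamma> *\<^sub>R f, k3)})"
proof -
  define n where "n = cross3 e f"
  note on = orthonormal_cross[OF ef, folded n_def]
  define \<kappa> where "\<kappa> = (\<alpha> * k2 - \<tau> * k1) / (\<alpha> * \<tau> * (\<tau> - \<alpha>))"
  define s where "s = (k1 - \<alpha>\<^sup>2 * \<kappa>) / (2 * \<alpha>)"
  define h0 h1 h2 where "h0 X = k3 - 2 * \<beta> * s - (\<beta> * X)\<^sup>2" and "h1 X = - 2 * \<beta> * X * \<gamma>" and "h2 = - \<gamma>\<^sup>2" for X
  define A where "A = R - s\<^sup>2"
  define S where "S = 1 - \<kappa>"
  define Q where "Q X y = h0 X + h1 X * y + h2 * y\<^sup>2" for X y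
  define c0 c1 c2 c3 where "c0 X = 4 * \<gamma>\<^sup>2 * (A * S - s\<^sup>2 * \<kappa>) - S * (h0 X)\<^sup>2"
    and "c1 X = - 2 * S * h0 X * h1 X - 4 * \<gamma> * s * X * h0 X"
    and "c2 X = - 4 * \<gamma>\<^sup>2 * A - S * ((h1 X)\<^sup>2 + 2 * h0 X * h2) - 4 * \<gamma> * s * X * h1 X"
    and "c3 X = - 2 * S * h1 X * h2 - 4 * \<gamma> * s * X * h2" for X
  define AX where "AX = {sqrt \<kappa>, - sqrt \<kappa>}"
  \<comment> \<open>For \<open>S = 0\<close> the quartic loses its leading term, but then
    \<open>y\<^sup>2 + z\<^sup>2 = S\<close> gives \<open>y = 0\<close> directly.\<close>
  define BY where "BY = (if S = 0 then {0} else
    (\<Union>X\<in>AX. {y. c0 X + c1 X * y + c2 X * y ^ 2 + c3 X * y ^ 3 + (- S * h2\<^sup>2) * y ^ 4 = 0}))"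
  define CZ where "CZ = (\<Union>y\<in>BY. {sqrt (S - y\<^sup>2), - sqrt (S - y\<^sup>2)})"
  define BQ where "BQ = (\<lambda>(X, y). Q X y / (2 * \<gamma>)) ` (AX \<times> BY)"
  define CM where "CM = (\<Union>q\<in>BQ. {sqrt (A - q\<^sup>2), - sqrt (A - q\<^sup>2)})"
  have fA: "finite AX" by (simp add: AX_def)
  have fB: "finite BY"
    using nz fA finite_quartic_roots[of "- S * h2\<^sup>2"] by (auto simp: BY_def h2_def)
  have fC: "finite CZ" and fQ: "finite BQ" using fA fB by (auto simp: CZ_def BQ_def)
  have fM: "finite CM" using fQ by (auto simp: CM_def)
  have "tangent_pairs R {(\<alpha> *\<^sub>R e, k1), (\<tau> *\<^sub>R e, k2), (\<beta> *\<^sub>R e + \<gamma> *\<^sub>R f, k3)} \<subseteq>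
     {P. e \<bullet> P \<in> {s} \<and> f \<bullet> P \<in> BQ \<and> n \<bullet> P \<in> CM} \<times> {v. e \<bullet> v \<in> AX \<and> f \<bullet> v \<in> BY \<and> n \<bullet> v \<in> CZ}"
  proof
    fix w assume "w \<in> tangent_pairs R {(\<alpha> *\<^sub>R e, k1), (\<tau> *\<^sub>R e, k2), (\<beta> *\<^sub>R e + \<gamma> *\<^sub>R f, k3)}"
    then obtain P v where w: "w = (P, v)" and vv: "v \<bullet> v = 1" and Pv: "P \<bullet> v = 0" and PP: "P \<bullet> P = R"
      and E: "2 * (\<alpha> * (e \<bullet> P)) = k1 - (\<alpha> * (e \<bullet> v))\<^sup>2" "2 * (\<tau> * (e \<bullet> P)) = k2 - (\<tau> * (e \<bullet> v))\<^sup>2"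
        "2 * (\<beta> * (e \<bullet> P) + \<gamma> * (f \<bullet> P)) = k3 - (\<beta> * (e \<bullet> v) + \<gamma> * (f \<bullet> v))\<^sup>2"
      by (auto simp: tangent_pairs_def inner_add_left)
    define X y z q m where "X = e \<bullet> v" and "y = f \<bullet> v" and "z = n \<bullet> v" and "q = f \<bullet> P" and "m = n \<bullet> P"
    have "X\<^sup>2 * (\<alpha> * \<tau> * (\<tau> - \<alpha>)) = \<alpha> * k2 - \<tau> * k1"
      using E(1,2) unfolding X_def[symmetric] by algebra
    then have X2: "X\<^sup>2 = \<kappa>" using nz by (simp add: \<kappa>_def field_simps)
    then have XA: "X \<in> AX" unfolding AX_def by (rule square_root_cases)
    have s: "e \<bullet> P = s"
      using E(1) nz unfolding s_def X_def[symmetric] power_mult_distrib X2 by (simp add: field_simps)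
    have q: "2 * \<gamma> * q = Q X y"
      using E(3) unfolding s X_def[symmetric] y_def[symmetric] q_def[symmetric] Q_def h0_def h1_def h2_def
      by (simp add: power2_eq_square algebra_simps)
    have z2: "z\<^sup>2 = S - y\<^sup>2"
      using vv unfolding on(5)[of v v] X_def[symmetric] y_def[symmetric] z_def[symmetric] S_def X2[symmetric]
      by (simp add: power2_eq_square)
    have m2: "m\<^sup>2 = A - q\<^sup>2"
      using PP unfolding on(5)[of P P] s q_def[symmetric] m_def[symmetric] A_def by (simp add: power2_eq_square)
    have mz: "s * X + q * y + m * z = 0"
      using Pv unfolding on(5)[of P v] s X_def[symmetric] y_def[symmetric] z_def[symmetric] q_def[symmetric] m_def[symmetric] .
    have "(m * z)\<^sup>2 = (s * X + q * y)\<^sup>2" using mz by algebra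
    then have "(A - q\<^sup>2) * (S - y\<^sup>2) = (s * X + q * y)\<^sup>2" by (simp add: power_mult_distrib m2 z2)
    then have "A * S - A * y\<^sup>2 - S * q\<^sup>2 - s\<^sup>2 * X\<^sup>2 - 2 * s * X * q * y = 0" by algebra
    then have "4 * \<gamma>\<^sup>2 * (A * S - A * y\<^sup>2 - s\<^sup>2 * \<kappa>) - S * (2 * \<gamma> * q)\<^sup>2 - 4 * \<gamma> * s * X * (2 * \<gamma> * q) * y = 0"
      unfolding X2[symmetric] by algebra
    then have "c0 X + c1 X * y + c2 X * y ^ 2 + c3 X * y ^ 3 + (- S * h2\<^sup>2) * y ^ 4 = 0"
      unfolding q Q_def c0_def c1_def c2_def c3_def by algebra
    moreover have "y = 0" if "S = 0"
    proof -
      have "y\<^sup>2 \<le> 0" using z2 that zero_le_power2[of z] by linarith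
      then show ?thesis by simp
    qed
    ultimately have yB: "y \<in> BY" using XA by (auto simp: BY_def)
    have "q = Q X y / (2 * \<gamma>)" using q nz by (simp add: field_simps)
    then have qB: "q \<in> BQ" using XA yB by (auto simp: BQ_def)
    have zC: "z \<in> CZ" using yB square_root_cases[OF z2] by (auto simp: CZ_def)
    have mC: "m \<in> CM" using qB square_root_cases[OF m2] by (auto simp: CM_def)
    show "w \<in> {P. e \<bullet> P \<in> {s} \<and> f \<bullet> P \<in> BQ \<and> n \<bullet> P \<in> CM} \<times> {v. e \<bullet> v \<in> AX \<and> f \<bullet> v \<in> BY \<and> n \<bullet> v \<in> CZ}"
      using XA yB qB zC mC s by (simp add: w X_def y_def z_def q_def m_def)
  qed
  moreover have "finite ({P. e \<bullet> P \<in> {s} \<and> f \<bullet> P \<in> BQ \<and> n \<bullet> P \<in> CM} \<times> {v. e \<bullet> v \<in> AX \<and> f \<bullet> v \<in> BY \<and> n \<bullet> v \<in> CZ})"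
    by (intro finite_SigmaI finite_vec_of_coords[OF on(4)] fA fB fC fQ fM finite.intros)
  ultimately show ?thesis by (rule finite_subset)
qed

text \<open>The discriminant of the conic is
  \<open>\<alpha> * \<beta> * (\<alpha> + \<beta> - 1)\<close>, nonzero exactly when no three of the
  points \<open>0\<close>, \<open>a1\<close>, \<open>a2\<close>,
  \<open>\<alpha> *\<^sub>R a1 + \<beta> *\<^sub>R a2\<close> are collinear. The sextic is the
  squared orthogonality of \<open>P\<close> and \<open>v\<close>, with the normal components
  eliminated by the two norm equations.\<close>

lemma finite_tangent_pairs_coplanar:
  fixes a1 a2 :: "real^3"
  assumes ind: "cross3 a1 a2 \<noteq> 0"
    and nz: "\<alpha> \<noteq> 0" "\<beta> \<noteq> 0" "\<alpha> + \<beta> \<noteq> 1"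
  shows "finite (tangent_pairs R {(a1, k1), (a2, k2), (\<alpha> *\<^sub>R a1 + \<beta> *\<^sub>R a2, k3)})"
proof -
  define n where "n = cross3 a1 a2"
  have "a1 \<bullet> (cross3 a2 n) = n \<bullet> n"
    unfolding n_def by (simp add: cross3_simps)
  then have "a1 \<bullet> (cross3 a2 n) \<noteq> 0" using ind by (simp add: n_def)
  then obtain d1 d2 d3 where exp: "\<And>v. v = (a1 \<bullet> v) *\<^sub>R d1 + (a2 \<bullet> v) *\<^sub>R d2 + (n \<bullet> v) *\<^sub>R d3"
    and dual: "a1 \<bullet> d1 = 1" "a1 \<bullet> d2 = 0" "a1 \<bullet> d3 = 0"
    "a2 \<bullet> d1 = 0" "a2 \<bullet> d2 = 1" "a2 \<bullet> d3 = 0"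
    "n \<bullet> d1 = 0" "n \<bullet> d2 = 0" "n \<bullet> d3 = 1"
    using dual_basis by metis
  have an: "a1 \<bullet> n = 0" "a2 \<bullet> n = 0" by (simp_all add: n_def dot_cross_self)
  have n3: "n = (n \<bullet> n) *\<^sub>R d3" using exp[of n] an by simp
  have nn: "n \<bullet> n \<noteq> 0" using ind by (simp add: n_def)
  have d3: "d1 \<bullet> d3 = 0" "d2 \<bullet> d3 = 0"
  proof -
    have "(n \<bullet> n) * (d3 \<bullet> d) = n \<bullet> d" for d using n3 by (metis inner_scaleR_left)
    then show "d1 \<bullet> d3 = 0" "d2 \<bullet> d3 = 0" using dual nn by (metis inner_commute mult_eq_0_iff)+
  qed
  define g11 g12 g22 h where "g11 = d1 \<bullet> d1" and "g12 = d1 \<bullet> d2" and "g22 = d2 \<bullet> d2" and "h = d3 \<bullet> d3"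
  have g0: "g11 \<noteq> 0" "g22 \<noteq> 0" "g11 + 2 * g12 + g22 \<noteq> 0" "h \<noteq> 0"
  proof -
    show "g11 \<noteq> 0" "g22 \<noteq> 0" "h \<noteq> 0" using dual by (auto simp: g11_def g22_def h_def)
    have "d1 + d2 \<noteq> 0" using dual by (metis add_0_right inner_add_right inner_zero_right zero_neq_one)
    then have "(d1 + d2) \<bullet> (d1 + d2) \<noteq> 0" by simp
    then show "g11 + 2 * g12 + g22 \<noteq> 0"
      by (simp add: g11_def g12_def g22_def inner_add_left inner_add_right inner_commute)
  qed
  define D where "D = g11 * g22 - g12\<^sup>2"
  have D0: "D \<noteq> 0"
  proof
    assume "D = 0"
    define w where "w = g22 *\<^sub>R d1 - g12 *\<^sub>R d2"
    have "w \<bullet> w = g22 * D"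
      unfolding w_def D_def by (simp add: g11_def g12_def g22_def inner_diff_left inner_diff_right inner_commute power2_eq_square algebra_simps)
    then have "w = 0" using \<open>D = 0\<close> by simp
    moreover have "a1 \<bullet> w = g22" using dual by (simp add: w_def inner_diff_right)
    ultimately show False using g0 by simp
  qed
  have ip: "u \<bullet> w = g11 * (a1 \<bullet> u) * (a1 \<bullet> w) + g12 * ((a1 \<bullet> u) * (a2 \<bullet> w) + (a2 \<bullet> u) * (a1 \<bullet> w)) + g22 * (a2 \<bullet> u) * (a2 \<bullet> w)
     + h * (n \<bullet> u) * (n \<bullet> w)" for u w
  proof -
    have "u \<bullet> w = ((a1 \<bullet> u) *\<^sub>R d1 + (a2 \<bullet> u) *\<^sub>R d2 + (n \<bullet> u) *\<^sub>R d3) \<bullet> ((a1 \<bullet> w) *\<^sub>R d1 + (a2 \<bullet> w) *\<^sub>R d2 + (n \<bullet> w) *\<^sub>R d3)"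
      using exp[of u] exp[of w] by simp
    also have "\<dots> = g11 * (a1 \<bullet> u) * (a1 \<bullet> w) + g12 * ((a1 \<bullet> u) * (a2 \<bullet> w) + (a2 \<bullet> u) * (a1 \<bullet> w)) + g22 * (a2 \<bullet> u) * (a2 \<bullet> w)
     + h * (n \<bullet> u) * (n \<bullet> w)"
      using d3 inner_commute[of d3 d1] inner_commute[of d3 d2] inner_commute[of d2 d1]
      by (simp add: inner_add_left inner_add_right g11_def g12_def g22_def h_def algebra_simps)
    finally show ?thesis .
  qed
  define W where "W X Y = g11 * X\<^sup>2 + 2 * g12 * X * Y + g22 * Y\<^sup>2" for X Y
  \<comment> \<open>The three linear equations combined with weights \<open>\<alpha>\<close>,
    \<open>\<beta>\<close> and \<open>- 1\<close>: \<open>P\<close> cancels and a conic in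
    \<open>X\<close>, \<open>Y\<close> remains.\<close>
  define a b c K where "a = \<alpha> * (1 - \<alpha>)" and "b = - \<alpha> * \<beta>" and "c = \<beta> * (1 - \<beta>)" and "K = \<alpha> * k1 + \<beta> * k2 - k3"
  have "b\<^sup>2 - a * c = \<alpha> * \<beta> * (\<alpha> + \<beta> - 1)"
    unfolding a_def b_def c_def by algebra
  then have disc: "b\<^sup>2 - a * c \<noteq> 0" using nz by simp
  define Z where "Z = {(X, Y). a * X\<^sup>2 + 2 * b * X * Y + c * Y\<^sup>2 = K \<and>
      g11 * (k1 - X\<^sup>2)\<^sup>2 + 2 * g12 * (k1 - X\<^sup>2) * (k2 - Y\<^sup>2) + g22 * (k2 - Y\<^sup>2)\<^sup>2
      - 4 * R * (1 - (g11 * X\<^sup>2 + 2 * g12 * X * Y + g22 * Y\<^sup>2))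
      - D * ((k1 - X\<^sup>2) * Y - (k2 - Y\<^sup>2) * X)\<^sup>2 = 0}"
  have fZ: "finite Z" unfolding Z_def by (rule finite_conic_sextic[OF disc D0 g0(1-3)])
  define CZ where "CZ = (\<Union>(X, Y)\<in>Z. {sqrt ((1 - W X Y) / h), - sqrt ((1 - W X Y) / h)})"
  define AP BP where "AP = (\<lambda>(X, Y). (k1 - X\<^sup>2) / 2) ` Z" and "BP = (\<lambda>(X, Y). (k2 - Y\<^sup>2) / 2) ` Z"
  define CP where "CP = (\<Union>(X, Y)\<in>Z. {sqrt ((R - W ((k1 - X\<^sup>2) / 2) ((k2 - Y\<^sup>2) / 2)) / h), - sqrt ((R - W ((k1 - X\<^sup>2) / 2) ((k2 - Y\<^sup>2) / 2)) / h)})"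
  have fin: "finite CZ" "finite AP" "finite BP" "finite CP" "finite (fst ` Z)" "finite (snd ` Z)"
    using fZ by (auto simp: CZ_def AP_def BP_def CP_def)
  have "tangent_pairs R {(a1, k1), (a2, k2), (\<alpha> *\<^sub>R a1 + \<beta> *\<^sub>R a2, k3)} \<subseteq>
    {P. a1 \<bullet> P \<in> AP \<and> a2 \<bullet> P \<in> BP \<and> n \<bullet> P \<in> CP} \<times> {v. a1 \<bullet> v \<in> fst ` Z \<and> a2 \<bullet> v \<in> snd ` Z \<and> n \<bullet> v \<in> CZ}"
  proof
    fix w assume "w \<in> tangent_pairs R {(a1, k1), (a2, k2), (\<alpha> *\<^sub>R a1 + \<beta> *\<^sub>R a2, k3)}"
    then obtain P v where w: "w = (P, v)" and vv: "v \<bullet> v = 1" and Pv: "P \<bullet> v = 0" and PP: "P \<bullet> P = R"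
      and E: "2 * (a1 \<bullet> P) = k1 - (a1 \<bullet> v)\<^sup>2" "2 * (a2 \<bullet> P) = k2 - (a2 \<bullet> v)\<^sup>2"
        "2 * (\<alpha> * (a1 \<bullet> P) + \<beta> * (a2 \<bullet> P)) = k3 - (\<alpha> * (a1 \<bullet> v) + \<beta> * (a2 \<bullet> v))\<^sup>2"
      by (auto simp: tangent_pairs_def inner_add_left)
    define X Y z x y m where "X = a1 \<bullet> v" and "Y = a2 \<bullet> v" and "z = n \<bullet> v"
      and "x = a1 \<bullet> P" and "y = a2 \<bullet> P" and "m = n \<bullet> P"
    note fold = X_def[symmetric] Y_def[symmetric] z_def[symmetric] x_def[symmetric] y_def[symmetric] m_def[symmetric]
    note E' = E[unfolded fold]
    have con: "a * X\<^sup>2 + 2 * b * X * Y + c * Y\<^sup>2 = K"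
      using E' unfolding a_def b_def c_def K_def by algebra
    have z2: "h * z\<^sup>2 = 1 - W X Y"
      using vv unfolding ip[of v v] fold W_def by (simp add: power2_eq_square algebra_simps)
    have m2: "h * m\<^sup>2 = R - W x y"
      using PP unfolding ip[of P P] fold W_def by (simp add: power2_eq_square algebra_simps)
    have mz: "h * m * z = - (g11 * x * X + g12 * (x * Y + y * X) + g22 * y * Y)"
      using Pv unfolding ip[of P v] fold by simp
    have "(h * m * z)\<^sup>2 = (1 - W X Y) * (R - W x y)"
      unfolding z2[symmetric] m2[symmetric] by (simp add: power2_eq_square)
    \<comment> \<open>Lagrange's identity: the square of the bilinear form of \<open>W\<close> is
      \<open>W x y * W X Y - D * (x * Y - y * X)\<^sup>2\<close>. The product of the two values of
      \<open>W\<close> cancels, so the degree in \<open>X\<close>, \<open>Y\<close> stays at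
      six.\<close>
    then have "W x y - R * (1 - W X Y) - D * (x * Y - y * X)\<^sup>2 = 0"
      unfolding mz W_def D_def by algebra
    then have "W (2 * x) (2 * y) - 4 * R * (1 - W X Y) - D * ((2 * x) * Y - (2 * y) * X)\<^sup>2 = 0"
      unfolding W_def by algebra
    then have Z: "(X, Y) \<in> Z"
      unfolding E' using con by (simp add: Z_def W_def)
    have xy: "x = (k1 - X\<^sup>2) / 2" "y = (k2 - Y\<^sup>2) / 2" using E' by simp_all
    have "z\<^sup>2 = (1 - W X Y) / h" using z2 g0 by (simp add: field_simps)
    from square_root_cases[OF this] have zC: "z \<in> CZ"
      unfolding CZ_def by (intro UN_I[OF Z]) simp
    have "m\<^sup>2 = (R - W ((k1 - X\<^sup>2) / 2) ((k2 - Y\<^sup>2) / 2)) / h" using m2 g0 xy by (simp add: field_simps)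
    from square_root_cases[OF this] have mC: "m \<in> CP"
      unfolding CP_def by (intro UN_I[OF Z]) simp
    have "X \<in> fst ` Z" "Y \<in> snd ` Z" "x \<in> AP" "y \<in> BP" using Z xy by (force simp: AP_def BP_def)+
    then show "w \<in> {P. a1 \<bullet> P \<in> AP \<and> a2 \<bullet> P \<in> BP \<and> n \<bullet> P \<in> CP} \<times> {v. a1 \<bullet> v \<in> fst ` Z \<and> a2 \<bullet> v \<in> snd ` Z \<and> n \<bullet> v \<in> CZ}"
      using zC mC by (simp add: w fold)
  qed
  moreover have "finite ({P. a1 \<bullet> P \<in> AP \<and> a2 \<bullet> P \<in> BP \<and> n \<bullet> P \<in> CP} \<times> {v. a1 \<bullet> v \<in> fst ` Z \<and> a2 \<bullet> v \<in> snd ` Z \<and> n \<bullet> v \<in> CZ})"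
    by (intro finite_SigmaI finite_vec_of_coords[OF exp] fin)
  ultimately show ?thesis by (rule finite_subset)
qed

section \<open>Non-collinear centers: reduction to the three positions\<close>

lemma dual_basis_swap:
  fixes a1 a2 a3 :: "real^3"
  assumes "\<And>v. v = (a1 \<bullet> v) *\<^sub>R d1 + (a2 \<bullet> v) *\<^sub>R d2 + (a3 \<bullet> v) *\<^sub>R d3"
  shows "w = (d1 \<bullet> w) *\<^sub>R a1 + (d2 \<bullet> w) *\<^sub>R a2 + (d3 \<bullet> w) *\<^sub>R a3"
proof -
  have "v \<bullet> w = v \<bullet> ((d1 \<bullet> w) *\<^sub>R a1 + (d2 \<bullet> w) *\<^sub>R a2 + (d3 \<bullet> w) *\<^sub>R a3)" for v
  proof -
    have "v \<bullet> w = ((a1 \<bullet> v) *\<^sub>R d1 + (a2 \<bullet> v) *\<^sub>R d2 + (a3 \<bullet> v) *\<^sub>R d3) \<bullet> w"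
      using assms[of v] by simp
    then show ?thesis by (simp add: inner_add_left inner_add_right inner_commute mult.commute)
  qed
  then show ?thesis using vector_eq_ldot by blast
qed

lemma orthonormal_pair:
  fixes a b :: "real^3"
  assumes "cross3 a b \<noteq> 0"
  obtains e f \<beta> \<gamma> where "e \<bullet> e = 1" "f \<bullet> f = 1" "e \<bullet> f = 0" "a = norm a *\<^sub>R e" "b = \<beta> *\<^sub>R e + \<gamma> *\<^sub>R f" "\<gamma> \<noteq> 0"
proof -
  have a: "a \<noteq> 0" using assms by auto
  define e where "e = a /\<^sub>R norm a"
  have e: "e \<bullet> e = 1" "a = norm a *\<^sub>R e" using a by (simp_all add: e_def dot_square_norm power2_eq_square)
  define w where "w = b - (e \<bullet> b) *\<^sub>R e"
  have "w \<noteq> 0"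
  proof
    assume "w = 0"
    then have b: "b = (e \<bullet> b) *\<^sub>R e" by (simp add: w_def)
    have "cross3 a b = cross3 (norm a *\<^sub>R e) ((e \<bullet> b) *\<^sub>R e)" using e(2) b by simp
    then show False using assms by (simp add: cross_mult_left cross_mult_right)
  qed
  define f where "f = w /\<^sub>R norm w"
  have f: "f \<bullet> f = 1" "w = norm w *\<^sub>R f" using \<open>w \<noteq> 0\<close> by (simp_all add: f_def dot_square_norm power2_eq_square)
  have "e \<bullet> w = 0" using e by (simp add: w_def inner_diff_right)
  then have "e \<bullet> f = 0" by (simp add: f_def)
  moreover have "b = (e \<bullet> b) *\<^sub>R e + norm w *\<^sub>R f" using f(2) by (simp add: w_def)
  ultimately show ?thesis using that[OF e(1) f(1) _ e(2)] \<open>w \<noteq> 0\<close> by simp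
qed

lemma collinear_3_shift: "collinear {x, y, z} \<longleftrightarrow> collinear {0, x - y, z - y}" for x y z :: "real^3"
  by (rule collinear_3) (simp add: NO_MATCH_def)

lemma finite_common_tangents_three_collinear:
  fixes x0 x1 x2 x3 :: "real^3"
  assumes r: "r0 > 0" "r1 > 0" "r2 > 0" "r3 > 0"
    and dist: "x0 \<noteq> x1" "x0 \<noteq> x2" "x1 \<noteq> x2"
    and col: "collinear {x0, x1, x2}" and ncol: "\<not> collinear {x0, x1, x2, x3}"
  shows "finite {l. tangent_line (sphere x0 r0) l \<and> tangent_line (sphere x1 r1) l \<and>
    tangent_line (sphere x2 r2) l \<and> tangent_line (sphere x3 r3) l}"
proof -
  have "collinear {x1, x0, x2}" using col by (simp add: insert_commute)
  then obtain t where t: "x2 - x0 = t *\<^sub>R (x1 - x0)"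
    using dist unfolding collinear_3_shift[of x1 x0 x2] collinear_lemma by auto
  have "cross3 (x1 - x0) (x3 - x0) \<noteq> 0"
  proof
    assume "cross3 (x1 - x0) (x3 - x0) = 0"
    then obtain s where s: "x3 - x0 = s *\<^sub>R (x1 - x0)"
      using dist unfolding cross_eq_0 collinear_lemma by (metis diff_eq_diff_eq eq_iff_diff_eq_0 scale_zero_left)
    have "x0 = x0 + 0 *\<^sub>R (x1 - x0)" "x1 = x0 + 1 *\<^sub>R (x1 - x0)" "x2 = x0 + t *\<^sub>R (x1 - x0)" "x3 = x0 + s *\<^sub>R (x1 - x0)"
      using t s by (simp_all add: algebra_simps)
    then have "{x0, x1, x2, x3} \<subseteq> affine hull {x0, x1}" unfolding affine_hull_2_alt by blast
    then show False using ncol collinear_affine_hull by blast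
  qed
  then obtain e f \<beta> \<gamma> where ef: "e \<bullet> e = 1" "f \<bullet> f = 1" "e \<bullet> f = 0"
    and a: "x1 - x0 = norm (x1 - x0) *\<^sub>R e" and b: "x3 - x0 = \<beta> *\<^sub>R e + \<gamma> *\<^sub>R f" and g: "\<gamma> \<noteq> 0"
    by (rule orthonormal_pair)
  define \<alpha> where "\<alpha> = norm (x1 - x0)"
  have a': "x1 - x0 = \<alpha> *\<^sub>R e" using a \<alpha>_def by simp
  have a2: "x2 - x0 = (t * \<alpha>) *\<^sub>R e" using t a' by simp
  have "\<alpha> \<noteq> 0" "t \<noteq> 0" using dist t by (auto simp: \<alpha>_def)
  moreover have "t \<noteq> 1" using dist t by auto
  ultimately have "finite (tangent_pairs R {(x1 - x0, k1), (x2 - x0, k2), (x3 - x0, k3)})" for R k1 k2 k3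
    unfolding a' a2 b by (intro finite_tangent_pairs_three_collinear ef g) auto
  then show ?thesis by (rule finite_common_tangents[OF r])
qed

text \<open>The order of the spheres is immaterial, so a collinear triple of centers can be moved to
  the front. Without such a triple the differences to \<open>x0\<close> are either independent or
  satisfy the three inequalities of the coplanar case, one for each of the triples other than
  \<open>x0\<close>, \<open>x1\<close>, \<open>x2\<close>.\<close>

lemma finite_common_tangents_noncollinear:
  fixes x0 x1 x2 x3 :: "real^3"
  assumes r: "r0 > 0" "r1 > 0" "r2 > 0" "r3 > 0"
    and dist: "distinct [x0, x1, x2, x3]" and ncol: "\<not> collinear {x0, x1, x2, x3}"
  shows "finite {l. tangent_line (sphere x0 r0) l \<and> tangent_line (sphere x1 r1) l \<and>
    tangent_line (sphere x2 r2) l \<and> tangent_line (sphere x3 r3) l}"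
proof -
  consider "collinear {x0, x1, x2}" | "collinear {x0, x1, x3}" | "collinear {x0, x2, x3}" | "collinear {x1, x2, x3}"
    | "\<not> collinear {x0, x1, x2}" "\<not> collinear {x0, x1, x3}" "\<not> collinear {x0, x2, x3}" "\<not> collinear {x1, x2, x3}"
    by blast
  then show ?thesis
  proof cases
    case 1
    then show ?thesis using finite_common_tangents_three_collinear[of r0 r1 r2 r3 x0 x1 x2 x3] r dist ncol by simp
  next
    case 2
    have "\<not> collinear {x0, x1, x3, x2}" using ncol by (simp add: insert_commute)
    then show ?thesis
      using finite_common_tangents_three_collinear[of r0 r1 r3 r2 x0 x1 x3 x2] 2 r dist
      by (simp add: conj_commute conj_left_commute)
  next
    case 3
    have "\<not> collinear {x0, x2, x3, x1}" using ncol by (simp add: insert_commute)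
    then show ?thesis
      using finite_common_tangents_three_collinear[of r0 r2 r3 r1 x0 x2 x3 x1] 3 r dist
      by (simp add: conj_commute conj_left_commute)
  next
    case 4
    have "\<not> collinear {x1, x2, x3, x0}" using ncol by (simp add: insert_commute)
    then show ?thesis
      using finite_common_tangents_three_collinear[of r1 r2 r3 r0 x1 x2 x3 x0] 4 r dist
      by (simp add: conj_commute conj_left_commute)
  next
    case 5
    define a1 a2 a3 where "a1 = x1 - x0" and "a2 = x2 - x0" and "a3 = x3 - x0"
    have "finite (tangent_pairs R {(a1, k1), (a2, k2), (a3, k3)})" for R k1 k2 k3
    proof (cases "a1 \<bullet> cross3 a2 a3 = 0")
      case False
      then show ?thesis by (rule finite_tangent_pairs_independent)
    next
      case True
      have nc: "\<not> collinear {0, x - y, z - y}" if "\<not> collinear {y, x, z}" for x y z :: "real^3"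
        using that collinear_3_shift[of x y z] by (simp add: insert_commute)
      have c12: "cross3 a1 a2 \<noteq> 0"
        unfolding cross_eq_0 a1_def a2_def by (rule nc[OF 5(1)])
      define n where "n = cross3 a1 a2"
      have "a1 \<bullet> cross3 a2 n = n \<bullet> n" unfolding n_def by (simp add: cross3_simps)
      then have "a1 \<bullet> cross3 a2 n \<noteq> 0" using c12 by (simp add: n_def)
      then obtain d1 d2 d3 where exp: "\<And>v. v = (a1 \<bullet> v) *\<^sub>R d1 + (a2 \<bullet> v) *\<^sub>R d2 + (n \<bullet> v) *\<^sub>R d3"
        using dual_basis by metis
      have "n = (n \<bullet> n) *\<^sub>R d3" using exp[of n] by (simp add: n_def dot_cross_self)
      then have "n \<bullet> a3 = (n \<bullet> n) * (d3 \<bullet> a3)" by (metis inner_scaleR_left)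
      moreover have "n \<bullet> a3 = a1 \<bullet> cross3 a2 a3" unfolding n_def by (simp add: cross3_simps)
      ultimately have "d3 \<bullet> a3 = 0" using True c12 by (simp add: n_def)
      then have a3: "a3 = (d1 \<bullet> a3) *\<^sub>R a1 + (d2 \<bullet> a3) *\<^sub>R a2"
        using dual_basis_swap[OF exp, of a3] by simp
      define \<alpha> \<beta> where "\<alpha> = d1 \<bullet> a3" and "\<beta> = d2 \<bullet> a3"
      have a3: "a3 = \<alpha> *\<^sub>R a1 + \<beta> *\<^sub>R a2" using a3 \<alpha>_def \<beta>_def by simp
      have "\<alpha> \<noteq> 0"
        using nc[OF 5(3)] a3 unfolding a2_def[symmetric] a3_def[symmetric] collinear_lemma by auto
      moreover have "\<beta> \<noteq> 0"
        using nc[OF 5(2)] a3 unfolding a1_def[symmetric] a3_def[symmetric] collinear_lemma by auto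
      moreover have "\<alpha> + \<beta> \<noteq> 1"
      proof
        assume "\<alpha> + \<beta> = 1"
        then have "\<alpha> = 1 - \<beta>" by simp
        then have "a3 - a1 = \<beta> *\<^sub>R (a2 - a1)" unfolding a3 by (simp add: scaleR_left_diff_distrib scaleR_right_diff_distrib)
        then have "x3 - x1 = \<beta> *\<^sub>R (x2 - x1)" by (simp add: a1_def a2_def a3_def)
        then show False using nc[OF 5(4)] unfolding collinear_lemma by auto
      qed
      ultimately show ?thesis
        unfolding a3 by (intro finite_tangent_pairs_coplanar c12)
    qed
    then show ?thesis unfolding a1_def a2_def a3_def by (rule finite_common_tangents[OF r])
  qed
qed

text \<open>The radius is the distance from the center to the common tangent, so concentric spheres
  with a common tangent coincide. This is how distinct spheres yield distinct centers.\<close>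

lemma common_tangent_centers_inj:
  fixes c :: "'i \<Rightarrow> real^3"
  assumes "\<And>i. r i > 0" "\<And>i. S i = sphere (c i) (r i)" "inj S" "common_tangent_lines S \<noteq> {}"
  shows "inj c"
proof (rule injI)
  fix i j assume c: "c i = c j"
  obtain l where l: "tangent_line (S k) l" for k
    using assms(4) by (auto simp: common_tangent_lines_def)
  have "is_line l" using l[of i] by (simp add: tangent_line_def)
  then obtain p v where v: "v \<bullet> v = 1" and lp: "l = range (\<lambda>t. p + t *\<^sub>R v)"
    unfolding is_line_iff_unit by (elim exE conjE)
  have e: "(p - c k) \<bullet> (p - c k) - ((p - c k) \<bullet> v)\<^sup>2 = (r k)\<^sup>2" for k
    using l[of k] tangent_line_unit_iff[OF v assms(1)] unfolding assms(2) lp by blast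
  have "(r i)\<^sup>2 = (r j)\<^sup>2" using e[of i] e[of j] c by simp
  then have "r i = r j" using assms(1)[of i] assms(1)[of j] by (simp add: power2_eq_iff)
  then have "S i = S j" using c assms(2) by simp
  then show "i = j" using assms(3) by (simp add: inj_eq)
qed

lemma infinite_common_tangents_imp_collinear:
  fixes c :: "4 \<Rightarrow> real^3" and r :: "4 \<Rightarrow> real"
  assumes "\<And>i. r i > 0" "\<And>i. S i = sphere (c i) (r i)" "inj S" "infinite (common_tangent_lines S)"
  shows "collinear (range c)"
proof (rule ccontr)
  assume nc: "\<not> collinear (range c)"
  have "common_tangent_lines S \<noteq> {}" using assms(4) by auto
  then have "inj c" using assms(1-3) by (intro common_tangent_centers_inj)
  then have "distinct [c 1, c 2, c 3, c 4]" by (simp add: inj_eq)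
  moreover have "\<not> collinear {c 1, c 2, c 3, c 4}" using nc by (simp add: UNIV_4)
  ultimately have "finite {l. tangent_line (sphere (c 1) (r 1)) l \<and> tangent_line (sphere (c 2) (r 2)) l \<and>
    tangent_line (sphere (c 3) (r 3)) l \<and> tangent_line (sphere (c 4) (r 4)) l}"
    by (intro finite_common_tangents_noncollinear assms(1))
  moreover have "common_tangent_lines S \<subseteq> {l. tangent_line (sphere (c 1) (r 1)) l \<and> tangent_line (sphere (c 2) (r 2)) l \<and>
    tangent_line (sphere (c 3) (r 3)) l \<and> tangent_line (sphere (c 4) (r 4)) l}"
    using assms(2) by (auto simp: common_tangent_lines_def)
  ultimately show False using assms(4) finite_subset by blast
qed

section \<open>Rotating a line about an axis\<close>

text \<open>A nonzero vector orthogonal to the radius is the velocity of a great circle run through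
  with angular speed \<open>norm v / r\<close>; the converse differentiates the equation of the
  sphere.\<close>

lemma tangent_vectors_sphere:
  fixes c p :: "real^3"
  assumes r: "r > 0" and p: "p \<in> sphere c r"
  shows "tangent_vectors (sphere c r) p = {v. v \<bullet> (p - c) = 0}"
proof (intro equalityI subsetI)
  fix v assume "v \<in> tangent_vectors (sphere c r) p"
  then obtain g where g: "g 0 = p" "\<And>t. g t \<in> sphere c r" "(g has_vector_derivative v) (at (0::real))"
    by (auto simp: tangent_vectors_def)
  have g': "((\<lambda>t. g t - c) has_vector_derivative v) (at 0)"
    unfolding has_vector_derivative_diff_const by (rule g(3))
  have "((\<lambda>t. (g t - c) \<bullet> (g t - c)) has_vector_derivative ((g 0 - c) \<bullet> v + v \<bullet> (g 0 - c))) (at 0)"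
    by (rule bounded_bilinear.has_vector_derivative[OF bounded_bilinear_inner g' g'])
  moreover have "(\<lambda>t. (g t - c) \<bullet> (g t - c)) = (\<lambda>t. r\<^sup>2)"
    using g(2) by (auto simp: dot_square_norm dist_norm norm_minus_commute)
  ultimately have "((\<lambda>t::real. r\<^sup>2) has_vector_derivative ((g 0 - c) \<bullet> v + v \<bullet> (g 0 - c))) (at 0)"
    by simp
  then have "(g 0 - c) \<bullet> v + v \<bullet> (g 0 - c) = 0"
    by (rule vector_derivative_unique_at) (rule has_vector_derivative_const)
  then show "v \<in> {v. v \<bullet> (p - c) = 0}" using g(1) by (simp add: inner_commute)
next
  fix v assume "v \<in> {v. v \<bullet> (p - c) = 0}"
  then have vp: "v \<bullet> (p - c) = 0" by simp
  have pp: "(p - c) \<bullet> (p - c) = r\<^sup>2" using p by (simp add: dot_square_norm dist_norm norm_minus_commute)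
  show "v \<in> tangent_vectors (sphere c r) p"
  proof (cases "v = 0")
    case True
    then show ?thesis unfolding tangent_vectors_def using p
      by (auto intro!: exI[of _ "\<lambda>_. p"])
  next
    case False
    define \<omega> where "\<omega> = norm v / r"
    have w: "\<omega> \<noteq> 0" using False r by (simp add: \<omega>_def)
    have vv: "v \<bullet> v = (\<omega> * r)\<^sup>2" using r by (simp add: \<omega>_def dot_square_norm)
    define g where "g t = c + cos (\<omega> * t) *\<^sub>R (p - c) + (sin (\<omega> * t) / \<omega>) *\<^sub>R v" for t
    have "g t \<in> sphere c r" for t
    proof -
      have "(norm (g t - c))\<^sup>2 = (cos (\<omega> * t))\<^sup>2 * r\<^sup>2 + (sin (\<omega> * t) / \<omega>)\<^sup>2 * (\<omega> * r)\<^sup>2"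
        unfolding power2_norm_eq_inner g_def vv[symmetric] pp[symmetric]
        using vp by (simp add: inner_add_left inner_add_right inner_commute power2_eq_square)
      also have "\<dots> = r\<^sup>2 * ((cos (\<omega> * t))\<^sup>2 + (sin (\<omega> * t))\<^sup>2)"
        using w by (simp add: power_mult_distrib power_divide distrib_left mult.commute del: sin_cos_squared_add2)
      also have "\<dots> = r\<^sup>2" by simp
      finally show ?thesis using r by (simp add: dist_norm norm_minus_commute)
    qed
    moreover have "(g has_vector_derivative v) (at 0)"
      unfolding g_def using w by (auto intro!: derivative_eq_intros)
    moreover have "g 0 = p" by (simp add: g_def)
    ultimately show ?thesis unfolding tangent_vectors_def by blast
  qed
qed

text \<open>The assumptions do not involve the origin \<open>m\<close>, so the predicate
  \<open>axis_frame\<close> takes only the three vectors and one frame serves several origins. The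
  orientation is left open.\<close>

locale axis_frame =
  fixes m e1 e2 e3 :: "real^3"
  assumes unit: "e1 \<bullet> e1 = 1" "e2 \<bullet> e2 = 1" "e3 \<bullet> e3 = 1"
    and orth: "e1 \<bullet> e2 = 0" "e1 \<bullet> e3 = 0" "e2 \<bullet> e3 = 0"
begin

lemma orth': "e2 \<bullet> e1 = 0" "e3 \<bullet> e1 = 0" "e3 \<bullet> e2 = 0"
  using orth by (simp_all add: inner_commute)

lemma expand: "v = (v \<bullet> e1) *\<^sub>R e1 + (v \<bullet> e2) *\<^sub>R e2 + (v \<bullet> e3) *\<^sub>R e3"
proof -
  define n where "n = cross3 e1 e2"
  note on = orthonormal_cross[OF unit(1,2) orth(1), folded n_def]
  \<comment> \<open>\<open>e3\<close> is \<open>n\<close> or \<open>- n\<close>; the sign occurs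
    twice in the last term of the expansion and cancels.\<close>
  have e3: "e3 = (n \<bullet> e3) *\<^sub>R n" using on(4)[of e3] orth by simp
  then have "e3 \<bullet> e3 = (n \<bullet> e3) * (n \<bullet> e3)" by (metis inner_scaleR_left)
  then have 1: "(n \<bullet> e3) * (n \<bullet> e3) = 1" using unit by simp
  have "(v \<bullet> e3) *\<^sub>R e3 = ((n \<bullet> e3) * (v \<bullet> n)) *\<^sub>R ((n \<bullet> e3) *\<^sub>R n)"
    using e3 by (metis inner_scaleR_right)
  also have "\<dots> = (((n \<bullet> e3) * (n \<bullet> e3)) * (n \<bullet> v)) *\<^sub>R n" by (simp add: inner_commute mult_ac)
  also have "\<dots> = (n \<bullet> v) *\<^sub>R n" unfolding 1 by simp
  finally show ?thesis using on(4)[of v] by (simp add: inner_commute)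
qed

lemma inner_expand: "u \<bullet> w = (u \<bullet> e1) * (w \<bullet> e1) + (u \<bullet> e2) * (w \<bullet> e2) + (u \<bullet> e3) * (w \<bullet> e3)"
proof -
  have "u \<bullet> w = ((u \<bullet> e1) *\<^sub>R e1 + (u \<bullet> e2) *\<^sub>R e2 + (u \<bullet> e3) *\<^sub>R e3) \<bullet> w"
    using expand[of u] by simp
  also have "\<dots> = (u \<bullet> e1) * (w \<bullet> e1) + (u \<bullet> e2) * (w \<bullet> e2) + (u \<bullet> e3) * (w \<bullet> e3)"
    by (simp only: inner_add_left inner_scaleR_left inner_commute[of e1 w] inner_commute[of e2 w] inner_commute[of e3 w])
  finally show ?thesis .
qed

lemma eqI: "u \<bullet> e1 = w \<bullet> e1 \<Longrightarrow> u \<bullet> e2 = w \<bullet> e2 \<Longrightarrow> u \<bullet> e3 = w \<bullet> e3 \<Longrightarrow> u = w"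
  using expand[of u] expand[of w] by simp

lemmas frame_simps = inner_add_left inner_diff_left inner_add_right inner_diff_right unit orth orth'

definition radial :: "real \<Rightarrow> real^3" where "radial \<theta> = cos \<theta> *\<^sub>R e1 + sin \<theta> *\<^sub>R e2"
definition tangential :: "real \<Rightarrow> real^3" where "tangential \<theta> = - sin \<theta> *\<^sub>R e1 + cos \<theta> *\<^sub>R e2"
text \<open>The direction is perpendicular to \<open>radial \<theta>\<close>, so \<open>m\<close> is
  the foot on the axis of a common perpendicular of length \<open>\<bar>\<rho>\<bar>\<close>. For
  \<open>a\<^sup>2 + b\<^sup>2 = 1\<close>, up to sign \<open>a\<close> is the sine of the angle
  with the axis. Varying \<open>\<theta>\<close> rotates the line about the axis.\<close>

definition ruling :: "real \<Rightarrow> real \<Rightarrow> real \<Rightarrow> real \<Rightarrow> (real^3) set" where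
  "ruling \<rho> a b \<theta> = range (\<lambda>t. (m + \<rho> *\<^sub>R radial \<theta>) + t *\<^sub>R (a *\<^sub>R tangential \<theta> + b *\<^sub>R e3))"

lemma radial_simps [simp]:
  "radial \<theta> \<bullet> e1 = cos \<theta>" "radial \<theta> \<bullet> e2 = sin \<theta>" "radial \<theta> \<bullet> e3 = 0"
  "tangential \<theta> \<bullet> e1 = - sin \<theta>" "tangential \<theta> \<bullet> e2 = cos \<theta>" "tangential \<theta> \<bullet> e3 = 0"
  by (simp_all add: radial_def tangential_def frame_simps)

lemma unit_direction:
  assumes "a\<^sup>2 + b\<^sup>2 = 1"
  shows "(a *\<^sub>R tangential \<theta> + b *\<^sub>R e3) \<bullet> (a *\<^sub>R tangential \<theta> + b *\<^sub>R e3) = 1"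
proof -
  define d where "d = a *\<^sub>R tangential \<theta> + b *\<^sub>R e3"
  have d: "d \<bullet> e1 = - a * sin \<theta>" "d \<bullet> e2 = a * cos \<theta>" "d \<bullet> e3 = b"
    by (simp_all add: d_def frame_simps)
  have "d \<bullet> d = 1"
    unfolding inner_expand[of d d] d using sin_cos_squared_add[of \<theta>] assms by algebra
  then show ?thesis by (simp only: d_def)
qed

text \<open>Moving a center by \<open>s\<close> along the axis adds \<open>(s * a)\<^sup>2\<close>
  to its squared distance from the line. The angle \<open>\<theta>\<close> does not enter: tangency
  survives rotation.\<close>

lemma tangent_ruling_iff:
  assumes ab: "a\<^sup>2 + b\<^sup>2 = 1" and r: "r > 0"
  shows "tangent_line (sphere (m + s *\<^sub>R e3) r) (ruling \<rho> a b \<theta>) \<longleftrightarrow> \<rho>\<^sup>2 + (s * a)\<^sup>2 = r\<^sup>2"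
proof -
  define d where "d = a *\<^sub>R tangential \<theta> + b *\<^sub>R e3"
  define q where "q = m + \<rho> *\<^sub>R radial \<theta> - (m + s *\<^sub>R e3)"
  have dd: "d \<bullet> d = 1" unfolding d_def by (rule unit_direction[OF ab])
  have d: "d \<bullet> e1 = - a * sin \<theta>" "d \<bullet> e2 = a * cos \<theta>" "d \<bullet> e3 = b"
    by (simp_all add: d_def frame_simps)
  have q: "q \<bullet> e1 = \<rho> * cos \<theta>" "q \<bullet> e2 = \<rho> * sin \<theta>" "q \<bullet> e3 = - s"
    by (simp_all add: q_def frame_simps)
  have "q \<bullet> q = \<rho>\<^sup>2 + s\<^sup>2"
    unfolding inner_expand[of q q] q using sin_cos_squared_add[of \<theta>] by algebra
  moreover have "q \<bullet> d = - s * b" unfolding inner_expand[of q d] q d by algebra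
  ultimately have "q \<bullet> q - (q \<bullet> d)\<^sup>2 = \<rho>\<^sup>2 + (s * a)\<^sup>2" using ab by algebra
  then show ?thesis
    using tangent_line_unit_iff[OF dd r, of "m + s *\<^sub>R e3" "m + \<rho> *\<^sub>R radial \<theta>"]
    unfolding ruling_def d_def[symmetric] q_def[symmetric] by simp
qed

text \<open>\<open>nd\<close> excludes only the axis itself, which rotation fixes. A line determines
  its direction up to sign; angles below \<open>pi / 2\<close> have positive cosine, which settles
  the sign. Lines parallel to the axis are told apart by their position.\<close>

lemma infinite_rulings:
  assumes ab: "a\<^sup>2 + b\<^sup>2 = 1" and nd: "a \<noteq> 0 \<or> \<rho> \<noteq> 0"
  shows "infinite (range (ruling \<rho> a b))"
proof -
  have "inj_on (ruling \<rho> a b) {0<..<pi/2}"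
  proof (rule inj_onI)
    fix \<theta> \<phi> assume th: "\<theta> \<in> {0<..<pi/2}" "\<phi> \<in> {0<..<pi/2}" and eq: "ruling \<rho> a b \<theta> = ruling \<rho> a b \<phi>"
    define d where "d \<theta> = a *\<^sub>R tangential \<theta> + b *\<^sub>R e3" for \<theta>
    have c: "cos \<theta> > 0" "cos \<phi> > 0" using th by (auto intro: cos_gt_zero)
    have "(m + \<rho> *\<^sub>R radial \<theta>) + t *\<^sub>R d \<theta> \<in> ruling \<rho> a b \<theta>" for t
      unfolding ruling_def d_def by (rule rangeI)
    then have ex: "\<exists>t'. (m + \<rho> *\<^sub>R radial \<theta>) + t *\<^sub>R d \<theta> = (m + \<rho> *\<^sub>R radial \<phi>) + t' *\<^sub>R d \<phi>" for t
      unfolding eq unfolding ruling_def d_def by (blast elim: rangeE)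
    obtain s where s: "(m + \<rho> *\<^sub>R radial \<theta>) = (m + \<rho> *\<^sub>R radial \<phi>) + s *\<^sub>R d \<phi>"
      using ex[of 0] by auto
    obtain t where t: "(m + \<rho> *\<^sub>R radial \<theta>) + d \<theta> = (m + \<rho> *\<^sub>R radial \<phi>) + t *\<^sub>R d \<phi>"
      using ex[of 1] by auto
    have ceq: "cos \<theta> = cos \<phi>"
    proof (cases "a = 0")
      case False
      have dd: "d \<theta> = (t - s) *\<^sub>R d \<phi>" using s t by (simp add: scaleR_left_diff_distrib algebra_simps)
      have "1 = (t - s)\<^sup>2"
        using unit_direction[OF ab, of \<theta>] unit_direction[OF ab, of \<phi>] dd unfolding d_def[symmetric]
        by (simp add: power2_eq_square)
      then have "t - s = 1 \<or> t - s = -1" by (metis power2_eq_1_iff)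
      moreover have "a * cos \<theta> = (t - s) * (a * cos \<phi>)"
        using arg_cong[OF dd, of "\<lambda>v. v \<bullet> e2"] by (simp add: d_def frame_simps)
      ultimately show ?thesis using False c by auto
    next
      case True
      then have "\<rho> \<noteq> 0" using nd by simp
      moreover have "\<rho> * cos \<theta> = \<rho> * cos \<phi>"
        using arg_cong[OF s, of "\<lambda>v. v \<bullet> e1"] True by (simp add: d_def frame_simps)
      ultimately show ?thesis by simp
    qed
    show "\<theta> = \<phi>" by (rule cos_inj_pi[OF _ _ _ _ ceq]) (use th pi_gt_zero in \<open>simp_all del: pi_gt_zero\<close>)
  qed
  moreover have "infinite {0<..<pi/2}" by (rule infinite_Ioo) simp
  ultimately have "infinite (ruling \<rho> a b ` {0<..<pi/2})" using finite_image_iff by blast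
  then show ?thesis by (rule infinite_super[rotated]) auto
qed

lemma infinite_common_tangents_rulings:
  assumes ab: "a\<^sup>2 + b\<^sup>2 = 1" and nd: "a \<noteq> 0 \<or> \<rho> \<noteq> 0"
    and S: "\<And>i. S i = sphere (m + s i *\<^sub>R e3) (r i)" and r: "\<And>i. r i > 0"
    and e: "\<And>i. \<rho>\<^sup>2 + (s i * a)\<^sup>2 = (r i)\<^sup>2"
  shows "infinite (common_tangent_lines S)"
proof -
  have "range (ruling \<rho> a b) \<subseteq> common_tangent_lines S"
    using tangent_ruling_iff[OF ab r] e by (auto simp: common_tangent_lines_def S)
  then show ?thesis using infinite_rulings[OF ab nd] infinite_super by blast
qed

end

text \<open>Plane vectors of equal length differ by a rotation; the cosine and sine are the real and
  imaginary parts of the quotient of the two vectors read as complex numbers.\<close>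

lemma rotation_angle:
  fixes x y u w :: real
  assumes "x\<^sup>2 + y\<^sup>2 = u\<^sup>2 + w\<^sup>2"
  obtains \<theta> where "x = u * cos \<theta> - w * sin \<theta>" "y = u * sin \<theta> + w * cos \<theta>"
proof (cases "u\<^sup>2 + w\<^sup>2 = 0")
  case True
  then show ?thesis using that[of 0] assms by (simp add: sum_power2_eq_zero_iff)
next
  case False
  define N where "N = u\<^sup>2 + w\<^sup>2"
  have N: "N \<noteq> 0" using False N_def by simp
  have "(u * x + w * y)\<^sup>2 + (u * y - w * x)\<^sup>2 = N\<^sup>2"
    using assms unfolding N_def by algebra
  then have "((u * x + w * y) / N)\<^sup>2 + ((u * y - w * x) / N)\<^sup>2 = 1"
    using N by (simp add: power_divide add_divide_distrib[symmetric])
  then obtain \<theta> where \<theta>: "(u * x + w * y) / N = cos \<theta>" "(u * y - w * x) / N = sin \<theta>"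
    using sincos_total_2pi by metis
  have c: "u * x + w * y = N * cos \<theta>" "u * y - w * x = N * sin \<theta>" using \<theta> N by (simp_all add: field_simps)
  have "N * x = N * (u * cos \<theta> - w * sin \<theta>)" "N * y = N * (u * sin \<theta> + w * cos \<theta>)"
    using c unfolding N_def by algebra+
  then show ?thesis using that N by simp
qed

section \<open>Quadrics of revolution touching spheres centered on the axis\<close>

context axis_frame
begin

text \<open>The surface swept by the rotates of a ruling with \<open>b \<noteq> 0\<close> and
  \<open>\<kappa> = a / b\<close>: a cone for \<open>\<rho> = 0\<close>, a cylinder for
  \<open>\<kappa> = 0\<close>, a one-sheeted hyperboloid if neither vanishes, the axis if both
  do.\<close>

definition rev_quadric :: "real \<Rightarrow> real \<Rightarrow> (real^3) set" where
  "rev_quadric \<rho> \<kappa> = {x. ((x - m) \<bullet> e1)\<^sup>2 + ((x - m) \<bullet> e2)\<^sup>2 = \<rho>\<^sup>2 + (\<kappa> * ((x - m) \<bullet> e3))\<^sup>2}"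

text \<open>The ruling through \<open>p\<close> lies in the quadric, so its direction
  \<open>d\<close> is tangent to the sphere and orthogonal to the radius. This gives
  \<open>s = (1 + \<kappa>\<^sup>2) * Z\<close> and covers the apex of a cone as well.\<close>

lemma tangent_at_rev_quadric_imp:
  assumes r: "r > 0" and t: "tangent_at (sphere (m + s *\<^sub>R e3) r) (rev_quadric \<rho> \<kappa>) p"
  shows "\<rho>\<^sup>2 + (s * \<kappa>)\<^sup>2 / (1 + \<kappa>\<^sup>2) = r\<^sup>2"
proof -
  define X Y Z where "X = (p - m) \<bullet> e1" and "Y = (p - m) \<bullet> e2" and "Z = (p - m) \<bullet> e3"
  have pS: "p \<in> sphere (m + s *\<^sub>R e3) r" and pQ: "p \<in> rev_quadric \<rho> \<kappa>"
    and tv: "tangent_vectors (sphere (m + s *\<^sub>R e3) r) p = tangent_vectors (rev_quadric \<rho> \<kappa>) p"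
    using t by (auto simp: tangent_at_def)
  have XY: "X\<^sup>2 + Y\<^sup>2 = \<rho>\<^sup>2 + (\<kappa> * Z)\<^sup>2" using pQ by (simp add: rev_quadric_def X_def Y_def Z_def)
  \<comment> \<open>The ruling at angle \<open>0\<close> has horizontal coordinates
    \<open>(\<rho>, \<kappa> * Z)\<close> at height \<open>Z\<close>; \<open>\<theta>\<close>
    rotates this point to \<open>p\<close>.\<close>
  then obtain \<theta> where \<theta>: "X = \<rho> * cos \<theta> - \<kappa> * Z * sin \<theta>" "Y = \<rho> * sin \<theta> + \<kappa> * Z * cos \<theta>"
    by (rule rotation_angle)
  define d where "d = \<kappa> *\<^sub>R tangential \<theta> + e3"
  have d: "d \<bullet> e1 = - \<kappa> * sin \<theta>" "d \<bullet> e2 = \<kappa> * cos \<theta>" "d \<bullet> e3 = 1"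
    by (simp_all add: d_def frame_simps)
  have "p + t *\<^sub>R d \<in> rev_quadric \<rho> \<kappa>" for t
  proof -
    have c: "(p + t *\<^sub>R d - m) \<bullet> e1 = X + t * (- \<kappa> * sin \<theta>)" "(p + t *\<^sub>R d - m) \<bullet> e2 = Y + t * (\<kappa> * cos \<theta>)"
      "(p + t *\<^sub>R d - m) \<bullet> e3 = Z + t"
      using d by (simp_all add: X_def Y_def Z_def inner_add_left inner_diff_left)
    show ?thesis unfolding rev_quadric_def mem_Collect_eq c \<theta>
      using sin_cos_squared_add[of \<theta>] by algebra
  qed
  moreover have "((\<lambda>t. p + t *\<^sub>R d) has_vector_derivative d) (at 0)"
    by (auto intro!: derivative_eq_intros)
  ultimately have "d \<in> tangent_vectors (rev_quadric \<rho> \<kappa>) p"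
    unfolding tangent_vectors_def by (auto intro!: exI[of _ "\<lambda>t. p + t *\<^sub>R d"])
  then have dp: "d \<bullet> (p - (m + s *\<^sub>R e3)) = 0"
    unfolding tv[symmetric] tangent_vectors_sphere[OF r pS] by simp
  have c: "(p - (m + s *\<^sub>R e3)) \<bullet> e1 = X" "(p - (m + s *\<^sub>R e3)) \<bullet> e2 = Y" "(p - (m + s *\<^sub>R e3)) \<bullet> e3 = Z - s"
    by (simp_all add: X_def Y_def Z_def frame_simps)
  have "- \<kappa> * sin \<theta> * X + \<kappa> * cos \<theta> * Y + (Z - s) = 0"
    using dp unfolding inner_expand[of d "p - (m + s *\<^sub>R e3)"] d c by simp
  then have s: "s = (1 + \<kappa>\<^sup>2) * Z" unfolding \<theta> using sin_cos_squared_add[of \<theta>] by algebra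
  have "(p - (m + s *\<^sub>R e3)) \<bullet> (p - (m + s *\<^sub>R e3)) = r\<^sup>2"
    using pS by (simp add: dot_square_norm dist_norm norm_minus_commute)
  then have "X\<^sup>2 + Y\<^sup>2 + (Z - s)\<^sup>2 = r\<^sup>2"
    unfolding inner_expand[of "p - (m + s *\<^sub>R e3)" "p - (m + s *\<^sub>R e3)"] c by (simp add: power2_eq_square)
  then have "\<rho>\<^sup>2 + (1 + \<kappa>\<^sup>2) * (\<kappa> * Z)\<^sup>2 = r\<^sup>2" unfolding XY s by algebra
  moreover have "1 + \<kappa>\<^sup>2 \<noteq> 0" by (smt (verit) zero_le_power2)
  then have "(s * \<kappa>)\<^sup>2 / (1 + \<kappa>\<^sup>2) = (1 + \<kappa>\<^sup>2) * (\<kappa> * Z)\<^sup>2"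
    unfolding s by (simp add: field_simps power2_eq_square)
  ultimately show ?thesis by simp
qed

lemma infinite_common_tangents_rev_quadric:
  assumes nd: "\<rho> \<noteq> 0 \<or> \<kappa> \<noteq> 0"
    and S: "\<And>i. S i = sphere (m + s i *\<^sub>R e3) (r i)" and r: "\<And>i. r i > 0"
    and t: "\<And>i. has_curve_of_tangency (S i) (rev_quadric \<rho> \<kappa>)"
  shows "infinite (common_tangent_lines S)"
proof -
  have k: "1 + \<kappa>\<^sup>2 > 0" by (smt (verit) zero_le_power2)
  \<comment> \<open>The ruling direction \<open>\<kappa> *\<^sub>R tangential \<theta> + e3\<close>,
    normalised.\<close>
  define a b where "a = \<kappa> / sqrt (1 + \<kappa>\<^sup>2)" and "b = 1 / sqrt (1 + \<kappa>\<^sup>2)"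
  have ab: "a\<^sup>2 = \<kappa>\<^sup>2 / (1 + \<kappa>\<^sup>2)" "b\<^sup>2 = 1 / (1 + \<kappa>\<^sup>2)" using k by (simp_all add: a_def b_def power_divide)
  then have ab1: "a\<^sup>2 + b\<^sup>2 = 1" using k by (simp add: add_divide_distrib[symmetric] add.commute)
  show ?thesis
  proof (rule infinite_common_tangents_rulings[OF ab1 _ S r])
    show "a \<noteq> 0 \<or> \<rho> \<noteq> 0" using nd k by (auto simp: a_def)
    fix i
    obtain g where "simple_path g" "path_image g = {p. tangent_at (S i) (rev_quadric \<rho> \<kappa>) p}"
      using t[of i] by (auto simp: has_curve_of_tangency_def)
    then obtain p where "tangent_at (S i) (rev_quadric \<rho> \<kappa>) p"
      using path_image_nonempty[of g] by auto
    then have "\<rho>\<^sup>2 + (s i * \<kappa>)\<^sup>2 / (1 + \<kappa>\<^sup>2) = (r i)\<^sup>2"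
      unfolding S by (rule tangent_at_rev_quadric_imp[OF r])
    then show "\<rho>\<^sup>2 + (s i * a)\<^sup>2 = (r i)\<^sup>2" by (simp add: power_mult_distrib ab)
  qed
qed

text \<open>\<open>off\<close> keeps \<open>p\<close> away from the axis, in particular from the
  apex of a cone. A given vector is realised in cylindrical coordinates: constant vertical speed
  \<open>v \<bullet> e3\<close>, constant angular speed \<open>\<omega>\<close>, and the radius
  \<open>h\<close> dictated by the quadric, differentiable because it is positive at
  \<open>0\<close>.\<close>

lemma tangent_vectors_rev_quadric:
  assumes p: "p \<in> rev_quadric \<rho> \<kappa>" and off: "\<rho>\<^sup>2 + (\<kappa> * ((p - m) \<bullet> e3))\<^sup>2 > 0"
  shows "tangent_vectors (rev_quadric \<rho> \<kappa>) p =
    {v. ((p - m) \<bullet> e1) * (v \<bullet> e1) + ((p - m) \<bullet> e2) * (v \<bullet> e2) = \<kappa>\<^sup>2 * ((p - m) \<bullet> e3) * (v \<bullet> e3)}"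
proof -
  define X Y Z where "X = (p - m) \<bullet> e1" and "Y = (p - m) \<bullet> e2" and "Z = (p - m) \<bullet> e3"
  note fold = X_def[symmetric] Y_def[symmetric] Z_def[symmetric]
  have XY: "X\<^sup>2 + Y\<^sup>2 = \<rho>\<^sup>2 + (\<kappa> * Z)\<^sup>2" using p by (simp add: rev_quadric_def fold)
  show ?thesis unfolding fold
  proof (intro equalityI subsetI)
    fix v assume "v \<in> tangent_vectors (rev_quadric \<rho> \<kappa>) p"
    then obtain g where g: "g 0 = p" "\<And>t. g t \<in> rev_quadric \<rho> \<kappa>" "(g has_vector_derivative v) (at (0::real))"
      by (auto simp: tangent_vectors_def)
    have g': "((\<lambda>t. g t - m) has_vector_derivative v) (at 0)"
      unfolding has_vector_derivative_diff_const by (rule g(3))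
    have D: "((\<lambda>t. (g t - m) \<bullet> e) has_real_derivative v \<bullet> e) (at 0)" for e
      unfolding has_real_derivative_iff_has_vector_derivative
      by (rule bounded_linear.has_vector_derivative[OF bounded_linear_inner_left g'])
    have "((\<lambda>t. ((g t - m) \<bullet> e1)\<^sup>2 + ((g t - m) \<bullet> e2)\<^sup>2 - (\<kappa> * ((g t - m) \<bullet> e3))\<^sup>2) has_real_derivative
      2 * X * (v \<bullet> e1) + 2 * Y * (v \<bullet> e2) - 2 * \<kappa> * Z * (\<kappa> * (v \<bullet> e3))) (at 0)"
      by (rule derivative_eq_intros D refl)+ (simp add: g(1) fold)
    moreover have "(\<lambda>t. ((g t - m) \<bullet> e1)\<^sup>2 + ((g t - m) \<bullet> e2)\<^sup>2 - (\<kappa> * ((g t - m) \<bullet> e3))\<^sup>2) = (\<lambda>t. \<rho>\<^sup>2)"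
      using g(2) by (auto simp: rev_quadric_def)
    ultimately have "((\<lambda>t::real. \<rho>\<^sup>2) has_real_derivative
      2 * X * (v \<bullet> e1) + 2 * Y * (v \<bullet> e2) - 2 * \<kappa> * Z * (\<kappa> * (v \<bullet> e3))) (at 0)" by simp
    then have "2 * X * (v \<bullet> e1) + 2 * Y * (v \<bullet> e2) - 2 * \<kappa> * Z * (\<kappa> * (v \<bullet> e3)) = 0"
      by (rule DERIV_unique) (rule DERIV_const)
    then have "X * (v \<bullet> e1) + Y * (v \<bullet> e2) = \<kappa>\<^sup>2 * Z * (v \<bullet> e3)" by algebra
    then show "v \<in> {v. X * (v \<bullet> e1) + Y * (v \<bullet> e2) = \<kappa>\<^sup>2 * Z * (v \<bullet> e3)}" by simp
  next
    fix v assume "v \<in> {v. X * (v \<bullet> e1) + Y * (v \<bullet> e2) = \<kappa>\<^sup>2 * Z * (v \<bullet> e3)}"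
    then have v: "X * (v \<bullet> e1) + Y * (v \<bullet> e2) = \<kappa>\<^sup>2 * Z * (v \<bullet> e3)" by simp
    define N where "N = sqrt (\<rho>\<^sup>2 + (\<kappa> * Z)\<^sup>2)"
    have N: "N > 0" "N\<^sup>2 = \<rho>\<^sup>2 + (\<kappa> * Z)\<^sup>2" using off by (simp_all add: N_def Z_def)
    have "X\<^sup>2 + Y\<^sup>2 = N\<^sup>2 + 0\<^sup>2" using XY N by simp
    then obtain \<theta> where \<theta>: "X = N * cos \<theta> - 0 * sin \<theta>" "Y = N * sin \<theta> + 0 * cos \<theta>"
      by (rule rotation_angle)
    define \<omega> where "\<omega> = (cos \<theta> * (v \<bullet> e2) - sin \<theta> * (v \<bullet> e1)) / N"
    have w: "N * \<omega> = cos \<theta> * (v \<bullet> e2) - sin \<theta> * (v \<bullet> e1)" using N by (simp add: \<omega>_def)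
    define h where "h t = sqrt (\<rho>\<^sup>2 + (\<kappa> * (Z + t * (v \<bullet> e3)))\<^sup>2)" for t
    have h0: "h 0 = N" by (simp add: h_def N_def)
    have h2: "(h t)\<^sup>2 = \<rho>\<^sup>2 + (\<kappa> * (Z + t * (v \<bullet> e3)))\<^sup>2" for t
      by (simp add: h_def)
    define g where "g t = m + (h t * cos (\<theta> + \<omega> * t)) *\<^sub>R e1 + (h t * sin (\<theta> + \<omega> * t)) *\<^sub>R e2 + (Z + t * (v \<bullet> e3)) *\<^sub>R e3" for t
    have gc: "(g t - m) \<bullet> e1 = h t * cos (\<theta> + \<omega> * t)" "(g t - m) \<bullet> e2 = h t * sin (\<theta> + \<omega> * t)"
      "(g t - m) \<bullet> e3 = Z + t * (v \<bullet> e3)" for t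
      by (simp_all add: g_def frame_simps)
    have "g t \<in> rev_quadric \<rho> \<kappa>" for t
    proof -
      have "(h t * cos (\<theta> + \<omega> * t))\<^sup>2 + (h t * sin (\<theta> + \<omega> * t))\<^sup>2 = (h t)\<^sup>2"
        using sin_cos_squared_add[of "\<theta> + \<omega> * t"] by algebra
      then show ?thesis by (simp add: rev_quadric_def gc h2)
    qed
    moreover have "g 0 = p"
    proof -
      have "g 0 - m = p - m"
        by (rule eqI) (use gc[of 0] h0 \<theta> in \<open>simp_all add: fold\<close>)
      then show ?thesis by simp
    qed
    moreover have "(g has_vector_derivative v) (at 0)"
    proof -
      have Dq: "((\<lambda>t. \<rho>\<^sup>2 + (\<kappa> * (Z + t * (v \<bullet> e3)))\<^sup>2) has_real_derivative 2 * (\<kappa> * Z) * (\<kappa> * (v \<bullet> e3))) (at 0)"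
        by (rule derivative_eq_intros refl)+ simp
      have Ds: "(sqrt has_real_derivative inverse N / 2) (at (\<rho>\<^sup>2 + (\<kappa> * (Z + 0 * (v \<bullet> e3)))\<^sup>2))"
        using DERIV_real_sqrt[of "\<rho>\<^sup>2 + (\<kappa> * Z)\<^sup>2"] off unfolding fold N_def[symmetric] by simp
      have Dh: "(h has_real_derivative \<kappa>\<^sup>2 * Z * (v \<bullet> e3) / N) (at 0)"
        unfolding h_def
        by (rule DERIV_cong[OF DERIV_chain2[OF Ds Dq]]) (use N(1) in \<open>simp add: field_simps power2_eq_square\<close>)
      have "\<kappa>\<^sup>2 * Z * (v \<bullet> e3) = N * (cos \<theta> * (v \<bullet> e1) + sin \<theta> * (v \<bullet> e2))"
        unfolding v[symmetric] \<theta> by (simp add: algebra_simps)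
      then have Dh': "(h has_real_derivative cos \<theta> * (v \<bullet> e1) + sin \<theta> * (v \<bullet> e2)) (at 0)"
        using Dh N by simp
      have D1: "((\<lambda>t. h t * cos (\<theta> + \<omega> * t)) has_real_derivative v \<bullet> e1) (at 0)"
      proof -
        have "((\<lambda>t. h t * cos (\<theta> + \<omega> * t)) has_real_derivative
          (cos \<theta> * (v \<bullet> e1) + sin \<theta> * (v \<bullet> e2)) * cos \<theta> - (N * \<omega>) * sin \<theta>) (at 0)"
          by (rule derivative_eq_intros Dh' refl)+ (simp add: h0)
        moreover have "(cos \<theta> * (v \<bullet> e1) + sin \<theta> * (v \<bullet> e2)) * cos \<theta> - (N * \<omega>) * sin \<theta> = v \<bullet> e1"
          unfolding w using sin_cos_squared_add[of \<theta>] by algebra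
        ultimately show ?thesis by simp
      qed
      have D2: "((\<lambda>t. h t * sin (\<theta> + \<omega> * t)) has_real_derivative v \<bullet> e2) (at 0)"
      proof -
        have "((\<lambda>t. h t * sin (\<theta> + \<omega> * t)) has_real_derivative
          (cos \<theta> * (v \<bullet> e1) + sin \<theta> * (v \<bullet> e2)) * sin \<theta> + (N * \<omega>) * cos \<theta>) (at 0)"
          by (rule derivative_eq_intros Dh' refl)+ (simp add: h0)
        moreover have "(cos \<theta> * (v \<bullet> e1) + sin \<theta> * (v \<bullet> e2)) * sin \<theta> + (N * \<omega>) * cos \<theta> = v \<bullet> e2"
          unfolding w using sin_cos_squared_add[of \<theta>] by algebra
        ultimately show ?thesis by simp
      qed
      have D3: "((\<lambda>t. Z + t * (v \<bullet> e3)) has_real_derivative v \<bullet> e3) (at 0)"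
        by (auto intro!: derivative_eq_intros)
      have sc: "((\<lambda>t. f t *\<^sub>R e) has_vector_derivative y *\<^sub>R e) (at 0)"
        if "(f has_real_derivative y) (at 0)" for f y and e :: "real^3"
        using that unfolding has_real_derivative_iff_has_vector_derivative
        by (rule bounded_linear.has_vector_derivative[OF bounded_linear_scaleR_left])
      have "(g has_vector_derivative 0 + (v \<bullet> e1) *\<^sub>R e1 + (v \<bullet> e2) *\<^sub>R e2 + (v \<bullet> e3) *\<^sub>R e3) (at 0)"
        unfolding g_def by (intro has_vector_derivative_add has_vector_derivative_const sc D1 D2 D3)
      then show ?thesis using expand[of v] by simp
    qed
    ultimately show "v \<in> tangent_vectors (rev_quadric \<rho> \<kappa>) p"
      unfolding tangent_vectors_def by blast
  qed
qed

lemma simple_path_latitude: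
  assumes "R > 0"
  obtains g where "simple_path g" "path_image g = {x. (x - m) \<bullet> e3 = z \<and> ((x - m) \<bullet> e1)\<^sup>2 + ((x - m) \<bullet> e2)\<^sup>2 = R\<^sup>2}"
proof -
  define f where "f w = Re w *\<^sub>R e1 + Im w *\<^sub>R e2" for w
  have lf: "linear f" by (rule linearI) (simp_all add: f_def algebra_simps)
  have fc: "f w \<bullet> e1 = Re w" "f w \<bullet> e2 = Im w" "f w \<bullet> e3 = 0" for w by (simp_all add: f_def frame_simps)
  have "inj f" by (rule injI) (metis fc complex_eqI)
  define g where "g = (\<lambda>x. (m + z *\<^sub>R e3) + x) \<circ> (f \<circ> circlepath 0 R)"
  have "simple_path g"
    unfolding g_def simple_path_translation_eq simple_path_linear_image_eq[OF lf \<open>inj f\<close>]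
    using assms by (simp add: simple_path_circlepath)
  moreover have "path_image g = {x. (x - m) \<bullet> e3 = z \<and> ((x - m) \<bullet> e1)\<^sup>2 + ((x - m) \<bullet> e2)\<^sup>2 = R\<^sup>2}"
  proof -
    have "path_image g = (\<lambda>w. (m + z *\<^sub>R e3) + f w) ` sphere 0 R"
      using assms by (simp add: g_def path_image_compose image_image)
    also have "\<dots> = {x. (x - m) \<bullet> e3 = z \<and> ((x - m) \<bullet> e1)\<^sup>2 + ((x - m) \<bullet> e2)\<^sup>2 = R\<^sup>2}"
    proof (intro equalityI subsetI)
      fix x assume "x \<in> (\<lambda>w. (m + z *\<^sub>R e3) + f w) ` sphere 0 R"
      then obtain w where w: "cmod w = R" "x = m + z *\<^sub>R e3 + f w" by auto
      have "(Re w)\<^sup>2 + (Im w)\<^sup>2 = R\<^sup>2" using w(1) cmod_power2 by metis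
      then show "x \<in> {x. (x - m) \<bullet> e3 = z \<and> ((x - m) \<bullet> e1)\<^sup>2 + ((x - m) \<bullet> e2)\<^sup>2 = R\<^sup>2}"
        by (simp add: w(2) frame_simps fc)
    next
      fix x assume x: "x \<in> {x. (x - m) \<bullet> e3 = z \<and> ((x - m) \<bullet> e1)\<^sup>2 + ((x - m) \<bullet> e2)\<^sup>2 = R\<^sup>2}"
      define w where "w = Complex ((x - m) \<bullet> e1) ((x - m) \<bullet> e2)"
      have "cmod w = R" using x assms by (simp add: w_def cmod_def)
      moreover have "x - m = z *\<^sub>R e3 + f w"
        by (rule eqI) (use x in \<open>simp_all add: inner_add_left fc w_def unit orth orth'\<close>)
      then have "x = (m + z *\<^sub>R e3) + f w" by (simp add: algebra_simps)
      ultimately show "x \<in> (\<lambda>w. (m + z *\<^sub>R e3) + f w) ` sphere 0 R" by auto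
    qed
    finally show ?thesis .
  qed
  ultimately show ?thesis by (rule that)
qed

text \<open>With \<open>s = (1 + \<kappa>\<^sup>2) * z\<close>, the two surface equations combine to
  \<open>(1 + \<kappa>\<^sup>2) * (Z - z)\<^sup>2 = 0\<close>. The surfaces meet only in the
  latitude circle at height \<open>z\<close>, and there the tangent planes agree.\<close>

lemma has_curve_of_tangency_rev_quadric:
  assumes r: "r > 0" and e: "\<rho>\<^sup>2 + (s * \<kappa>)\<^sup>2 / (1 + \<kappa>\<^sup>2) = r\<^sup>2"
  shows "has_curve_of_tangency (sphere (m + s *\<^sub>R e3) r) (rev_quadric \<rho> \<kappa>)"
proof -
  have k: "1 + \<kappa>\<^sup>2 > 0" by (smt (verit) zero_le_power2)
  define z where "z = s / (1 + \<kappa>\<^sup>2)"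
  have s: "s = (1 + \<kappa>\<^sup>2) * z" using k by (simp add: z_def)
  have "(s * \<kappa>)\<^sup>2 / (1 + \<kappa>\<^sup>2) = (1 + \<kappa>\<^sup>2) * (\<kappa> * z)\<^sup>2"
    unfolding s using k by (simp add: field_simps power2_eq_square)
  then have e: "\<rho>\<^sup>2 + (1 + \<kappa>\<^sup>2) * (\<kappa> * z)\<^sup>2 = r\<^sup>2" using e by simp
  define N where "N = sqrt (\<rho>\<^sup>2 + (\<kappa> * z)\<^sup>2)"
  \<comment> \<open>A circle of radius zero would force \<open>r = 0\<close>. The circle of tangency
    therefore never shrinks to the apex of a cone.\<close>
  have pos: "\<rho>\<^sup>2 + (\<kappa> * z)\<^sup>2 > 0"
  proof (rule ccontr)
    assume "\<not> ?thesis"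
    then have "\<rho>\<^sup>2 = 0 \<and> (\<kappa> * z)\<^sup>2 = 0" using zero_le_power2[of \<rho>] zero_le_power2[of "\<kappa> * z"] by linarith
    then have 0: "\<rho>\<^sup>2 = 0" "(\<kappa> * z)\<^sup>2 = 0" by blast+
    then show False using e r unfolding 0 by simp
  qed
  have N: "N > 0" "N\<^sup>2 = \<rho>\<^sup>2 + (\<kappa> * z)\<^sup>2" using pos by (simp_all add: N_def)
  obtain g where g: "simple_path g" "path_image g = {x. (x - m) \<bullet> e3 = z \<and> ((x - m) \<bullet> e1)\<^sup>2 + ((x - m) \<bullet> e2)\<^sup>2 = N\<^sup>2}"
    using simple_path_latitude[OF N(1)] by blast
  have "{x. (x - m) \<bullet> e3 = z \<and> ((x - m) \<bullet> e1)\<^sup>2 + ((x - m) \<bullet> e2)\<^sup>2 = N\<^sup>2}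
    = {p. tangent_at (sphere (m + s *\<^sub>R e3) r) (rev_quadric \<rho> \<kappa>) p}"
  proof (intro Collect_cong)
    fix p
    define X Y Z where "X = (p - m) \<bullet> e1" and "Y = (p - m) \<bullet> e2" and "Z = (p - m) \<bullet> e3"
    note fold = X_def[symmetric] Y_def[symmetric] Z_def[symmetric]
    have c: "(p - (m + s *\<^sub>R e3)) \<bullet> e1 = X" "(p - (m + s *\<^sub>R e3)) \<bullet> e2 = Y" "(p - (m + s *\<^sub>R e3)) \<bullet> e3 = Z - s"
      by (simp_all add: X_def Y_def Z_def frame_simps)
    have "p \<in> sphere (m + s *\<^sub>R e3) r \<longleftrightarrow> (p - (m + s *\<^sub>R e3)) \<bullet> (p - (m + s *\<^sub>R e3)) = r\<^sup>2"
      using r by (simp add: dot_square_norm dist_norm norm_minus_commute)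
    then have pS: "p \<in> sphere (m + s *\<^sub>R e3) r \<longleftrightarrow> X\<^sup>2 + Y\<^sup>2 + (Z - s)\<^sup>2 = r\<^sup>2"
      unfolding inner_expand[of "p - (m + s *\<^sub>R e3)" "p - (m + s *\<^sub>R e3)"] c by (simp add: power2_eq_square)
    have pQ: "p \<in> rev_quadric \<rho> \<kappa> \<longleftrightarrow> X\<^sup>2 + Y\<^sup>2 = \<rho>\<^sup>2 + (\<kappa> * Z)\<^sup>2"
      by (simp add: rev_quadric_def fold)
    have "(Z = z \<and> X\<^sup>2 + Y\<^sup>2 = N\<^sup>2) \<longleftrightarrow> tangent_at (sphere (m + s *\<^sub>R e3) r) (rev_quadric \<rho> \<kappa>) p"
    proof
      assume L: "Z = z \<and> X\<^sup>2 + Y\<^sup>2 = N\<^sup>2"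
      have 1: "p \<in> rev_quadric \<rho> \<kappa>" unfolding pQ using L N by simp
      have zs: "Z - s = - \<kappa>\<^sup>2 * z" using L s by (simp add: distrib_right)
      have "\<rho>\<^sup>2 + (\<kappa> * z)\<^sup>2 + (- \<kappa>\<^sup>2 * z)\<^sup>2 = r\<^sup>2" unfolding e[symmetric] by algebra
      then have 2: "p \<in> sphere (m + s *\<^sub>R e3) r" unfolding pS zs conjunct2[OF L] N(2) .
      have off: "\<rho>\<^sup>2 + (\<kappa> * ((p - m) \<bullet> e3))\<^sup>2 > 0" unfolding fold using L pos by simp
      have "v \<bullet> (p - (m + s *\<^sub>R e3)) = X * (v \<bullet> e1) + Y * (v \<bullet> e2) - \<kappa>\<^sup>2 * Z * (v \<bullet> e3)" for v
        unfolding inner_expand[of v "p - (m + s *\<^sub>R e3)"] c zs using L by (simp add: mult.commute)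
      then have "tangent_vectors (sphere (m + s *\<^sub>R e3) r) p = tangent_vectors (rev_quadric \<rho> \<kappa>) p"
        unfolding tangent_vectors_sphere[OF r 2] tangent_vectors_rev_quadric[OF 1 off] fold by auto
      then show "tangent_at (sphere (m + s *\<^sub>R e3) r) (rev_quadric \<rho> \<kappa>) p"
        using 1 2 by (simp add: tangent_at_def)
    next
      assume "tangent_at (sphere (m + s *\<^sub>R e3) r) (rev_quadric \<rho> \<kappa>) p"
      then have h: "X\<^sup>2 + Y\<^sup>2 + (Z - s)\<^sup>2 = r\<^sup>2" "X\<^sup>2 + Y\<^sup>2 = \<rho>\<^sup>2 + (\<kappa> * Z)\<^sup>2"
        unfolding pS[symmetric] pQ[symmetric] by (simp_all add: tangent_at_def)
      have "(1 + \<kappa>\<^sup>2) * (Z - z)\<^sup>2 = 0" using h e s by algebra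
      then have "Z = z" using k by simp
      then show "Z = z \<and> X\<^sup>2 + Y\<^sup>2 = N\<^sup>2" using h N by simp
    qed
    then show "((p - m) \<bullet> e3 = z \<and> ((p - m) \<bullet> e1)\<^sup>2 + ((p - m) \<bullet> e2)\<^sup>2 = N\<^sup>2) =
        tangent_at (sphere (m + s *\<^sub>R e3) r) (rev_quadric \<rho> \<kappa>) p"
      unfolding fold .
  qed
  then show ?thesis unfolding has_curve_of_tangency_def using g by auto
qed

end

context axis_frame
begin

text \<open>The quadratic part is \<open>x \<bullet> x - (1 + \<kappa>\<^sup>2) * (x \<bullet>
  e3)\<^sup>2\<close>, so its matrix is the identity minus a multiple of the projection onto
  \<open>e3\<close>.\<close>

lemma quadric_rev_quadric: "quadric (rev_quadric \<rho> \<kappa>)"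
proof -
  define k where "k = 1 + \<kappa>\<^sup>2"
  define f where "f x = x - (k * (x \<bullet> e3)) *\<^sub>R e3" for x
  define A :: "real^3^3" where "A = matrix f"
  have lf: "linear f" by (rule linearI) (simp_all add: f_def inner_add_left algebra_simps)
  have Af: "A *v x = f x" for x unfolding A_def by (rule matrix_works) (simp add: linear_matrix_vector_mul_eq lf)
  have "f (axis j 1) $ i = (if i = j then 1 else 0) - k * (e3 $ j * e3 $ i)" for i j
    by (simp add: f_def inner_axis' mult.assoc) (simp add: axis_def)
  then have "transpose A = A"
    unfolding A_def matrix_def transpose_def by (simp add: vec_eq_iff mult.commute)
  moreover have "A \<noteq> 0"
  proof
    assume "A = 0"
    then have "f e1 = 0" using Af[of e1] by simp
    then have "e1 \<bullet> e1 = 0" by (simp add: f_def orth)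
    then show False using unit by simp
  qed
  moreover have "rev_quadric \<rho> \<kappa> = {x. x \<bullet> (A *v x) + (- 2 *\<^sub>R f m) \<bullet> x + (m \<bullet> f m - \<rho>\<^sup>2) = 0}"
  proof -
    have "((x - m) \<bullet> e1)\<^sup>2 + ((x - m) \<bullet> e2)\<^sup>2 = \<rho>\<^sup>2 + (\<kappa> * ((x - m) \<bullet> e3))\<^sup>2
      \<longleftrightarrow> x \<bullet> f x + (- 2 *\<^sub>R f m) \<bullet> x + (m \<bullet> f m - \<rho>\<^sup>2) = 0" for x
    proof -
      have "(x - m) \<bullet> (x - m) = ((x - m) \<bullet> e1)\<^sup>2 + ((x - m) \<bullet> e2)\<^sup>2 + ((x - m) \<bullet> e3)\<^sup>2"
        unfolding inner_expand[of "x - m" "x - m"] by (simp add: power2_eq_square)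
      moreover have "x \<bullet> f x + (- 2 *\<^sub>R f m) \<bullet> x + m \<bullet> f m = (x - m) \<bullet> (x - m) - k * ((x - m) \<bullet> e3)\<^sup>2"
        unfolding f_def
        by (simp add: inner_diff_left inner_diff_right inner_commute[of e3] inner_commute[of m x] power2_eq_square algebra_simps)
      ultimately have "x \<bullet> f x + (- 2 *\<^sub>R f m) \<bullet> x + m \<bullet> f m
        = ((x - m) \<bullet> e1)\<^sup>2 + ((x - m) \<bullet> e2)\<^sup>2 - (\<kappa> * ((x - m) \<bullet> e3))\<^sup>2"
        unfolding k_def by algebra
      then show ?thesis by auto
    qed
    then show ?thesis unfolding rev_quadric_def Af by simp
  qed
  ultimately show ?thesis unfolding quadric_def by blast
qed

text \<open>Membership depends only on the distance to \<open>m\<close> and the height along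
  \<open>e3\<close>; both are preserved, since the map fixes \<open>m\<close> and its orthogonal
  linear part fixes \<open>e3\<close>.\<close>

lemma surface_of_revolution_rev_quadric:
  "surface_of_revolution {m + s *\<^sub>R e3 | s. True} (rev_quadric \<rho> \<kappa>)"
  unfolding surface_of_revolution_def
proof (intro allI impI)
  fix M :: "real^3^3" and t
  assume "rotation_matrix M \<and> (\<forall>x\<in>{m + s *\<^sub>R e3 | s. True}. M *v x + t = x)"
  then have orthM: "orthogonal_matrix M" and fixL: "\<And>s. M *v (m + s *\<^sub>R e3) + t = m + s *\<^sub>R e3"
    by (auto simp: rotation_matrix_def)
  have m: "M *v m + t = m" using fixL[of 0] by simp
  have e3: "M *v e3 = e3"
  proof -
    have "M *v e3 + (M *v m + t) = e3 + m"
      using fixL[of 1] by (simp add: matrix_vector_right_distrib add_ac)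
    then show ?thesis unfolding m by simp
  qed
  have ip: "(M *v x) \<bullet> (M *v y) = x \<bullet> y" for x y
  proof -
    have "(M *v x) \<bullet> (M *v y) = (transpose M *v (M *v x)) \<bullet> y"
      by (simp only: transpose_matrix_vector dot_lmul_matrix)
    also have "\<dots> = x \<bullet> y"
      using orthM by (simp add: matrix_vector_mul_assoc orthogonal_matrix)
    finally show ?thesis .
  qed
  have inv: "(x - m) \<bullet> (x - m) = \<rho>\<^sup>2 + k * ((x - m) \<bullet> e3)\<^sup>2 \<longleftrightarrow>
    (M *v x + t - m) \<bullet> (M *v x + t - m) = \<rho>\<^sup>2 + k * ((M *v x + t - m) \<bullet> e3)\<^sup>2" for x k
  proof -
    have d: "M *v x + t - m = M *v (x - m)"
      using m by (simp add: matrix_vector_mult_diff_distrib algebra_simps)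
    have "(M *v (x - m)) \<bullet> e3 = (x - m) \<bullet> e3" using ip[of "x - m" e3] e3 by simp
    then show ?thesis unfolding d ip by simp
  qed
  have memQ: "x \<in> rev_quadric \<rho> \<kappa> \<longleftrightarrow> (x - m) \<bullet> (x - m) = \<rho>\<^sup>2 + (1 + \<kappa>\<^sup>2) * ((x - m) \<bullet> e3)\<^sup>2" for x
    unfolding inner_expand[of "x - m" "x - m"] rev_quadric_def
    by (auto simp: power2_eq_square algebra_simps)
  have iff: "M *v x + t \<in> rev_quadric \<rho> \<kappa> \<longleftrightarrow> x \<in> rev_quadric \<rho> \<kappa>" for x
    unfolding memQ using inv by blast
  show "(\<lambda>x. M *v x + t) ` rev_quadric \<rho> \<kappa> = rev_quadric \<rho> \<kappa>"
  proof (intro equalityI subsetI)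
    fix y assume y: "y \<in> rev_quadric \<rho> \<kappa>"
    have "M *v (transpose M *v (y - t)) + t = y"
      using orthM by (simp add: matrix_vector_mul_assoc orthogonal_matrix_def del: transpose_matrix_vector)
    then show "y \<in> (\<lambda>x. M *v x + t) ` rev_quadric \<rho> \<kappa>"
      using iff y by (metis image_eqI)
  qed (use iff in auto)
qed

lemma frame_along_axis: "frame_along {m + s *\<^sub>R e3 | s. True} m e1 e2 e3"
  using unit orth by (simp add: frame_along_def norm_eq_1)

lemma rev_quadric_eq:
  assumes "a > 0" "c > 0"
  shows "{x. ((x - m) \<bullet> e1)\<^sup>2 / a\<^sup>2 + ((x - m) \<bullet> e2)\<^sup>2 / a\<^sup>2 - ((x - m) \<bullet> e3)\<^sup>2 / c\<^sup>2 = 0} = rev_quadric 0 (a / c)"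
    and "{x. ((x - m) \<bullet> e1)\<^sup>2 / a\<^sup>2 + ((x - m) \<bullet> e2)\<^sup>2 / a\<^sup>2 - ((x - m) \<bullet> e3)\<^sup>2 / c\<^sup>2 = 1} = rev_quadric a (a / c)"
    and "{x. ((x - m) \<bullet> e1)\<^sup>2 / a\<^sup>2 + ((x - m) \<bullet> e2)\<^sup>2 / a\<^sup>2 = 1} = rev_quadric a 0"
proof -
  have "X / a\<^sup>2 + Y / a\<^sup>2 - Z\<^sup>2 / c\<^sup>2 = k \<longleftrightarrow> X + Y = k * a\<^sup>2 + (a / c * Z)\<^sup>2" for X Y Z k :: real
  proof -
    have "X / a\<^sup>2 + Y / a\<^sup>2 - Z\<^sup>2 / c\<^sup>2 = k \<longleftrightarrow> a\<^sup>2 * (X / a\<^sup>2 + Y / a\<^sup>2 - Z\<^sup>2 / c\<^sup>2) = a\<^sup>2 * k"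
      using assms by simp
    also have "a\<^sup>2 * (X / a\<^sup>2 + Y / a\<^sup>2 - Z\<^sup>2 / c\<^sup>2) = X + Y - (a / c * Z)\<^sup>2"
      using assms by (simp add: distrib_left right_diff_distrib power_mult_distrib power_divide)
    finally show ?thesis by (auto simp: mult.commute)
  qed
  note iff = this
  show "{x. ((x - m) \<bullet> e1)\<^sup>2 / a\<^sup>2 + ((x - m) \<bullet> e2)\<^sup>2 / a\<^sup>2 - ((x - m) \<bullet> e3)\<^sup>2 / c\<^sup>2 = 0} = rev_quadric 0 (a / c)"
    "{x. ((x - m) \<bullet> e1)\<^sup>2 / a\<^sup>2 + ((x - m) \<bullet> e2)\<^sup>2 / a\<^sup>2 - ((x - m) \<bullet> e3)\<^sup>2 / c\<^sup>2 = 1} = rev_quadric a (a / c)"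
    unfolding rev_quadric_def iff by simp_all
  show "{x. ((x - m) \<bullet> e1)\<^sup>2 / a\<^sup>2 + ((x - m) \<bullet> e2)\<^sup>2 / a\<^sup>2 = 1} = rev_quadric a 0"
    using iff[of _ _ 0 1] unfolding rev_quadric_def by simp
qed

lemma rev_quadric_abs: "rev_quadric \<bar>\<rho>\<bar> \<bar>\<kappa>\<bar> = rev_quadric \<rho> \<kappa>"
  by (simp add: rev_quadric_def power_mult_distrib)

lemma rev_quadric_cases:
  assumes "\<rho> \<noteq> 0 \<or> \<kappa> \<noteq> 0"
  shows "cone_of_revolution {m + s *\<^sub>R e3 | s. True} (rev_quadric \<rho> \<kappa>) \<or>
    cylinder_of_revolution {m + s *\<^sub>R e3 | s. True} (rev_quadric \<rho> \<kappa>) \<or>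
    one_sheeted_hyperboloid_of_revolution {m + s *\<^sub>R e3 | s. True} (rev_quadric \<rho> \<kappa>)"
proof -
  consider "\<rho> = 0" "\<kappa> \<noteq> 0" | "\<rho> \<noteq> 0" "\<kappa> = 0" | "\<rho> \<noteq> 0" "\<kappa> \<noteq> 0" using assms by blast
  then show ?thesis
  proof cases
    case 1
    then have "rev_quadric \<rho> \<kappa> = {x. ((x - m) \<bullet> e1)\<^sup>2 / \<bar>\<kappa>\<bar>\<^sup>2 + ((x - m) \<bullet> e2)\<^sup>2 / \<bar>\<kappa>\<bar>\<^sup>2 - ((x - m) \<bullet> e3)\<^sup>2 / 1\<^sup>2 = 0}"
      using rev_quadric_eq(1)[of "\<bar>\<kappa>\<bar>" 1] rev_quadric_abs[of \<rho> \<kappa>] by simp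
    then have "cone_of_revolution {m + s *\<^sub>R e3 | s. True} (rev_quadric \<rho> \<kappa>)"
      unfolding cone_of_revolution_def using frame_along_axis 1
      by (intro exI[of _ m] exI[of _ e1] exI[of _ e2] exI[of _ e3] exI[of _ "\<bar>\<kappa>\<bar>"] exI[of _ "1::real"]) simp
    then show ?thesis by blast
  next
    case 2
    then have "rev_quadric \<rho> \<kappa> = {x. ((x - m) \<bullet> e1)\<^sup>2 / \<bar>\<rho>\<bar>\<^sup>2 + ((x - m) \<bullet> e2)\<^sup>2 / \<bar>\<rho>\<bar>\<^sup>2 = 1}"
      using rev_quadric_eq(3)[of "\<bar>\<rho>\<bar>" 1] rev_quadric_abs[of \<rho> \<kappa>] by simp
    then have "cylinder_of_revolution {m + s *\<^sub>R e3 | s. True} (rev_quadric \<rho> \<kappa>)"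
      unfolding cylinder_of_revolution_def using frame_along_axis 2
      by (intro exI[of _ m] exI[of _ e1] exI[of _ e2] exI[of _ e3] exI[of _ "\<bar>\<rho>\<bar>"]) simp
    then show ?thesis by blast
  next
    case 3
    then have "rev_quadric \<rho> \<kappa> = {x. ((x - m) \<bullet> e1)\<^sup>2 / \<bar>\<rho>\<bar>\<^sup>2 + ((x - m) \<bullet> e2)\<^sup>2 / \<bar>\<rho>\<bar>\<^sup>2 - ((x - m) \<bullet> e3)\<^sup>2 / (\<bar>\<rho>\<bar> / \<bar>\<kappa>\<bar>)\<^sup>2 = 1}"
      using rev_quadric_eq(2)[of "\<bar>\<rho>\<bar>" "\<bar>\<rho>\<bar> / \<bar>\<kappa>\<bar>"] rev_quadric_abs[of \<rho> \<kappa>] by simp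
    then have "one_sheeted_hyperboloid_of_revolution {m + s *\<^sub>R e3 | s. True} (rev_quadric \<rho> \<kappa>)"
      unfolding one_sheeted_hyperboloid_of_revolution_def using frame_along_axis 3
      by (intro exI[of _ m] exI[of _ e1] exI[of _ e2] exI[of _ e3] exI[of _ "\<bar>\<rho>\<bar>"] exI[of _ "\<bar>\<rho>\<bar> / \<bar>\<kappa>\<bar>"]) simp
    then show ?thesis by blast
  qed
qed

end

section \<open>Frames adapted to an axis and a line\<close>

lemma frame_alongD:
  assumes "frame_along L m e1 e2 e3"
  shows "axis_frame e1 e2 e3" "L = {m + s *\<^sub>R e3 | s. True}"
  using assms by (auto simp: frame_along_def axis_frame_def norm_eq_1)

lemma obtain_frame:
  fixes e :: "real^3"
  assumes e: "e \<bullet> e = 1"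
  obtains e1 e2 where "axis_frame e1 e2 e"
proof -
  have "\<exists>a. cross3 e a \<noteq> 0"
  proof (rule ccontr)
    assume "\<not> ?thesis"
    then have "cross3 e (axis i 1) = 0" for i by blast
    from this[of 1] this[of 2] have "e = 0"
      by (simp add: cross3_def vec_eq_iff forall_3 axis_def)
    then show False using e by simp
  qed
  then obtain a where "cross3 e a \<noteq> 0" by blast
  then obtain f0 f \<beta> \<gamma> where f: "f0 \<bullet> f0 = 1" "f \<bullet> f = 1" "f0 \<bullet> f = 0" "e = norm e *\<^sub>R f0"
    by (rule orthonormal_pair)
  have ef: "e \<bullet> f = 0" using f(3,4) by (metis inner_scaleR_left mult_zero_right)
  note on = orthonormal_cross(1-3)[OF e f(2) ef]
  have "axis_frame f (cross3 e f) e"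
    using on e f(2) ef by unfold_locales (simp_all add: inner_commute)
  then show ?thesis by (rule that)
qed

lemma obtain_frame_containing:
  fixes e v :: "real^3"
  assumes e: "e \<bullet> e = 1" and v: "v \<bullet> e = 0"
  obtains f e1 where "axis_frame f e1 e" "v = norm v *\<^sub>R f"
proof (cases "v = 0")
  case True
  obtain e1 e2 where "axis_frame e1 e2 e" using obtain_frame[OF e] .
  then show ?thesis using that True by auto
next
  case False
  define f where "f = v /\<^sub>R norm v"
  have f: "f \<bullet> f = 1" "v = norm v *\<^sub>R f" "e \<bullet> f = 0"
    using False v by (simp_all add: f_def dot_square_norm power2_eq_square inner_commute)
  note on = orthonormal_cross(1-3)[OF e f(1,3)]
  have "axis_frame f (cross3 e f) e"
    using on e f(1,3) by unfold_locales (simp_all add: inner_commute)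
  then show ?thesis using f(2) by (rule that)
qed

text \<open>The origin \<open>m\<close> is the foot on the axis of the common perpendicular of axis and line.\<close>

lemma line_as_ruling:
  fixes c0 e3 p v :: "real^3"
  assumes e3: "e3 \<bullet> e3 = 1" and v: "v \<bullet> v = 1"
  obtains m e1 e2 h \<rho> a b where "axis_frame e1 e2 e3" "m = c0 + h *\<^sub>R e3" "a\<^sup>2 + b\<^sup>2 = 1"
    "range (\<lambda>t. p + t *\<^sub>R v) = axis_frame.ruling m e1 e2 e3 \<rho> a b 0"
proof -
  define b where "b = v \<bullet> e3"
  define w where "w = v - b *\<^sub>R e3"
  have we: "w \<bullet> e3 = 0" using e3 by (simp add: w_def b_def inner_diff_left)
  have vw: "v = w + b *\<^sub>R e3" by (simp add: w_def)
  have "v \<bullet> v = (w + b *\<^sub>R e3) \<bullet> (w + b *\<^sub>R e3)" by (simp only: vw[symmetric])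
  then have nb: "w \<bullet> w + b\<^sup>2 = 1"
    using v we e3 by (simp add: inner_add_left inner_add_right inner_commute power2_eq_square)
  have rul: "axis_frame.ruling m e1 e2 e3 \<rho> a b 0 = range (\<lambda>t. (m + \<rho> *\<^sub>R e1) + t *\<^sub>R (a *\<^sub>R e2 + b *\<^sub>R e3))"
    if "axis_frame e1 e2 e3" for m e1 e2 \<rho> a b
    unfolding axis_frame.ruling_def[OF that] axis_frame.radial_def[OF that] axis_frame.tangential_def[OF that] by simp
  show ?thesis
  proof (cases "w = 0")
    case False
    obtain e2 e1' where fr: "axis_frame e2 e1' e3" and w: "w = norm w *\<^sub>R e2"
      using obtain_frame_containing[OF e3 we] .
    interpret F: axis_frame m e2 e1' e3 for m by (rule fr)
    have fr': "axis_frame e1' e2 e3"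
      using F.unit F.orth F.orth' by unfold_locales simp_all
    define q where "q = p - c0"
    \<comment> \<open>At this parameter the coordinate along \<open>e2\<close>, the horizontal
      direction of the line, vanishes: the foot of the common perpendicular on the line.\<close>
    define t0 where "t0 = - (q \<bullet> e2) / norm w"
    have nw: "norm w \<noteq> 0" using False by simp
    have q: "q = (q \<bullet> e1') *\<^sub>R e1' + (q \<bullet> e2) *\<^sub>R e2 + (q \<bullet> e3) *\<^sub>R e3"
      using F.expand[of q] by (simp add: add_ac)
    have t0e: "t0 *\<^sub>R v = - (q \<bullet> e2) *\<^sub>R e2 + (t0 * b) *\<^sub>R e3"
    proof -
      have "t0 *\<^sub>R v = t0 *\<^sub>R (norm w *\<^sub>R e2 + b *\<^sub>R e3)" using vw w by simp
      then show ?thesis using nw by (simp add: t0_def scaleR_add_right)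
    qed
    have "p + t0 *\<^sub>R v = c0 + q + t0 *\<^sub>R v" by (simp add: q_def)
    also have "\<dots> = (c0 + (q \<bullet> e3 + t0 * b) *\<^sub>R e3) + (q \<bullet> e1') *\<^sub>R e1'"
      unfolding t0e by (subst q) (simp add: scaleR_add_left)
    finally have p0: "p + t0 *\<^sub>R v = (c0 + (q \<bullet> e3 + t0 * b) *\<^sub>R e3) + (q \<bullet> e1') *\<^sub>R e1'" .
    have v': "v = norm w *\<^sub>R e2 + b *\<^sub>R e3" using vw w by simp
    have "range (\<lambda>t. p + t *\<^sub>R v) = range (\<lambda>t. (p + t0 *\<^sub>R v) + t *\<^sub>R v)"
      by (rule range_line_shift[symmetric])
    also have "\<dots> = axis_frame.ruling (c0 + (q \<bullet> e3 + t0 * b) *\<^sub>R e3) e1' e2 e3 (q \<bullet> e1') (norm w) b 0"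
      unfolding rul[OF fr'] p0 v'[symmetric] ..
    finally have R: "range (\<lambda>t. p + t *\<^sub>R v) = axis_frame.ruling (c0 + (q \<bullet> e3 + t0 * b) *\<^sub>R e3) e1' e2 e3 (q \<bullet> e1') (norm w) b 0" .
    show ?thesis by (rule that[OF fr' refl _ R]) (use nb in \<open>simp add: dot_square_norm\<close>)
  next
    case True
    define q where "q = p - c0"
    \<comment> \<open>The line is parallel to the axis, so every point of it is a foot of a common
      perpendicular; \<open>p\<close> is taken.\<close>
    define u where "u = q - (q \<bullet> e3) *\<^sub>R e3"
    have "u \<bullet> e3 = 0" using e3 by (simp add: u_def inner_diff_left)
    then obtain e1 e2 where fr: "axis_frame e1 e2 e3" and u: "u = norm u *\<^sub>R e1"
      using obtain_frame_containing[OF e3] by metis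
    have "p = (c0 + (q \<bullet> e3) *\<^sub>R e3) + u" by (simp add: u_def q_def)
    then have p: "p = (c0 + (q \<bullet> e3) *\<^sub>R e3) + norm u *\<^sub>R e1" using u by simp
    have v': "v = 0 *\<^sub>R e2 + b *\<^sub>R e3" using vw True by simp
    have R: "range (\<lambda>t. p + t *\<^sub>R v) = axis_frame.ruling (c0 + (q \<bullet> e3) *\<^sub>R e3) e1 e2 e3 (norm u) 0 b 0"
      unfolding rul[OF fr] p[symmetric] v'[symmetric] ..
    show ?thesis by (rule that[OF fr refl _ R]) (use nb True in simp)
  qed
qed

section \<open>From the geometric configurations to infinitely many tangents\<close>

lemma infinite_common_tangents_circle:
  fixes c :: "'i \<Rightarrow> real^3"
  assumes r: "\<And>i. r i > 0" and S: "\<And>i. S i = sphere (c i) (r i)" and circ: "is_circle (\<Inter>i. S i)"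
  shows "infinite (common_tangent_lines S)"
proof -
  obtain m n R where n: "n \<noteq> 0" and R: "R > 0" and C: "(\<Inter>i. S i) = {x. (x - m) \<bullet> n = 0} \<inter> sphere m R"
    using circ by (auto simp: is_circle_def)
  define e3 where "e3 = n /\<^sub>R norm n"
  have e3: "e3 \<bullet> e3 = 1" "n = norm n *\<^sub>R e3" using n by (simp_all add: e3_def dot_square_norm power2_eq_square)
  obtain e1 e2 where fr: "axis_frame e1 e2 e3" using obtain_frame[OF e3(1)] .
  interpret axis_frame m e1 e2 e3 by (rule fr)
  have on_circle: "m + R *\<^sub>R radial \<theta> \<in> S i" for \<theta> i
  proof -
    have "radial \<theta> \<bullet> radial \<theta> = 1"
      unfolding inner_expand[of "radial \<theta>" "radial \<theta>"] radial_simps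
      using sin_cos_squared_add[of \<theta>] by (simp add: power2_eq_square add.commute)
    then have "norm (radial \<theta>) = 1" by (simp add: norm_eq_1)
    moreover have "radial \<theta> \<bullet> n = 0" by (subst e3(2)) simp
    ultimately have "m + R *\<^sub>R radial \<theta> \<in> (\<Inter>i. S i)"
      unfolding C using R by (simp add: dist_norm)
    then show ?thesis by blast
  qed
  define s where "s i = (c i - m) \<bullet> e3" for i
  have eq: "R\<^sup>2 - 2 * R * ((c i - m) \<bullet> radial \<theta>) + (c i - m) \<bullet> (c i - m) = (r i)\<^sup>2" for i \<theta>
  proof -
    define d where "d = c i - m"
    have "norm (R *\<^sub>R radial \<theta> - d) = r i"
      using on_circle[of \<theta> i] unfolding S d_def by (simp add: dist_norm norm_minus_commute algebra_simps)
    then have "(R *\<^sub>R radial \<theta> - d) \<bullet> (R *\<^sub>R radial \<theta> - d) = (r i)\<^sup>2" by (simp add: dot_square_norm)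
    moreover have "radial \<theta> \<bullet> radial \<theta> = 1"
      unfolding inner_expand[of "radial \<theta>" "radial \<theta>"] radial_simps
      using sin_cos_squared_add[of \<theta>] by (simp add: power2_eq_square add.commute)
    ultimately show ?thesis unfolding d_def[symmetric]
      by (simp add: inner_diff_left inner_diff_right inner_commute[of d "radial \<theta>"] power2_eq_square algebra_simps)
  qed
  \<comment> \<open>Comparing opposite points of the circle isolates the linear term of
    \<open>eq\<close>: every center lies on the axis of the circle.\<close>
  have rad: "radial 0 = e1" "radial pi = - e1" "radial (pi/2) = e2" "radial (-(pi/2)) = - e2"
    by (simp_all add: radial_def)
  have perp: "(c i - m) \<bullet> e1 = 0" "(c i - m) \<bullet> e2 = 0" for i
  proof -
    note e = eq[of i 0] eq[of i pi] eq[of i "pi/2"] eq[of i "-(pi/2)"]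
    have "R * ((c i - m) \<bullet> e1) = 0" "R * ((c i - m) \<bullet> e2) = 0"
      using e unfolding rad inner_minus_right by linarith+
    then show "(c i - m) \<bullet> e1 = 0" "(c i - m) \<bullet> e2 = 0" using R by simp_all
  qed
  have ci: "c i - m = s i *\<^sub>R e3" for i
    using expand[of "c i - m"] by (simp add: perp s_def)
  show ?thesis
  \<comment> \<open>With \<open>a = 1\<close> and \<open>b = 0\<close> the rulings are the tangents
    of the circle within its plane.\<close>
  proof (rule infinite_common_tangents_rulings[of 1 0 R S s r])
    show "S i = sphere (m + s i *\<^sub>R e3) (r i)" for i
      unfolding S ci[symmetric] by simp
    show "R\<^sup>2 + (s i * 1)\<^sup>2 = (r i)\<^sup>2" for i
      using eq[of i 0] unfolding rad perp ci by (simp add: unit orth' power2_eq_square)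
  qed (use r in auto)
qed

text \<open>Equal tangent planes put all centers on the common normal at \<open>p\<close>. The lines
  through \<open>p\<close> in the tangent plane are the rulings with \<open>a = 1\<close>,
  \<open>b = 0\<close> and \<open>\<rho> = 0\<close>.\<close>

lemma infinite_common_tangents_point:
  fixes c :: "'i \<Rightarrow> real^3"
  assumes r: "\<And>i. r i > 0" and S: "\<And>i. S i = sphere (c i) (r i)"
    and t: "\<And>i j. tangent_at (S i) (S j) p"
  shows "infinite (common_tangent_lines S)"
proof -
  have p: "p \<in> sphere (c i) (r i)" for i using t[of i i] S by (simp add: tangent_at_def)
  have pc: "(p - c i) \<bullet> (p - c i) = (r i)\<^sup>2" for i
    using p[of i] by (simp add: dot_square_norm dist_norm norm_minus_commute)
  have tv: "v \<bullet> (p - c i) = 0 \<longleftrightarrow> v \<bullet> (p - c j) = 0" for i j v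
    using t[of i j] tangent_vectors_sphere[OF r[of i] p[of i]] tangent_vectors_sphere[OF r[of j] p[of j]]
    unfolding tangent_at_def S by blast
  \<comment> \<open>An arbitrary index, used to fix the direction of the common normal.\<close>
  define j where "j = (undefined :: 'i)"
  define e3 where "e3 = (p - c j) /\<^sub>R r j"
  have e3: "e3 \<bullet> e3 = 1" "p - c j = r j *\<^sub>R e3"
    using r[of j] pc[of j] by (simp_all add: e3_def power2_eq_square flip: mult.assoc)
  obtain e1 e2 where fr: "axis_frame e1 e2 e3" using obtain_frame[OF e3(1)] .
  interpret axis_frame p e1 e2 e3 by (rule fr)
  define s where "s i = (c i - p) \<bullet> e3" for i
  have "e1 \<bullet> (p - c j) = 0" "e2 \<bullet> (p - c j) = 0" unfolding e3(2) by (simp_all add: orth)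
  then have "e1 \<bullet> (p - c i) = 0" "e2 \<bullet> (p - c i) = 0" for i using tv by blast+
  then have perp: "(c i - p) \<bullet> e1 = 0" "(c i - p) \<bullet> e2 = 0" for i
    by (simp_all add: inner_diff_left inner_diff_right inner_commute)
  have ci: "c i - p = s i *\<^sub>R e3" for i
    using expand[of "c i - p"] by (simp add: perp s_def)
  show ?thesis
  proof (rule infinite_common_tangents_rulings[of 1 0 0 S s r])
    show "S i = sphere (p + s i *\<^sub>R e3) (r i)" for i
      unfolding S ci[symmetric] by simp
    have "(c i - p) \<bullet> (c i - p) = (r i)\<^sup>2" for i
      using pc[of i] by (simp add: inner_diff_left inner_diff_right)
    then show "0\<^sup>2 + (s i * 1)\<^sup>2 = (r i)\<^sup>2" for i
      unfolding ci by (simp add: unit power2_eq_square)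
  qed (use r in auto)
qed

lemma infinite_common_tangents_quadric:
  fixes c :: "'i \<Rightarrow> real^3"
  assumes r: "\<And>i. r i > 0" and S: "\<And>i. S i = sphere (c i) (r i)"
    and cL: "range c \<subseteq> L" and t: "tangent_to_common_quadric_of_revolution L S"
  shows "infinite (common_tangent_lines S)"
proof -
  obtain Q where curve: "\<And>i. has_curve_of_tangency (S i) Q"
    and shape: "cone_of_revolution L Q \<or> cylinder_of_revolution L Q \<or> one_sheeted_hyperboloid_of_revolution L Q"
    using t by (auto simp: tangent_to_common_quadric_of_revolution_def)
  obtain m e1 e2 e3 \<rho> \<kappa> where fr: "frame_along L m e1 e2 e3" and nd: "\<rho> \<noteq> 0 \<or> \<kappa> \<noteq> 0"
    and Q: "Q = axis_frame.rev_quadric m e1 e2 e3 \<rho> \<kappa>"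
  proof -
    from shape consider "cone_of_revolution L Q" | "cylinder_of_revolution L Q" | "one_sheeted_hyperboloid_of_revolution L Q"
      by blast
    then show thesis
    proof cases
      case 1
      then obtain m e1 e2 e3 a c where h: "frame_along L m e1 e2 e3" "a > 0" "c > 0"
        "Q = {x. ((x - m) \<bullet> e1)\<^sup>2 / a\<^sup>2 + ((x - m) \<bullet> e2)\<^sup>2 / a\<^sup>2 - ((x - m) \<bullet> e3)\<^sup>2 / c\<^sup>2 = 0}"
        unfolding cone_of_revolution_def by blast
      interpret axis_frame m e1 e2 e3 by (rule frame_alongD(1)[OF h(1)])
      show thesis using that[OF h(1), of 0 "a / c"] h(2-4) rev_quadric_eq(1)[OF h(2,3)] by simp
    next
      case 2
      then obtain m e1 e2 e3 a where h: "frame_along L m e1 e2 e3" "a > 0"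
        "Q = {x. ((x - m) \<bullet> e1)\<^sup>2 / a\<^sup>2 + ((x - m) \<bullet> e2)\<^sup>2 / a\<^sup>2 = 1}"
        unfolding cylinder_of_revolution_def by blast
      interpret axis_frame m e1 e2 e3 by (rule frame_alongD(1)[OF h(1)])
      show thesis using that[OF h(1), of a 0] h(2-3) rev_quadric_eq(3)[OF h(2,2)] by simp
    next
      case 3
      then obtain m e1 e2 e3 a c where h: "frame_along L m e1 e2 e3" "a > 0" "c > 0"
        "Q = {x. ((x - m) \<bullet> e1)\<^sup>2 / a\<^sup>2 + ((x - m) \<bullet> e2)\<^sup>2 / a\<^sup>2 - ((x - m) \<bullet> e3)\<^sup>2 / c\<^sup>2 = 1}"
        unfolding one_sheeted_hyperboloid_of_revolution_def by blast
      interpret axis_frame m e1 e2 e3 by (rule frame_alongD(1)[OF h(1)])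
      show thesis using that[OF h(1), of a "a / c"] h(2-4) rev_quadric_eq(2)[OF h(2,3)] by simp
    qed
  qed
  interpret axis_frame m e1 e2 e3 by (rule frame_alongD(1)[OF fr])
  have "\<exists>s. c i = m + s *\<^sub>R e3" for i
    using cL unfolding frame_alongD(2)[OF fr] by blast
  then obtain s where s: "\<And>i. c i = m + s i *\<^sub>R e3" by metis
  show ?thesis
    by (rule infinite_common_tangents_rev_quadric[OF nd _ r]) (use S s curve Q in auto)
qed

text \<open>The inclination of the tangent to the axis decides. For \<open>b = 0\<close> it lies in
  the plane through \<open>m\<close> perpendicular to the axis, and all spheres meet in the circle
  of radius \<open>\<bar>\<rho>\<bar>\<close> about \<open>m\<close> in that plane, or in
  \<open>m\<close> alone. For \<open>b \<noteq> 0\<close> its rotates sweep out the quadric with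
  \<open>\<kappa> = a / b\<close>, which touches every sphere.\<close>

lemma collinear_common_tangent_configuration:
  fixes c :: "'i \<Rightarrow> real^3"
  assumes r: "\<And>i. r i > 0" and S: "\<And>i. S i = sphere (c i) (r i)" and c: "inj c"
    and ij: "(i0::'i) \<noteq> j0" and col: "collinear (range c)" and l: "l \<in> common_tangent_lines S"
  shows "meet_in_circle_or_tangency_point S \<or>
    (\<exists>L. is_line L \<and> range c \<subseteq> L \<and> tangent_to_common_quadric_of_revolution L S)"
proof -
  have tl: "tangent_line (S i) l" for i using l by (simp add: common_tangent_lines_def)
  have "is_line l" using tl[of i0] by (simp add: tangent_line_def)
  then obtain p v where v: "v \<bullet> v = 1" and lp: "l = range (\<lambda>t. p + t *\<^sub>R v)"
    unfolding is_line_iff_unit by (elim exE conjE)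
  have cij: "c i0 \<noteq> c j0" using c ij by (simp add: inj_eq)
  define c0 where "c0 = c i0"
  define e3 where "e3 = (c j0 - c i0) /\<^sub>R norm (c j0 - c i0)"
  have e3: "e3 \<bullet> e3 = 1" "c j0 - c i0 = norm (c j0 - c i0) *\<^sub>R e3"
    using cij by (simp_all add: e3_def dot_square_norm power2_eq_square)
  have on_axis: "\<exists>s. c i = c0 + s *\<^sub>R e3" for i
  proof -
    have "collinear {c i0, c j0, c i}" by (rule collinear_subset[OF col]) auto
    then have "c i \<in> affine hull {c i0, c j0}" using collinear_3_affine_hull[OF cij] by blast
    then obtain u where "c i = c i0 + u *\<^sub>R (c j0 - c i0)" unfolding affine_hull_2_alt by blast
    then have "c i = c0 + (u * norm (c j0 - c i0)) *\<^sub>R e3" using e3(2) unfolding c0_def by (metis scaleR_scaleR)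
    then show ?thesis by blast
  qed
  obtain m e1 e2 h \<rho> a b where fr: "axis_frame e1 e2 e3" and m: "m = c0 + h *\<^sub>R e3" and ab: "a\<^sup>2 + b\<^sup>2 = 1"
    and rul: "range (\<lambda>t. p + t *\<^sub>R v) = axis_frame.ruling m e1 e2 e3 \<rho> a b 0"
    by (rule line_as_ruling[OF e3(1) v])
  interpret axis_frame m e1 e2 e3 by (rule fr)
  have "\<exists>s. c i = m + s *\<^sub>R e3" for i
  proof -
    obtain s where "c i = c0 + s *\<^sub>R e3" using on_axis by blast
    then have "c i = m + (s - h) *\<^sub>R e3" by (simp add: m scaleR_left_diff_distrib)
    then show ?thesis by blast
  qed
  then obtain s where s: "\<And>i. c i = m + s i *\<^sub>R e3" by metis
  have Ss: "S i = sphere (m + s i *\<^sub>R e3) (r i)" for i using S s by simp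
  have e: "\<rho>\<^sup>2 + (s i * a)\<^sup>2 = (r i)\<^sup>2" for i
    using tl[of i] unfolding Ss lp rul tangent_ruling_iff[OF ab r] .
  have sij: "s i0 \<noteq> s j0" using cij s by auto
  have mem: "x \<in> S i \<longleftrightarrow> (x - m) \<bullet> (x - m) - 2 * s i * ((x - m) \<bullet> e3) + (s i)\<^sup>2 = (r i)\<^sup>2" for x i
  proof -
    define y where "y = x - m"
    have "x \<in> S i \<longleftrightarrow> (norm (y - s i *\<^sub>R e3))\<^sup>2 = (r i)\<^sup>2"
      using r[of i] unfolding Ss y_def by (simp add: dist_norm norm_minus_commute algebra_simps)
    also have "(norm (y - s i *\<^sub>R e3))\<^sup>2 = y \<bullet> y - 2 * s i * (y \<bullet> e3) + (s i)\<^sup>2"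
      unfolding power2_norm_eq_inner
      by (simp add: inner_diff_left inner_diff_right unit inner_commute[of e3 y] power2_eq_square algebra_simps)
    finally show ?thesis unfolding y_def .
  qed
  show ?thesis
  proof (cases "b = 0")
    case True
    then have a2: "a\<^sup>2 = 1" using ab by simp
    have e': "\<rho>\<^sup>2 + (s i)\<^sup>2 = (r i)\<^sup>2" for i using e[of i] a2 by (simp add: power_mult_distrib)
    have mem': "x \<in> S i \<longleftrightarrow> (x - m) \<bullet> (x - m) - 2 * s i * ((x - m) \<bullet> e3) = \<rho>\<^sup>2" for x i
      unfolding mem e'[symmetric] by auto
    have inter: "(\<Inter>i. S i) = {x. (x - m) \<bullet> e3 = 0 \<and> (x - m) \<bullet> (x - m) = \<rho>\<^sup>2}"
    proof (intro equalityI subsetI)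
      fix x assume "x \<in> (\<Inter>i. S i)"
      then have x: "(x - m) \<bullet> (x - m) - 2 * s i * ((x - m) \<bullet> e3) = \<rho>\<^sup>2" for i using mem' by blast
      \<comment> \<open>The radical plane of two spheres with different centers is the plane through
        \<open>m\<close> perpendicular to the axis.\<close>
      have "(s i0 - s j0) * ((x - m) \<bullet> e3) = 0" using x[of i0] x[of j0] by (simp add: algebra_simps)
      then have "(x - m) \<bullet> e3 = 0" using sij by simp
      then show "x \<in> {x. (x - m) \<bullet> e3 = 0 \<and> (x - m) \<bullet> (x - m) = \<rho>\<^sup>2}" using x[of i0] by simp
    next
      fix x assume "x \<in> {x. (x - m) \<bullet> e3 = 0 \<and> (x - m) \<bullet> (x - m) = \<rho>\<^sup>2}"
      then show "x \<in> (\<Inter>i. S i)" by (auto simp: mem')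
    qed
    have "meet_in_circle_or_tangency_point S"
    proof (cases "\<rho> = 0")
      case False
      have "(\<Inter>i. S i) = {x. (x - m) \<bullet> e3 = 0} \<inter> sphere m \<bar>\<rho>\<bar>"
      proof -
        have "y \<bullet> y = \<rho>\<^sup>2 \<longleftrightarrow> norm y = \<bar>\<rho>\<bar>" for y :: "real^3"
          using power2_eq_iff_nonneg[of "norm y" "\<bar>\<rho>\<bar>"] by (simp add: dot_square_norm)
        then have "x \<in> sphere m \<bar>\<rho>\<bar> \<longleftrightarrow> (x - m) \<bullet> (x - m) = \<rho>\<^sup>2" for x
          by (simp add: dist_norm norm_minus_commute[of m x])
        then show ?thesis unfolding inter by blast
      qed
      moreover have "e3 \<noteq> 0" using unit by auto
      ultimately have "is_circle (\<Inter>i. S i)"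
        unfolding is_circle_def using False by (intro exI[of _ m] exI[of _ e3] exI[of _ "\<bar>\<rho>\<bar>"]) simp
      then show ?thesis by (simp add: meet_in_circle_or_tangency_point_def)
    next
      case True
      have "(\<Inter>i. S i) = {m}" unfolding inter True by auto
      moreover have "tangent_at (S i) (S j) m" for i j
      proof -
        have "m \<in> S k" for k unfolding mem' by (simp add: True)
        then have mS: "m \<in> sphere (m + s k *\<^sub>R e3) (r k)" for k unfolding Ss .
        have "s k \<noteq> 0" for k using e'[of k] r[of k] True by auto
        then have "tangent_vectors (S k) m = {v. v \<bullet> e3 = 0}" for k
          unfolding Ss tangent_vectors_sphere[OF r mS] by simp
        then show ?thesis using \<open>\<And>k. m \<in> S k\<close> by (simp add: tangent_at_def)
      qed
      ultimately show ?thesis by (auto simp: meet_in_circle_or_tangency_point_def)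
    qed
    then show ?thesis by blast
  next
    case False
    define \<kappa> where "\<kappa> = a / b"
    define L where "L = {m + t *\<^sub>R e3 | t. True}"
    have "(1 + \<kappa>\<^sup>2) * b\<^sup>2 = 1" using ab False by (simp add: \<kappa>_def power_divide algebra_simps)
    moreover have "1 + \<kappa>\<^sup>2 \<noteq> 0" by (smt (verit) zero_le_power2)
    ultimately have b2: "b\<^sup>2 = 1 / (1 + \<kappa>\<^sup>2)" by (simp add: field_simps)
    have "(s i * a)\<^sup>2 = (s i * \<kappa>)\<^sup>2 * b\<^sup>2" for i using False by (simp add: \<kappa>_def power_mult_distrib power_divide)
    then have "(s i * a)\<^sup>2 = (s i * \<kappa>)\<^sup>2 / (1 + \<kappa>\<^sup>2)" for i unfolding b2 by simp
    then have e': "\<rho>\<^sup>2 + (s i * \<kappa>)\<^sup>2 / (1 + \<kappa>\<^sup>2) = (r i)\<^sup>2" for i using e[of i] by simp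
    \<comment> \<open>The tangent is not the axis, which passes through the centers at distance
      zero.\<close>
    have nd: "\<rho> \<noteq> 0 \<or> \<kappa> \<noteq> 0" using e'[of i0] r[of i0] by auto
    have "is_line L"
      unfolding is_line_iff_unit L_def using unit(3) by (intro exI[of _ m] exI[of _ e3]) (auto simp: image_def)
    moreover have "range c \<subseteq> L" using s by (auto simp: L_def)
    moreover have "has_curve_of_tangency (S i) (rev_quadric \<rho> \<kappa>)" for i
      unfolding Ss by (rule has_curve_of_tangency_rev_quadric[OF r e'])
    then have "tangent_to_common_quadric_of_revolution L S"
      unfolding tangent_to_common_quadric_of_revolution_def quadric_of_revolution_def L_def
      using quadric_rev_quadric surface_of_revolution_rev_quadric rev_quadric_cases[OF nd] by blast
    ultimately show ?thesis by blast
  qed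
qed

theorem theorem8p12:
  fixes c :: "4 \<Rightarrow> real^3" and r :: "4 \<Rightarrow> real" and S :: "4 \<Rightarrow> (real^3) set"
  assumes "\<And>i. r i > 0"
    and "\<And>i. S i = sphere (c i) (r i)"
    and "inj S"
  shows "(infinite (common_tangent_lines S) \<longleftrightarrow>
           collinear (range c) \<and> common_tangent_lines S \<noteq> {})
       \<and> (infinite (common_tangent_lines S) \<longleftrightarrow>
           meet_in_circle_or_tangency_point S \<or>
           (\<exists>L. is_line L \<and> range c \<subseteq> L \<and> tangent_to_common_quadric_of_revolution L S))"
proof -
  let ?I = "infinite (common_tangent_lines S)"
  let ?C = "collinear (range c) \<and> common_tangent_lines S \<noteq> {}"
  let ?G = "meet_in_circle_or_tangency_point S \<or>
    (\<exists>L. is_line L \<and> range c \<subseteq> L \<and> tangent_to_common_quadric_of_revolution L S)"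
  have "?C" if "?I"
    using infinite_common_tangents_imp_collinear[OF assms that] that by auto
  moreover have "?G" if C: "?C"
  proof -
    obtain l where l: "l \<in> common_tangent_lines S" using C by blast
    have "inj c" using C by (intro common_tangent_centers_inj[OF assms]) blast
    then show ?thesis
      using C l by (intro collinear_common_tangent_configuration[where ?i0.0 = 1 and ?j0.0 = 2, OF assms(1,2)]) auto
  qed
  moreover have "?I" if G: "?G"
    using G unfolding meet_in_circle_or_tangency_point_def
  proof (elim disjE exE conjE)
    assume "is_circle (\<Inter>i. S i)"
    then show "?I" by (rule infinite_common_tangents_circle[OF assms(1,2)])
  next
    fix p assume "\<forall>i j. tangent_at (S i) (S j) p"
    then show "?I" by (intro infinite_common_tangents_point[OF assms(1,2), where p = p]) blast
  next
    fix L assume "range c \<subseteq> L" "tangent_to_common_quadric_of_revolution L S"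
    then show "?I" by (rule infinite_common_tangents_quadric[OF assms(1,2)])
  qed
  ultimately show ?thesis by blast
qed

end
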